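(* Let $(u,v)$ be a $uv$-evolution with homogeneous Neumann boundary conditions in a bounded interval $(a,b)\subseteq\mathbb{R}$, where $u$ denotes the representative that is continuous on $[0,+\infty)$ with values in $L^1((a,b))$. Then the following hold. (1) (Maximum principle) For every $t\ge0$, let $M^+(t)$ and $M^-(t)$ denote, respectively, the essential supremum and the essential infimum of the function $x\mapsto u(t,x)$. Then $t\mapsto M^+(t)$ is nonincreasing on $[0,+\infty)$, and $t\mapsto M^-(t)$ is nondecreasing on $[0,+\infty)$. (2) (Monotonicity of the total variation) For every $t\ge0$, let $TV^+(t)$ and $TV^-(t)$ denote the positive and negative total variation of the function $x\mapsto u(t,x)$. Then the functions $t\mapsto TV^+(t)$ and $t\mapsto TV^-(t)$ are nonincreasing on $[0,+\infty)$.
   Context: A $uv$-evolution with homogeneous Neumann boundary conditions in an interval $(a,b)$ is a pair of measurable functions $u,v:(0,+\infty)\times(a,b)\to\mathbb{R}$ such that: - (time regularity) $u$ admits a weak derivative $u_t$ with respect to time, and $u_t\in L^1((0,T)\times(a,b))$ for every $T>0$; - (space regularity) for almost every $t>0$, $x\mapsto u(t,x)$ is in $BV((a,b))$ and $x\mapsto v(t,x)$ is in $W^{1,1}((a,b))$; - (evolution equation) $u_t(t,x)=v_x(t,x)$ in $(0,+\infty)\times(a,b)$ (as an equality of functions in $L^1((0,T)\times(a,b))$ for every $T>0$); - (Neumann boundary conditions) for almost every $t>0$, $v(t,a)=v(t,b)=0$ (using the continuous extension of $v(t,\cdot)$ to $[a,b]$); - (sign condition) for almost every $t>0$, $v(t,x)\cdot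 Du(t,x)\ge0$ as a measure in $(a,b)$, where $Du$ is the distributional derivative of $x\mapsto u(t,x)$ (a signed measure), multiplied by the continuous function $v(t,\cdot)$. The time regularity implies that $u$ has a representative that is absolutely continuous as a function of time with values in $L^1((a,b))$ and extends continuously up to $t=0$; so $u(t,\cdot)\in L^1((a,b))$ is well defined for every $t\ge0$. The positive total variation of $w\in BV((a,b))$, identified with its left-continuous representative, is $$TV^+(w):=\sup\left\{\sum_{i=1}^{2m}(-1)^iw(x_i):m\ge1,\ a<x_1\le x_2\le\dots\le x_{2m}<b\right\},$$ and $TV^-(w):=TV^+(-w)$. For a general $w\in L^1((a,b))$ the same formula is understood as the supremum over $m\ge 1$ of the essential supremum of $\sum_{i=1}^{2m}(-1)^iw(x_i)$ over $\{a<x_1<\dots<x_{2m}<b\}\subseteq\mathbb{R}^{2m}$, which, when $w\in BV((a,b))$, agrees with the pointwise supremum of $\sum_{i=1}^{2m}(-1)^iw(x_i)$ over all $m\ge1$ and all $a<x_1\le x_2\le\dots\le x_{2m}<b$ computed with the left-continuous representative of $w$. The quantities $M^{\pm}(t)$ and $TV^\pm(t)$ take values in the extended real line. *)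

theory Defs
  imports "HOL-Analysis.Analysis" "HOL-Probability.Essential_Supremum"
begin

subsection \<open>Test functions\<close>

text \<open>In both definitions of smoothness \<open>D\<close> is the family of all iterated (partial) derivatives.\<close>

definition smooth :: "(real \<Rightarrow> real) \<Rightarrow> bool" where
  "smooth \<phi> \<longleftrightarrow> (\<exists>D :: nat \<Rightarrow> real \<Rightarrow> real. D 0 = \<phi> \<and>
     (\<forall>n x. (D n has_real_derivative D (Suc n) x) (at x)))"

definition smooth2 :: "(real \<Rightarrow> real \<Rightarrow> real) \<Rightarrow> bool" where
  "smooth2 \<phi> \<longleftrightarrow> (\<exists>D :: nat \<Rightarrow> nat \<Rightarrow> real \<Rightarrow> real \<Rightarrow> real. D 0 0 = \<phi> \<and>
     (\<forall>i j. continuous_on UNIV (\<lambda>(t, x). D i j t x)) \<and>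
     (\<forall>i j t x. ((\<lambda>s. D i j s x) has_real_derivative D (Suc i) j t x) (at t)) \<and>
     (\<forall>i j t x. ((\<lambda>y. D i j t y) has_real_derivative D i (Suc j) t x) (at x)))"

definition test_fun :: "real set \<Rightarrow> (real \<Rightarrow> real) \<Rightarrow> bool" where
  "test_fun \<Omega> \<phi> \<longleftrightarrow> smooth \<phi> \<and>
     compact (closure {x. \<phi> x \<noteq> 0}) \<and> closure {x. \<phi> x \<noteq> 0} \<subseteq> \<Omega>"

definition test_fun2 :: "(real \<times> real) set \<Rightarrow> (real \<Rightarrow> real \<Rightarrow> real) \<Rightarrow> bool" where
  "test_fun2 \<Omega> \<phi> \<longleftrightarrow> smooth2 \<phi> \<and>
     compact (closure {(t, x). \<phi> t x \<noteq> 0}) \<and> closure {(t, x). \<phi> t x \<noteq> 0} \<subseteq> \<Omega>"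


subsection \<open>Weak derivatives, Sobolev and BV functions\<close>

text \<open>A weak derivative is only meaningful for locally integrable functions, so local
  integrability of the function and of its derivative is part of the definition.\<close>

definition weak_time_deriv ::
  "(real \<times> real) set \<Rightarrow> (real \<Rightarrow> real \<Rightarrow> real) \<Rightarrow> (real \<Rightarrow> real \<Rightarrow> real) \<Rightarrow> bool" where
  "weak_time_deriv \<Omega> u g \<longleftrightarrow>
     (\<forall>K. compact K \<longrightarrow> K \<subseteq> \<Omega> \<longrightarrow>
        integrable (lebesgue_on K) (\<lambda>(t, x). u t x) \<and>
        integrable (lebesgue_on K) (\<lambda>(t, x). g t x)) \<and>
     (\<forall>\<phi>. test_fun2 \<Omega> \<phi> \<longrightarrow>
        integral\<^sup>L (lebesgue_on \<Omega>) (\<lambda>(t, x). u t x * deriv (\<lambda>s. \<phi> s x) t) =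
        - integral\<^sup>L (lebesgue_on \<Omega>) (\<lambda>(t, x). g t x * \<phi> t x))"

definition W11_deriv :: "real \<Rightarrow> real \<Rightarrow> (real \<Rightarrow> real) \<Rightarrow> (real \<Rightarrow> real) \<Rightarrow> bool" where
  "W11_deriv a b w g \<longleftrightarrow>
     integrable (lebesgue_on {a<..<b}) w \<and> integrable (lebesgue_on {a<..<b}) g \<and>
     (\<forall>\<phi>. test_fun {a<..<b} \<phi> \<longrightarrow>
        (LINT x|lebesgue_on {a<..<b}. w x * deriv \<phi> x) =
        - (LINT x|lebesgue_on {a<..<b}. g x * \<phi> x))"

definition W11 :: "real \<Rightarrow> real \<Rightarrow> (real \<Rightarrow> real) \<Rightarrow> bool" where
  "W11 a b w \<longleftrightarrow> (\<exists>g. W11_deriv a b w g)"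

definition continuous_rep :: "real \<Rightarrow> real \<Rightarrow> (real \<Rightarrow> real) \<Rightarrow> (real \<Rightarrow> real) \<Rightarrow> bool" where
  "continuous_rep a b w V \<longleftrightarrow>
     continuous_on {a..b} V \<and> (AE x in lebesgue_on {a<..<b}. V x = w x)"

text \<open>The finite signed measure \<open>Dw\<close> is encoded as a difference \<open>\<mu> - \<nu>\<close> of two finite positive
  Borel measures on \<open>(a,b)\<close>; the pair is not required to be the Jordan decomposition.\<close>

definition BV_deriv ::
  "real \<Rightarrow> real \<Rightarrow> (real \<Rightarrow> real) \<Rightarrow> real measure \<Rightarrow> real measure \<Rightarrow> bool" where
  "BV_deriv a b w \<mu> \<nu> \<longleftrightarrow>
     integrable (lebesgue_on {a<..<b}) w \<and>
     finite_measure \<mu> \<and> sets \<mu> = sets (restrict_space borel {a<..<b}) \<and>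
     finite_measure \<nu> \<and> sets \<nu> = sets (restrict_space borel {a<..<b}) \<and>
     (\<forall>\<phi>. test_fun {a<..<b} \<phi> \<longrightarrow>
        (LINT x|lebesgue_on {a<..<b}. w x * deriv \<phi> x) =
        - ((LINT x|\<mu>. \<phi> x) - (LINT x|\<nu>. \<phi> x)))"

definition BV :: "real \<Rightarrow> real \<Rightarrow> (real \<Rightarrow> real) \<Rightarrow> bool" where
  "BV a b w \<longleftrightarrow> (\<exists>\<mu> \<nu>. BV_deriv a b w \<mu> \<nu>)"

text \<open>Nonnegativity of the signed measure \<open>V (\<mu> - \<nu>)\<close>; it depends on \<open>\<mu>\<close> and \<open>\<nu>\<close> only through
  \<open>\<mu> - \<nu>\<close>.\<close>

definition nonneg_product ::
  "real \<Rightarrow> real \<Rightarrow> (real \<Rightarrow> real) \<Rightarrow> real measure \<Rightarrow> real measure \<Rightarrow> bool" where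
  "nonneg_product a b V \<mu> \<nu> \<longleftrightarrow>
     (\<forall>B \<in> sets (restrict_space borel {a<..<b}).
        (LINT x:B|\<mu>. V x) - (LINT x:B|\<nu>. V x) \<ge> 0)"


subsection \<open>Evolutions\<close>

definition uv_evolution ::
  "real \<Rightarrow> real \<Rightarrow> (real \<Rightarrow> real \<Rightarrow> real) \<Rightarrow> (real \<Rightarrow> real \<Rightarrow> real) \<Rightarrow> bool" where
  "uv_evolution a b u v \<longleftrightarrow>
     (\<lambda>(t, x). u t x) \<in> borel_measurable (lebesgue_on ({0<..} \<times> {a<..<b})) \<and>
     (\<lambda>(t, x). v t x) \<in> borel_measurable (lebesgue_on ({0<..} \<times> {a<..<b})) \<and>
     (AE t in lebesgue_on {0<..}. BV a b (u t)) \<and>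
     (AE t in lebesgue_on {0<..}. W11 a b (v t)) \<and>
     (\<exists>ut vx :: real \<Rightarrow> real \<Rightarrow> real.
        weak_time_deriv ({0<..} \<times> {a<..<b}) u ut \<and>
        (\<forall>T>0. integrable (lebesgue_on ({0<..<T} \<times> {a<..<b})) (\<lambda>(t, x). ut t x)) \<and>
        (AE t in lebesgue_on {0<..}. W11_deriv a b (v t) (vx t)) \<and>
        (\<forall>T>0. integrable (lebesgue_on ({0<..<T} \<times> {a<..<b})) (\<lambda>(t, x). vx t x)) \<and>
        (AE p in lebesgue_on ({0<..} \<times> {a<..<b}). ut (fst p) (snd p) = vx (fst p) (snd p))) \<and>
     (AE t in lebesgue_on {0<..}. \<exists>V. continuous_rep a b (v t) V \<and> V a = 0 \<and> V b = 0) \<and>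
     (AE t in lebesgue_on {0<..}. \<exists>V \<mu> \<nu>. continuous_rep a b (v t) V \<and>
        BV_deriv a b (u t) \<mu> \<nu> \<and> nonneg_product a b V \<mu> \<nu>)"

text \<open>\<open>U\<close> is a continuous curve \<open>[0,\<infinity>) \<rightarrow> L\<^sup>1((a,b))\<close> that agrees with \<open>u\<close> at almost every time;
  the values of \<open>u\<close> at \<open>t \<le> 0\<close> are irrelevant.\<close>

definition L1_continuous_rep ::
  "real \<Rightarrow> real \<Rightarrow> (real \<Rightarrow> real \<Rightarrow> real) \<Rightarrow> (real \<Rightarrow> real \<Rightarrow> real) \<Rightarrow> bool" where
  "L1_continuous_rep a b u U \<longleftrightarrow>
     (\<forall>t\<ge>0. integrable (lebesgue_on {a<..<b}) (U t)) \<and>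
     (\<forall>t\<ge>0. ((\<lambda>s. LINT x|lebesgue_on {a<..<b}. \<bar>U s x - U t x\<bar>) \<longlongrightarrow> 0) (at t within {0..})) \<and>
     (AE t in lebesgue_on {0<..}. AE x in lebesgue_on {a<..<b}. U t x = u t x)"


subsection \<open>Essential bounds and total variations\<close>

definition ess_sup_on :: "real \<Rightarrow> real \<Rightarrow> (real \<Rightarrow> real) \<Rightarrow> ereal" where
  "ess_sup_on a b w = esssup (lebesgue_on {a<..<b}) (\<lambda>x. ereal (w x))"

definition ess_inf_on :: "real \<Rightarrow> real \<Rightarrow> (real \<Rightarrow> real) \<Rightarrow> ereal" where
  "ess_inf_on a b w = - esssup (lebesgue_on {a<..<b}) (\<lambda>x. - ereal (w x))"

text \<open>Lebesgue measure on the simplex \<open>a < x\<^sub>1 < \<dots> < x\<^sub>n < b\<close> of \<open>\<real>\<^sup>n\<close>, whose points are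
  functions on \<open>{1..n}\<close>. The completion matters: the constant \<^const>\<open>esssup\<close> is \<open>top\<close> on
  nonmeasurable functions, and the alternating sums below are in general only Lebesgue
  measurable (see \<open>alternating_sum_measurable\<close>).\<close>

definition simplex_measure :: "real \<Rightarrow> real \<Rightarrow> nat \<Rightarrow> (nat \<Rightarrow> real) measure" where
  "simplex_measure a b n =
     restrict_space (completion (Pi\<^sub>M {1..n} (\<lambda>_. lborel)))
       {x \<in> space (Pi\<^sub>M {1..n} (\<lambda>_. lborel :: real measure)).
          (\<forall>i\<in>{1..n}. a < x i \<and> x i < b) \<and> (\<forall>i\<in>{1..<n}. x i < x (Suc i))}"

definition TV_plus :: "real \<Rightarrow> real \<Rightarrow> (real \<Rightarrow> real) \<Rightarrow> ereal" where
  "TV_plus a b w =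
     (SUP m\<in>{1..}. esssup (simplex_measure a b (2 * m))
        (\<lambda>x. ereal (\<Sum>i=1..2 * m. (-1) ^ i * w (x i))))"

definition TV_minus :: "real \<Rightarrow> real \<Rightarrow> (real \<Rightarrow> real) \<Rightarrow> ereal" where
  "TV_minus a b w = TV_plus a b (\<lambda>x. - w x)"

lemma alternating_sum_measurable:
  assumes "w \<in> borel_measurable (lebesgue_on {a<..<b})"
  shows "(\<lambda>x. ereal (\<Sum>i=1..n. (-1) ^ i * w (x i))) \<in> borel_measurable (simplex_measure a b n)"
proof -
  let ?P = "Pi\<^sub>M {1..n} (\<lambda>_. lborel :: real measure)"
  let ?S = "{x \<in> space ?P. (\<forall>i\<in>{1..n}. a < x i \<and> x i < b) \<and> (\<forall>i\<in>{1..<n}. x i < x (Suc i))}"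
  interpret product_sigma_finite "\<lambda>_::nat. lborel :: real measure" ..
  interpret finite_product_sigma_finite "\<lambda>_::nat. lborel :: real measure" "{1..n}"
    by standard simp
  let ?w = "\<lambda>x. if x \<in> {a<..<b} then w x else 0"
  have "?w \<in> borel_measurable lebesgue"
    using assms by (subst (asm) borel_measurable_if[symmetric]) auto
  have comp: "(\<lambda>x. ?w (x i)) \<in> borel_measurable (completion ?P)" if i: "i \<in> {1..n}" for i
  proof -
    have proj: "(\<lambda>x. x i) \<in> ?P \<rightarrow>\<^sub>M lborel"
      using i by (rule measurable_component_singleton)
    have null: "(\<lambda>x. x i) -` N \<inter> space (completion ?P) \<in> null_sets (completion ?P)"
      if N: "N \<in> null_sets lborel" for N
    proof -
      have "(\<lambda>x. x i) -` N \<inter> space ?P = Pi\<^sub>E {1..n} (\<lambda>j. if j = i then N else UNIV)"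
        using i by (force simp: space_PiM PiE_iff split: if_splits)
      moreover have "emeasure ?P (Pi\<^sub>E {1..n} (\<lambda>j. if j = i then N else UNIV)) =
          (\<Prod>j\<in>{1..n}. emeasure lborel (if j = i then N else UNIV))"
        using N by (intro emeasure_PiM) (auto simp: null_sets_def)
      moreover have "\<dots> = 0"
        using i N by (intro prod_zero bexI[of _ i]) (auto simp: null_sets_def)
      moreover have "(\<lambda>x. x i) -` N \<inter> space ?P \<in> sets ?P"
        using proj N by (intro measurable_sets[OF proj]) auto
      ultimately have "(\<lambda>x. x i) -` N \<inter> space ?P \<in> null_sets ?P"
        by (auto simp: null_sets_def)
      then show ?thesis
        by (simp add: null_sets_completionI)
    qed
    have "null_sets lborel \<subseteq> null_sets (distr (completion ?P) lborel (\<lambda>x. x i))"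
      using null measurable_completion[OF proj] by (auto simp: null_sets_def emeasure_distr simp del: emeasure_completion)
    then have "(\<lambda>x. x i) \<in> completion ?P \<rightarrow>\<^sub>M lebesgue"
      by (rule completion.measurable_completion2[OF measurable_completion[OF proj]])
    from measurable_compose[OF this \<open>?w \<in> borel_measurable lebesgue\<close>] show ?thesis .
  qed
  have "(\<lambda>x. \<Sum>i=1..n. (-1) ^ i * ?w (x i)) \<in> borel_measurable (completion ?P)"
    using comp by (intro borel_measurable_sum borel_measurable_times) auto
  then have "(\<lambda>x. \<Sum>i=1..n. (-1) ^ i * ?w (x i)) \<in> borel_measurable (simplex_measure a b n)"
    unfolding simplex_measure_def by (rule measurable_restrict_space1)
  moreover have "(\<Sum>i=1..n. (-1) ^ i * ?w (x i)) = (\<Sum>i=1..n. (-1) ^ i * w (x i))"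
    if "x \<in> space (simplex_measure a b n)" for x
    using that by (intro sum.cong) (auto simp: simplex_measure_def space_restrict_space)
  ultimately have "(\<lambda>x. \<Sum>i=1..n. (-1) ^ i * w (x i)) \<in> borel_measurable (simplex_measure a b n)"
    by (simp cong: measurable_cong)
  then show ?thesis by measurable
qed

end

theory Submission
  imports Defs "HOL-Probability.Infinite_Product_Measure"
begin

text \<open>
  For a function \<open>w\<close> on \<open>(a,b)\<close> let \<open>W(x\<^sub>1,\<dots>,x\<^sub>n) = \<Sum> (-1)\<^sup>i w(x\<^sub>i)\<close> be its alternating sum on the
  simplex \<open>a < x\<^sub>1 < \<dots> < x\<^sub>n < b\<close>. The maximum principle and the monotonicity of the total
  variations are instances of one fact: a bound \<open>W \<le> k\<close> that holds almost everywhere for \<open>u(s)\<close>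
  holds almost everywhere for \<open>u(t)\<close> whenever \<open>s \<le> t\<close>. Applied to \<open>u\<close> and to \<open>-u\<close>, the case
  \<open>n = 1\<close> yields the essential infimum and supremum, and \<open>n = 2m\<close> yields \<open>TV\<^sup>+\<close> and \<open>TV\<^sup>-\<close>.

  The fact (lemma \<open>oscillation_le_propagates\<close>) is a maximum principle on the simplex, proved by
  induction on \<open>n\<close> in steps of two. Along the evolution \<open>W\<close> has the time derivative
  \<open>\<Sum> (-1)\<^sup>i v\<^sub>x(t,x\<^sub>i)\<close>. For a convex nondecreasing \<open>\<Phi>\<close> that vanishes exactly on \<open>(-\<infinity>,0]\<close>, the
  integral of \<open>\<Phi>(W - k)\<close> over the simplex grows at the rate
  \<open>\<Sum>\<^sub>i \<integral> \<Phi>'(W - k) (-1)\<^sup>i v\<^sub>x(t,x\<^sub>i)\<close>, and every summand is nonpositive. To see this, integrate in \<open>x\<^sub>i\<close>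
  first, over the interval \<open>(p,q)\<close> between its neighbours. On each component of \<open>{v \<noteq> 0}\<close> the sign
  condition makes \<open>u\<close> monotone, increasing where \<open>v > 0\<close> and decreasing where \<open>v < 0\<close>, so that the
  second mean value theorem gives the sign of the integral up to boundary terms at \<open>p\<close> and \<open>q\<close>
  (lemma \<open>flux_nonpos\<close>). At \<open>a\<close> and \<open>b\<close> these vanish because \<open>v\<close> does. At a neighbour \<open>x\<^sub>i\<^sub>\<plusminus>\<^sub>1\<close> the
  two terms of \<open>W\<close> cancel, what is left is an alternating sum of \<open>n - 2\<close> points, and it is at most
  \<open>k\<close> by the induction hypothesis; so \<open>\<Phi>'(W - k) = 0\<close> there. The hypothesis applies because the bound
  \<open>k\<close> for \<open>n\<close> points implies the same bound for \<open>n - 2\<close> points: the last two points can be added with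
  almost equal values of \<open>w\<close>.

  The rest translates the weak formulation. Every distributional identity is tested with
  \<open>trapezoids\<close>, limits of test functions whose derivative is a difference of two indicator functions;
  together with Lebesgue points this yields that \<open>v(t)\<close> is a primitive of \<open>v\<^sub>x(t)\<close>, that \<open>u(t)\<close> is
  monotone where \<open>v(t) \<noteq> 0\<close> (\<open>monotone_where_positive\<close>), and that
  \<open>u(t) = u(s) + \<integral>\<^sub>s\<^sup>t v\<^sub>x\<close> (\<open>borel_representative_flow\<close>). Bounds almost everywhere on the simplex
  are exchanged for bounds at all points off a null set of the line by \<open>oscillation_le_of_AE_PiM\<close> and
  \<open>AE_PiM_of_oscillation_le\<close>.
\<close>


section \<open>Smooth cut-off functions\<close>

text \<open>Smoothness by coinduction: in a set of functions that is closed under taking some derivative, all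
  iterated derivatives of each member can be chosen. This avoids explicit formulas for them.\<close>

lemma smooth_closedI:
  assumes "f \<in> C" and "\<And>g. g \<in> C \<Longrightarrow> \<exists>g'\<in>C. \<forall>x. (g has_real_derivative g' x) (at x)"
  shows "smooth f"
proof -
  from assms(2) obtain d where d: "\<And>g. g \<in> C \<Longrightarrow> d g \<in> C \<and> (\<forall>x. (g has_real_derivative d g x) (at x))"
    by metis
  have mem: "(d ^^ n) f \<in> C" for n
    by (induction n) (use assms(1) d in auto)
  show ?thesis
    unfolding smooth_def
    by (rule exI[of _ "\<lambda>n. (d ^^ n) f"]) (use d mem in auto)
qed

lemma smooth_affine:
  assumes "smooth f"
  shows "smooth (\<lambda>x. f (c * x + e))"
proof -
  from assms obtain D where D: "D 0 = f" "\<And>n x. (D n has_real_derivative D (Suc n) x) (at x)"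
    unfolding smooth_def by blast
  have "((\<lambda>x. c ^ n * D n (c * x + e)) has_real_derivative c ^ Suc n * D (Suc n) (c * x + e)) (at x)" for n x
    by (rule derivative_eq_intros DERIV_chain2[OF D(2)] refl | simp)+
  then show ?thesis
    unfolding smooth_def using D(1)
    by (intro exI[of _ "\<lambda>n x. c ^ n * D n (c * x + e)"]) auto
qed

lemma smooth_lincomb:
  assumes "smooth f" "smooth g"
  shows "smooth (\<lambda>x. c * f x + e * g x)"
proof -
  from assms obtain D E where D: "D 0 = f" "\<And>n x. (D n has_real_derivative D (Suc n) x) (at x)"
    and E: "E 0 = g" "\<And>n x. (E n has_real_derivative E (Suc n) x) (at x)"
    unfolding smooth_def by metis
  have "((\<lambda>x. c * D n x + e * E n x) has_real_derivative c * D (Suc n) x + e * E (Suc n) x) (at x)" for n x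
    by (auto intro!: derivative_eq_intros D E)
  then show ?thesis
    unfolding smooth_def using D(1) E(1)
    by (intro exI[of _ "\<lambda>n x. c * D n x + e * E n x"]) auto
qed

text \<open>The functions \<open>exp (-1/x) / x\<^sup>n\<close>, extended by zero, span a space that is closed under
  differentiation; \<open>n = 0\<close> is the classical flat function.\<close>

definition flat_exp :: "nat \<Rightarrow> real \<Rightarrow> real" where
  "flat_exp n x = (if x > 0 then exp (- 1 / x) / x ^ n else 0)"

lemma flat_exp_tendsto_0: "((\<lambda>x. exp (- 1 / x) / x ^ n) \<longlongrightarrow> (0::real)) (at_right 0)"
proof -
  have "((\<lambda>x. (inverse x) ^ n / exp (inverse x)) \<longlongrightarrow> (0::real)) (at_right 0)"
    by (rule filterlim_compose[OF tendsto_power_div_exp_0 filterlim_inverse_at_top_right])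
  moreover have "(inverse x) ^ n / exp (inverse x) = exp (- 1 / x) / x ^ n" for x :: real
    by (simp add: exp_minus divide_simps)
  ultimately show ?thesis by simp
qed

lemma flat_exp_deriv:
  "(flat_exp n has_real_derivative flat_exp (n + 2) x + (- real n) * flat_exp (n + 1) x) (at x)"
proof -
  consider "x > 0" | "x < 0" | "x = 0" by linarith
  then show ?thesis
  proof cases
    case 1
    have e: "((\<lambda>x. exp (- 1 / x)) has_real_derivative exp (- 1 / x) / x\<^sup>2) (at x)"
      using 1 by (auto intro!: derivative_eq_intros simp: power2_eq_square)
    have "((\<lambda>x. exp (- 1 / x) / x ^ n) has_real_derivative
        flat_exp (n + 2) x + (- real n) * flat_exp (n + 1) x) (at x)"
      by (rule DERIV_cong[OF DERIV_divide[OF e DERIV_pow[of n x UNIV]]])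
        (use 1 in simp, cases n, use 1 in \<open>auto simp: flat_exp_def field_simps power2_eq_square\<close>)
    moreover have "\<forall>\<^sub>F y in nhds x. flat_exp n y = exp (- 1 / y) / y ^ n"
      using eventually_nhds_in_open[of "{0<..}" x] 1
      by (auto elim!: eventually_mono simp: flat_exp_def)
    ultimately show ?thesis
      by (subst DERIV_cong_ev[OF refl _ refl]) 
  next
    case 2
    have "\<forall>\<^sub>F y in nhds x. flat_exp n y = 0"
      using eventually_nhds_in_open[of "{..<0}" x] 2
      by (auto elim!: eventually_mono simp: flat_exp_def)
    then have "(flat_exp n has_real_derivative 0) (at x)"
      by (subst DERIV_cong_ev[OF refl _ refl]) auto
    with 2 show ?thesis by (simp add: flat_exp_def)
  next
    case 3
    have "((\<lambda>h. flat_exp n h / h) \<longlongrightarrow> 0) (at 0)"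
      unfolding filterlim_split_at
    proof (intro filterlim_split_at)
      show "((\<lambda>h. flat_exp n h / h) \<longlongrightarrow> 0) (at_left 0)"
        by (rule tendsto_eventually) (auto simp: flat_exp_def eventually_at_filter)
      have "\<forall>\<^sub>F h in at_right 0. exp (- 1 / h) / h ^ Suc n = flat_exp n h / h"
        by (auto simp: flat_exp_def eventually_at_filter)
      from tendsto_cong[THEN iffD1, OF this flat_exp_tendsto_0]
      show "((\<lambda>h. flat_exp n h / h) \<longlongrightarrow> 0) (at_right 0)" .
    qed
    with 3 show ?thesis
      by (simp add: DERIV_def flat_exp_def)
  qed
qed

definition smooth_step :: "real \<Rightarrow> real" where
  "smooth_step x = flat_exp 0 x / (flat_exp 0 x + flat_exp 0 (1 - x))"

lemma flat_exp_sum_pos: "flat_exp 0 x + flat_exp 0 (1 - x) > 0"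
  unfolding flat_exp_def by (cases "x > 0"; cases "x < 1") (auto intro: add_pos_pos)

text \<open>The algebra generated by the derivatives of the numerator of the smooth step, their reflections, and
  the reciprocal of its denominator. It is closed under differentiation because the derivative of a
  reciprocal is a polynomial in the reciprocal and the derivatives of the denominator.\<close>

inductive_set step_class :: "(real \<Rightarrow> real) set" where
  "flat_exp n \<in> step_class"
| "(\<lambda>x. flat_exp n (1 - x)) \<in> step_class"
| "(\<lambda>x. inverse (flat_exp 0 x + flat_exp 0 (1 - x))) \<in> step_class"
| "(\<lambda>x. c) \<in> step_class"
| "f \<in> step_class \<Longrightarrow> g \<in> step_class \<Longrightarrow> (\<lambda>x. f x + g x) \<in> step_class"
| "f \<in> step_class \<Longrightarrow> g \<in> step_class \<Longrightarrow> (\<lambda>x. f x * g x) \<in> step_class"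

lemma flat_exp_deriv_reflected:
  "((\<lambda>x. flat_exp n (1 - x)) has_real_derivative
     (- 1) * (flat_exp (n + 2) (1 - x) + (- real n) * flat_exp (n + 1) (1 - x))) (at x)"
proof -
  have "((\<lambda>x. 1 - x) has_real_derivative - 1) (at x)"
    by (auto intro!: derivative_eq_intros)
  from DERIV_chain2[where f = "flat_exp n" and g = "\<lambda>x. 1 - x", OF flat_exp_deriv this]
  show ?thesis by simp
qed

lemma step_class_deriv:
  "f \<in> step_class \<Longrightarrow> \<exists>f'\<in>step_class. \<forall>x. (f has_real_derivative f' x) (at x)"
proof (induction rule: step_class.induct)
  case (1 n)
  show ?case
    by (rule bexI, rule allI, rule flat_exp_deriv) (intro step_class.intros)
next
  case (2 n)
  show ?case
    by (rule bexI, rule allI, rule flat_exp_deriv_reflected) (intro step_class.intros)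
next
  case 3
  let ?r = "\<lambda>x. inverse (flat_exp 0 x + flat_exp 0 (1 - x))"
  have "(?r has_real_derivative (- 1) * ((flat_exp 2 x + (- 1) * flat_exp 2 (1 - x)) * (?r x * ?r x))) (at x)" for x
    using flat_exp_sum_pos[of x]
    by (auto intro!: derivative_eq_intros flat_exp_deriv[of 0, simplified] flat_exp_deriv_reflected[of 0, simplified]
      simp: field_simps power2_eq_square numeral_2_eq_2)
  then show ?case
    by (intro bexI[of _ "\<lambda>x. (- 1) * ((flat_exp 2 x + (- 1) * flat_exp 2 (1 - x)) * (?r x * ?r x))"] allI)
       (blast, intro step_class.intros)
next
  case (4 c)
  show ?case by (rule bexI[of _ "\<lambda>x. 0"]) (auto intro: step_class.intros)
next
  case (5 f g)
  then obtain f' g' where *: "f' \<in> step_class" "g' \<in> step_class"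
    "\<And>x. (f has_real_derivative f' x) (at x)" "\<And>x. (g has_real_derivative g' x) (at x)" by blast
  then show ?case
    by (intro bexI[of _ "\<lambda>x. f' x + g' x"]) (auto intro!: step_class.intros derivative_eq_intros)
next
  case (6 f g)
  then obtain f' g' where *: "f' \<in> step_class" "g' \<in> step_class"
    "\<And>x. (f has_real_derivative f' x) (at x)" "\<And>x. (g has_real_derivative g' x) (at x)" by blast
  then show ?case using 6
    by (intro bexI[of _ "\<lambda>x. f' x * g x + g' x * f x"]) (auto intro!: step_class.intros derivative_eq_intros)
qed

lemma smooth_smooth_step: "smooth smooth_step"
proof -
  have "smooth_step = (\<lambda>x. flat_exp 0 x * inverse (flat_exp 0 x + flat_exp 0 (1 - x)))"
    by (auto simp: smooth_step_def divide_inverse)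
  moreover have "(\<lambda>x. flat_exp 0 x * inverse (flat_exp 0 x + flat_exp 0 (1 - x))) \<in> step_class"
    by (intro step_class.intros)
  ultimately show ?thesis
    using smooth_closedI[OF _ step_class_deriv] by metis
qed

lemma smooth_step_0: "x \<le> 0 \<Longrightarrow> smooth_step x = 0"
  and smooth_step_1: "x \<ge> 1 \<Longrightarrow> smooth_step x = 1"
  and smooth_step_ge_0: "0 \<le> smooth_step x"
  and smooth_step_le_1: "smooth_step x \<le> 1"
  using flat_exp_sum_pos[of x]
  by (auto simp: smooth_step_def flat_exp_def divide_simps split: if_splits)

lemma flat_exp_mono: "x \<le> y \<Longrightarrow> flat_exp 0 x \<le> flat_exp 0 y"
  by (auto simp: flat_exp_def field_simps)

lemma smooth_step_mono: "x \<le> y \<Longrightarrow> smooth_step x \<le> smooth_step y"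
proof -
  assume "x \<le> y"
  have "flat_exp 0 x * flat_exp 0 (1 - y) \<le> flat_exp 0 y * flat_exp 0 (1 - x)"
    using \<open>x \<le> y\<close> by (intro mult_mono flat_exp_mono) (auto simp: flat_exp_def)
  then show ?thesis
    unfolding smooth_step_def using flat_exp_sum_pos[of x] flat_exp_sum_pos[of y]
    by (simp add: divide_simps algebra_simps)
qed

lemma smooth_continuous_on: "smooth f \<Longrightarrow> continuous_on A f"
  unfolding smooth_def by (metis DERIV_isCont continuous_at_imp_continuous_on)


section \<open>Trapezoids as limits of test functions\<close>

lemma smooth_ramp_ex: "\<exists>S. (\<forall>x. (S has_real_derivative smooth_step x) (at x)) \<and> S 0 = 0"
proof -
  have "isCont smooth_step x" for x
    using smooth_continuous_on[OF smooth_smooth_step, of UNIV] by (simp add: continuous_on_eq_continuous_at)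
  then obtain F where "\<And>x. (F has_vector_derivative smooth_step x) (at x)"
    using einterval_antiderivative[of "-\<infinity>" "\<infinity>" smooth_step] by auto
  then have "((\<lambda>x. F x - F 0) has_real_derivative smooth_step x) (at x)" for x
    by (auto intro!: derivative_eq_intros simp: has_real_derivative_iff_has_vector_derivative[symmetric])
  then show ?thesis by (intro exI[of _ "\<lambda>x. F x - F 0"]) auto
qed

text \<open>The antiderivative of the smooth step that vanishes at \<open>0\<close>: a smooth version of \<open>max x 0\<close>.\<close>

definition smooth_ramp :: "real \<Rightarrow> real" where
  "smooth_ramp = (SOME S. (\<forall>x. (S has_real_derivative smooth_step x) (at x)) \<and> S 0 = 0)"

lemma smooth_ramp_deriv: "(smooth_ramp has_real_derivative smooth_step x) (at x)"
  and smooth_ramp_0: "smooth_ramp 0 = 0"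
  using someI_ex[OF smooth_ramp_ex] unfolding smooth_ramp_def by auto

lemma smooth_smooth_ramp: "smooth smooth_ramp"
proof -
  obtain D where D: "D 0 = smooth_step" "\<And>n x. (D n has_real_derivative D (Suc n) x) (at x)"
    using smooth_smooth_step unfolding smooth_def by blast
  have "((case n of 0 \<Rightarrow> smooth_ramp | Suc m \<Rightarrow> D m) has_real_derivative
      (case Suc n of 0 \<Rightarrow> smooth_ramp | Suc m \<Rightarrow> D m) x) (at x)" for n x
    using D smooth_ramp_deriv by (cases n) auto
  then show ?thesis
    unfolding smooth_def by (intro exI[of _ "case_nat smooth_ramp D"]) auto
qed

lemma smooth_ramp_nonpos: "x \<le> 0 \<Longrightarrow> smooth_ramp x = 0"
proof -
  assume "x \<le> 0"
  have "x = 0 \<or> smooth_ramp x = smooth_ramp 0"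
  proof (cases "x = 0")
    case False
    with \<open>x \<le> 0\<close> have "x < 0" by simp
    then obtain z where "x < z" "z < 0" "smooth_ramp 0 - smooth_ramp x = (0 - x) * smooth_step z"
      using MVT2[of x 0 smooth_ramp smooth_step] smooth_ramp_deriv by auto
    then show ?thesis by (simp add: smooth_step_0)
  qed simp
  then show ?thesis using smooth_ramp_0 by auto
qed

lemma smooth_ramp_ge_1: "x \<ge> 1 \<Longrightarrow> smooth_ramp x = smooth_ramp 1 + (x - 1)"
proof (cases "x = 1")
  case False
  assume "x \<ge> 1"
  with False have "1 < x" by simp
  then obtain z where "1 < z" "z < x" "smooth_ramp x - smooth_ramp 1 = (x - 1) * smooth_step z"
    using MVT2[of 1 x smooth_ramp smooth_step] smooth_ramp_deriv by auto
  then show ?thesis by (simp add: smooth_step_1)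
qed simp

lemma smooth_step_scaled_tendsto:
  assumes "filterlim r at_top sequentially"
  shows "(\<lambda>n. smooth_step (r n * y)) \<longlonglongrightarrow> (if y > 0 then 1 else 0)"
proof (cases "y > 0")
  case True
  have "\<forall>\<^sub>F n in sequentially. r n \<ge> 1 / y"
    using assms by (simp add: filterlim_at_top)
  then have "\<forall>\<^sub>F n in sequentially. smooth_step (r n * y) = 1"
    by eventually_elim (use True in \<open>auto simp: field_simps intro!: smooth_step_1\<close>)
  with True show ?thesis by (simp add: tendsto_eventually)
next
  case False
  have "\<forall>\<^sub>F n in sequentially. r n \<ge> 0"
    using assms by (simp add: filterlim_at_top)
  then have "\<forall>\<^sub>F n in sequentially. smooth_step (r n * y) = 0"
    by eventually_elim (use False in \<open>auto simp: mult_nonneg_nonpos intro!: smooth_step_0\<close>)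
  with False show ?thesis by (simp add: tendsto_eventually)
qed

lemma smooth_ramp_scaled_tendsto:
  assumes "filterlim r at_top sequentially"
  shows "(\<lambda>n. smooth_ramp (r n * y) / r n) \<longlonglongrightarrow> max y 0"
proof (cases "y > 0")
  case True
  have "\<forall>\<^sub>F n in sequentially. r n \<ge> max 1 (1 / y)"
    using assms unfolding filterlim_at_top by blast
  then have "\<forall>\<^sub>F n in sequentially. (smooth_ramp 1 - 1) / r n + y = smooth_ramp (r n * y) / r n"
  proof eventually_elim
    case (elim n)
    then have "r n * y \<ge> 1" using True by (simp add: field_simps)
    from elim smooth_ramp_ge_1[OF this] show ?case by (simp add: field_simps)
  qed
  moreover have "(\<lambda>n. (smooth_ramp 1 - 1) / r n + y) \<longlonglongrightarrow> 0 + y"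
    by (intro tendsto_intros real_tendsto_divide_at_top[OF tendsto_const assms])
  ultimately show ?thesis using True
    by (simp add: tendsto_cong)
next
  case False
  have "\<forall>\<^sub>F n in sequentially. r n \<ge> 0"
    using assms by (simp add: filterlim_at_top)
  then have "\<forall>\<^sub>F n in sequentially. smooth_ramp (r n * y) / r n = 0"
    by eventually_elim (use False in \<open>auto simp: mult_nonneg_nonpos smooth_ramp_nonpos\<close>)
  with False show ?thesis by (simp add: tendsto_eventually)
qed

text \<open>The primitive, vanishing far to the left, of the difference of the indicators of two intervals of
  length \<open>h\<close> that start at \<open>p\<close> and at \<open>q\<close>. Testing with it compares the averages of a function over
  these intervals.\<close>

definition trapezoid :: "real \<Rightarrow> real \<Rightarrow> real \<Rightarrow> real \<Rightarrow> real" where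
  "trapezoid p q h x = min (max (x - p) 0) h - min (max (x - q) 0) h"

definition trapezoid_deriv :: "real \<Rightarrow> real \<Rightarrow> real \<Rightarrow> real \<Rightarrow> real" where
  "trapezoid_deriv p q h x = indicator {p<..p + h} x - indicator {q<..q + h} x"

text \<open>The trapezoid with \<open>max x 0\<close> replaced by \<open>smooth_ramp (r * x) / r\<close>, which tends to it as \<open>r\<close> grows.\<close>

definition soft_trapezoid :: "real \<Rightarrow> real \<Rightarrow> real \<Rightarrow> real \<Rightarrow> real \<Rightarrow> real" where
  "soft_trapezoid r p q h x =
     (smooth_ramp (r * (x - p)) / r - smooth_ramp (r * (x - p - h)) / r)
     - (smooth_ramp (r * (x - q)) / r - smooth_ramp (r * (x - q - h)) / r)"

lemma smooth_soft_trapezoid: "smooth (soft_trapezoid r p q h)"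
proof -
  have 1: "smooth (\<lambda>x. 1 / r * smooth_ramp (r * x + - r * c) + - (1 / r) * smooth_ramp (r * x + - r * (c + h)))" for c
    by (intro smooth_lincomb smooth_affine smooth_smooth_ramp)
  have "smooth (\<lambda>x. 1 * (1 / r * smooth_ramp (r * x + - r * p) + - (1 / r) * smooth_ramp (r * x + - r * (p + h))) +
     (- 1) * (1 / r * smooth_ramp (r * x + - r * q) + - (1 / r) * smooth_ramp (r * x + - r * (q + h))))"
    by (intro smooth_lincomb[of _ _ 1 "-1"] 1)
  also have "(\<lambda>x. 1 * (1 / r * smooth_ramp (r * x + - r * p) + - (1 / r) * smooth_ramp (r * x + - r * (p + h))) +
     (- 1) * (1 / r * smooth_ramp (r * x + - r * q) + - (1 / r) * smooth_ramp (r * x + - r * (q + h)))) =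
     soft_trapezoid r p q h"
    by (rule ext) (simp add: soft_trapezoid_def algebra_simps)
  finally show ?thesis .
qed

lemma ramp_diff_deriv:
  assumes "r > 0"
  shows "((\<lambda>x. smooth_ramp (r * x) / r - smooth_ramp (r * (x - h)) / r)
    has_real_derivative smooth_step (r * x) - smooth_step (r * (x - h))) (at x)"
proof -
  have *: "((\<lambda>x. smooth_ramp (r * (x - c)) / r) has_real_derivative smooth_step (r * (x - c))) (at x)" for c
  proof -
    have "((\<lambda>x. r * (x - c)) has_real_derivative r) (at x)"
      by (auto intro!: derivative_eq_intros)
    from DERIV_cdivide[OF DERIV_chain2[where f = smooth_ramp and g = "\<lambda>x. r * (x - c)", OF smooth_ramp_deriv this], of r]
    show ?thesis using assms by simp
  qed
  show ?thesis
    using DERIV_diff[OF *[of 0] *[of h]] by simp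
qed

lemma ramp_diff_mono:
  assumes "r > 0" "h \<ge> 0" "x \<le> y"
  shows "smooth_ramp (r * x) / r - smooth_ramp (r * (x - h)) / r
     \<le> smooth_ramp (r * y) / r - smooth_ramp (r * (y - h)) / r"
proof (rule DERIV_nonneg_imp_nondecreasing[OF \<open>x \<le> y\<close>])
  fix z
  show "\<exists>d. ((\<lambda>x. smooth_ramp (r * x) / r - smooth_ramp (r * (x - h)) / r) has_real_derivative d) (at z) \<and> 0 \<le> d"
    using ramp_diff_deriv[OF assms(1), of h z] smooth_step_mono[of "r * (z - h)" "r * z"] assms
    by (intro exI[of _ "smooth_step (r * z) - smooth_step (r * (z - h))"]) (auto simp: mult_left_mono)
qed

lemma ramp_diff_left: "r > 0 \<Longrightarrow> h \<ge> 0 \<Longrightarrow> x \<le> 0 \<Longrightarrow>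
    smooth_ramp (r * x) / r - smooth_ramp (r * (x - h)) / r = 0"
  by (simp add: smooth_ramp_nonpos mult_nonneg_nonpos)

lemma ramp_diff_right:
  assumes "r > 0" "h \<ge> 0" "x \<ge> h + 1 / r"
  shows "smooth_ramp (r * x) / r - smooth_ramp (r * (x - h)) / r = h"
proof -
  have "r * (x - h) \<ge> 1" using assms by (simp add: field_simps)
  moreover have "r * (x - h) \<le> r * x" using assms by simp
  ultimately have "r * x \<ge> 1" by linarith
  show ?thesis
    using assms(1) smooth_ramp_ge_1[OF \<open>r * x \<ge> 1\<close>] smooth_ramp_ge_1[OF \<open>r * (x - h) \<ge> 1\<close>]
    by (simp add: field_simps)
qed

lemma ramp_diff_bounds:
  assumes "r > 0" "h \<ge> 0"
  shows "0 \<le> smooth_ramp (r * x) / r - smooth_ramp (r * (x - h)) / r"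
    "smooth_ramp (r * x) / r - smooth_ramp (r * (x - h)) / r \<le> h"
  using ramp_diff_mono[OF assms, of "min x 0" x] ramp_diff_left[OF assms, of "min x 0"]
    ramp_diff_mono[OF assms, of x "max x (h + 1 / r)"] ramp_diff_right[OF assms, of "max x (h + 1 / r)"]
  by auto

text \<open>The monotonicity of the smooth step makes \<open>x \<mapsto> R x - R (x - h)\<close> increasing for the rescaled ramp \<open>R\<close>,
  and a soft trapezoid is the difference of two translates of this function; hence it is nonnegative,
  as the sign condition on the evolution requires. The support is \<open>[p, c]\<close> with \<open>c\<close> slightly larger than
  \<open>q + h\<close>, uniformly in the sequence.\<close>

lemma trapezoid_approx:
  assumes "a < p" "p \<le> q" "q + h < b" "0 < h"
  obtains c and \<phi> :: "nat \<Rightarrow> real \<Rightarrow> real" where "c < b" "q + h < c"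
    "\<And>n. test_fun {a<..<b} (\<phi> n)" "\<And>n x. x \<notin> {p..c} \<Longrightarrow> \<phi> n x = 0"
    "\<And>n x. 0 \<le> \<phi> n x" "\<And>n x. \<phi> n x \<le> h" "\<And>n x. \<bar>deriv (\<phi> n) x\<bar> \<le> 1"
    "\<And>n x. x \<notin> {p..c} \<Longrightarrow> deriv (\<phi> n) x = 0"
    "\<And>x. (\<lambda>n. \<phi> n x) \<longlonglongrightarrow> trapezoid p q h x"
    "\<And>x. (\<lambda>n. deriv (\<phi> n) x) \<longlonglongrightarrow> trapezoid_deriv p q h x"
    "\<And>n. continuous_on UNIV (deriv (\<phi> n))"
proof -
  \<comment> \<open>The support reaches \<open>q + h + 1 / r n\<close>, so the scales \<open>r n\<close> start large enough to make this at most \<open>c\<close>.\<close>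
  define c where "c = (q + h + b) / 2"
  define r where "r n = real n + 1 / (c - q - h)" for n
  have c: "c < b" "q + h < c" using assms by (auto simp: c_def)
  have r: "r n > 0" "r n \<ge> 1 / (c - q - h)" for n using c by (auto simp: r_def add_nonneg_pos)
  have "filterlim (\<lambda>n. 1 / (c - q - h) + real n) at_top sequentially"
    by (rule filterlim_tendsto_add_at_top[OF tendsto_const filterlim_real_sequentially])
  then have rl: "filterlim r at_top sequentially"
    by (simp add: r_def[abs_def] add.commute)
  let ?E = "\<lambda>n x. smooth_ramp (r n * x) / r n - smooth_ramp (r n * (x - h)) / r n"
  define \<phi> where "\<phi> n = soft_trapezoid (r n) p q h" for n
  have \<phi>E: "\<phi> n x = ?E n (x - p) - ?E n (x - q)" for n x
    by (simp add: \<phi>_def soft_trapezoid_def)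
  let ?s = "\<lambda>n y. smooth_step (r n * y) - smooth_step (r n * (y - h))"
  have d: "(\<phi> n has_real_derivative ?s n (x - p) - ?s n (x - q)) (at x)" for n x
  proof -
    have *: "((\<lambda>x. ?E n (x - e)) has_real_derivative ?s n (x - e)) (at x)" for e
    proof -
      have "((\<lambda>x. x - e) has_real_derivative 1) (at x)"
        by (auto intro!: derivative_eq_intros)
      from DERIV_chain2[where f = "?E n" and g = "\<lambda>x. x - e", OF ramp_diff_deriv[OF r(1)] this]
      show ?thesis by simp
    qed
    have "\<phi> n = (\<lambda>x. ?E n (x - p) - ?E n (x - q))" using \<phi>E by auto
    then show ?thesis using DERIV_diff[OF *[of p] *[of q]] by metis
  qed
  then have deriv: "deriv (\<phi> n) x = ?s n (x - p) - ?s n (x - q)" for n x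
    by (rule DERIV_imp_deriv)
  have s01: "0 \<le> ?s n y" "?s n y \<le> 1" for n y
    using smooth_step_mono[of "r n * (y - h)" "r n * y"] r[of n] \<open>0 < h\<close>
      smooth_step_le_1[of "r n * y"] smooth_step_ge_0[of "r n * (y - h)"]
    by (auto simp: mult_left_mono)
  have rc: "1 / r n \<le> c - q - h" for n
    using r[of n] c by (simp add: field_simps)
  have z: "\<phi> n x = 0" if "x \<notin> {p..c}" for n x
  proof (cases "x < p")
    case True
    then show ?thesis unfolding \<phi>E using assms r by (simp add: ramp_diff_left)
  next
    case False
    with that have "x > c" by auto
    then have "x - q \<ge> h + 1 / r n" "x - p \<ge> h + 1 / r n" using rc[of n] assms by auto
    then show ?thesis unfolding \<phi>E using assms r[of n] ramp_diff_right[of "r n" h] by simp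
  qed
  have supp: "closure {x. \<phi> n x \<noteq> 0} \<subseteq> {p..c}" for n
    by (rule closure_minimal) (use z in blast, simp)
  show ?thesis
  proof (rule that[of c \<phi>])
    show "test_fun {a<..<b} (\<phi> n)" for n
    proof -
      have "compact (closure {x. \<phi> n x \<noteq> 0})"
        using supp[of n] by (meson bounded_closed_interval bounded_subset closed_closure compact_eq_bounded_closed)
      moreover have "closure {x. \<phi> n x \<noteq> 0} \<subseteq> {a<..<b}"
        using supp[of n] assms c by force
      ultimately show ?thesis
        unfolding test_fun_def by (simp add: \<phi>_def smooth_soft_trapezoid)
    qed
    show "0 \<le> \<phi> n x" for n x
      unfolding \<phi>E using ramp_diff_mono[OF r(1), of h "x - q" "x - p"] assms by auto
    show "\<phi> n x \<le> h" for n x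
      unfolding \<phi>E using ramp_diff_bounds[OF r(1), of h n "x - q"] ramp_diff_bounds[OF r(1), of h n "x - p"] assms
      by linarith
    show "\<bar>deriv (\<phi> n) x\<bar> \<le> 1" for n x
      unfolding deriv using s01[of n "x - p"] s01[of n "x - q"] by linarith
    show "deriv (\<phi> n) x = 0" if x: "x \<notin> {p..c}" for n x
    proof -
      have "\<forall>\<^sub>F y in nhds x. \<phi> n y = 0"
        using eventually_nhds_in_open[OF open_Compl[OF closed_real_atLeastAtMost], of x p c] x
        by (auto elim!: eventually_mono intro!: z simp del: atLeastAtMost_iff)
      then have "(\<phi> n has_real_derivative 0) (at x)"
        by (subst DERIV_cong_ev[OF refl _ refl]) auto
      then show ?thesis by (rule DERIV_imp_deriv)
    qed
    show "(\<lambda>n. \<phi> n x) \<longlonglongrightarrow> trapezoid p q h x" for x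
    proof -
      have "(\<lambda>n. ?E n y) \<longlonglongrightarrow> max y 0 - max (y - h) 0" for y
        by (intro tendsto_intros smooth_ramp_scaled_tendsto rl)
      moreover have "max y 0 - max (y - h) 0 = min (max y 0) h" for y
        using \<open>0 < h\<close> by auto
      ultimately show ?thesis
        unfolding \<phi>E trapezoid_def by (intro tendsto_diff) auto
    qed
    show "(\<lambda>n. deriv (\<phi> n) x) \<longlonglongrightarrow> trapezoid_deriv p q h x" for x
    proof -
      have "(\<lambda>n. ?s n (x - e)) \<longlonglongrightarrow> (if x - e > 0 then 1 else 0) - (if x - e - h > 0 then 1 else 0)" for e
        by (intro tendsto_diff smooth_step_scaled_tendsto rl)
      moreover have "(if x - e > 0 then 1 else 0) - (if x - e - h > 0 then 1 else 0) = (indicator {e<..e + h} x :: real)" for e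
        using \<open>0 < h\<close> by (auto simp: indicator_def)
      ultimately show ?thesis
        unfolding deriv trapezoid_deriv_def by (intro tendsto_diff) auto
    qed
    show "continuous_on UNIV (deriv (\<phi> n))" for n
    proof -
      have "continuous_on UNIV (\<lambda>x. ?s n (x - p) - ?s n (x - q))"
        by (intro continuous_intros continuous_on_compose2[OF smooth_continuous_on[OF smooth_smooth_step]]) auto
      then show ?thesis using deriv by presburger
    qed
  qed (use c z in auto)
qed


section \<open>Weak derivatives on an interval\<close>

lemma bounded_multiplier_convergence:
  fixes w :: "'a \<Rightarrow> real"
  assumes w: "integrable M w" and m: "\<And>n. \<psi> n \<in> borel_measurable M"
    and b: "\<And>n x. \<bar>\<psi> n x\<bar> \<le> C" and l: "\<And>x. (\<lambda>n. \<psi> n x) \<longlonglongrightarrow> f x"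
  shows "(\<lambda>n. LINT x|M. w x * \<psi> n x) \<longlonglongrightarrow> (LINT x|M. w x * f x)"
proof (rule integral_dominated_convergence[where w = "\<lambda>x. C * \<bar>w x\<bar>"])
  have "f \<in> borel_measurable M"
    by (rule borel_measurable_LIMSEQ_real[where u = \<psi>]) (use l m in auto)
  then show "(\<lambda>x. w x * f x) \<in> borel_measurable M" using w by measurable
  show "(\<lambda>x. w x * \<psi> n x) \<in> borel_measurable M" for n using w m by measurable
  show "integrable M (\<lambda>x. C * \<bar>w x\<bar>)" using w by auto
  show "AE x in M. (\<lambda>n. w x * \<psi> n x) \<longlonglongrightarrow> w x * f x"
    using l by (intro AE_I2 tendsto_intros)
  show "AE x in M. norm (w x * \<psi> n x) \<le> C * \<bar>w x\<bar>" for n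
    using b by (intro AE_I2) (metis abs_mult mult.commute mult_right_mono abs_ge_zero real_norm_def)
qed

lemma integrable_bounded_multiplier:
  fixes w :: "'a \<Rightarrow> real"
  assumes "integrable M w" "\<psi> \<in> borel_measurable M" "\<And>x. \<bar>\<psi> x\<bar> \<le> C"
  shows "integrable M (\<lambda>x. w x * \<psi> x)"
proof (rule Bochner_Integration.integrable_bound[where f = "\<lambda>x. C * \<bar>w x\<bar>"])
  show "AE x in M. norm (w x * \<psi> x) \<le> norm (C * \<bar>w x\<bar>)"
  proof (intro AE_I2)
    fix x
    have "\<bar>w x\<bar> * \<bar>\<psi> x\<bar> \<le> \<bar>w x\<bar> * \<bar>C\<bar>" using assms(3)[of x] by (intro mult_left_mono) auto
    then show "norm (w x * \<psi> x) \<le> norm (C * \<bar>w x\<bar>)" by (simp add: abs_mult mult.commute)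
  qed
qed (use assms in auto)

lemma trapezoid_deriv_measurable [measurable]: "trapezoid_deriv p q h \<in> borel_measurable borel"
  unfolding trapezoid_deriv_def[abs_def] by measurable

lemma trapezoid_measurable [measurable]: "trapezoid p q h \<in> borel_measurable borel"
  unfolding trapezoid_def[abs_def] by measurable

lemma borel_measurable_lebesgue_on:
  "f \<in> borel_measurable borel \<Longrightarrow> f \<in> borel_measurable (lebesgue_on S)"
  by (simp add: measurable_restrict_space1 measurable_completion)

lemma lebesgue_on_integral_subinterval:
  fixes w :: "real \<Rightarrow> real"
  assumes w: "integrable (lebesgue_on {a<..<b}) w" and "a < p" "q < b"
  shows "(LINT x|lebesgue_on {a<..<b}. w x * indicator {p<..q} x) = integral {p..q} w"
    and "w absolutely_integrable_on {p..q}" and "w integrable_on {p..q}"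
proof -
  have aw: "w absolutely_integrable_on {a<..<b}"
    using w by (simp add: integrable_restrict_space set_integrable_def)
  show a: "w absolutely_integrable_on {p..q}"
    by (rule absolutely_integrable_on_subinterval[OF aw]) (use assms in auto)
  then show "w integrable_on {p..q}" by (rule set_lebesgue_integral_eq_integral(1))
  have "(LINT x|lebesgue_on {a<..<b}. w x * indicator {p<..q} x) = (LINT x:{p..q}|lebesgue. w x)"
    unfolding set_lebesgue_integral_def
  proof (subst integral_restrict_space, simp, rule integral_cong_AE)
    show "AE x in lebesgue. indicat_real {a<..<b} x *\<^sub>R (w x * indicator {p<..q} x) = indicator {p..q} x *\<^sub>R w x"
    proof (rule AE_mp[OF AE_not_in[of "{p}"]])
      show "{p} \<in> null_sets lebesgue" by simp
      show "AE x in lebesgue. x \<notin> {p} \<longrightarrow> indicat_real {a<..<b} x *\<^sub>R (w x * indicator {p<..q} x) = indicator {p..q} x *\<^sub>R w x"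
        using assms by (intro AE_I2) (auto simp: indicator_def)
    qed
    show "(\<lambda>x. indicat_real {p..q} x *\<^sub>R w x) \<in> borel_measurable lebesgue"
      using a unfolding set_integrable_def by auto
    have "(\<lambda>x. indicator {p<..q} x *\<^sub>R (indicat_real {a<..<b} x *\<^sub>R w x)) \<in> borel_measurable lebesgue"
      using borel_measurable_integrable[OF aw[unfolded set_integrable_def]]
      by (rule borel_measurable_scaleR[rotated]) (simp add: borel_measurable_indicator)
    then show "(\<lambda>x. indicat_real {a<..<b} x *\<^sub>R (w x * indicat_real {p<..q} x)) \<in> borel_measurable lebesgue"
      by (simp add: mult_ac)
  qed
  also have "\<dots> = integral {p..q} w" by (rule set_lebesgue_integral_eq_integral(2)[OF a])
  finally show "(LINT x|lebesgue_on {a<..<b}. w x * indicator {p<..q} x) = integral {p..q} w" .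
qed

lemma integral_trapezoid_deriv:
  fixes w :: "real \<Rightarrow> real"
  assumes w: "integrable (lebesgue_on {a<..<b}) w" and "a < p" "p \<le> q" "q + h < b" "0 < h"
  shows "(LINT x|lebesgue_on {a<..<b}. w x * trapezoid_deriv p q h x)
    = integral {p..p + h} w - integral {q..q + h} w"
proof -
  have i: "integrable (lebesgue_on {a<..<b}) (\<lambda>x. w x * indicator {e<..e + h} x)" for e
    by (rule integrable_bounded_multiplier[OF w, where C = 1])
      (auto intro!: borel_measurable_lebesgue_on simp: indicator_def)
  have "(LINT x|lebesgue_on {a<..<b}. w x * trapezoid_deriv p q h x) =
     (LINT x|lebesgue_on {a<..<b}. w x * indicator {p<..p + h} x - w x * indicator {q<..q + h} x)"
    by (simp add: trapezoid_deriv_def algebra_simps)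
  also have "\<dots> = integral {p..p + h} w - integral {q..q + h} w"
    using assms by (subst Bochner_Integration.integral_diff[OF i i])
      (auto simp: lebesgue_on_integral_subinterval[OF w])
  finally show ?thesis .
qed

lemma weak_derivative_trapezoid:
  fixes w :: "real \<Rightarrow> real"
  assumes w: "integrable (lebesgue_on {a<..<b}) w" and g: "integrable (lebesgue_on {a<..<b}) g"
    and weak: "\<And>\<phi>. test_fun {a<..<b} \<phi> \<Longrightarrow> (LINT x|lebesgue_on {a<..<b}. w x * deriv \<phi> x)
       = - (LINT x|lebesgue_on {a<..<b}. g x * \<phi> x)"
    and pq: "a < p" "p \<le> q" "q + h < b" "0 < h"
  shows "integral {p..p + h} w - integral {q..q + h} w
    = - (LINT x|lebesgue_on {a<..<b}. g x * trapezoid p q h x)"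
proof -
  obtain \<phi> c where \<phi>: "\<And>n. test_fun {a<..<b} (\<phi> n)"
    "\<And>n x. 0 \<le> \<phi> n x" "\<And>n x. \<phi> n x \<le> h" "\<And>n x. \<bar>deriv (\<phi> n) x\<bar> \<le> 1"
    "\<And>x. (\<lambda>n. \<phi> n x) \<longlonglongrightarrow> trapezoid p q h x"
    "\<And>x. (\<lambda>n. deriv (\<phi> n) x) \<longlonglongrightarrow> trapezoid_deriv p q h x"
    "\<And>n. continuous_on UNIV (deriv (\<phi> n))"
    using trapezoid_approx[OF pq] by metis
  have "(\<lambda>n. LINT x|lebesgue_on {a<..<b}. w x * deriv (\<phi> n) x) \<longlonglongrightarrow>
      (LINT x|lebesgue_on {a<..<b}. w x * trapezoid_deriv p q h x)"
    by (rule bounded_multiplier_convergence[OF w _ \<phi>(4,6)])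
      (auto intro!: borel_measurable_lebesgue_on borel_measurable_continuous_onI \<phi>)
  moreover have "(\<lambda>n. LINT x|lebesgue_on {a<..<b}. g x * \<phi> n x) \<longlonglongrightarrow>
      (LINT x|lebesgue_on {a<..<b}. g x * trapezoid p q h x)"
    by (rule bounded_multiplier_convergence[OF g _ _ \<phi>(5), where C = h])
      (use \<phi>(1,2,3) in \<open>auto intro!: borel_measurable_lebesgue_on borel_measurable_continuous_onI smooth_continuous_on
         simp: test_fun_def abs_le_iff intro: order_trans[of _ 0]\<close>)
  then have "(\<lambda>n. LINT x|lebesgue_on {a<..<b}. w x * deriv (\<phi> n) x) \<longlonglongrightarrow>
      - (LINT x|lebesgue_on {a<..<b}. g x * trapezoid p q h x)"
    unfolding weak[OF \<phi>(1)] by (rule tendsto_minus)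
  ultimately have "(LINT x|lebesgue_on {a<..<b}. w x * trapezoid_deriv p q h x) =
     - (LINT x|lebesgue_on {a<..<b}. g x * trapezoid p q h x)"
    by (rule LIMSEQ_unique)
  then show ?thesis using integral_trapezoid_deriv[OF w pq] by simp
qed

lemma tendsto_average_right:
  fixes V :: "real \<Rightarrow> real"
  assumes V: "continuous_on {p..p + d} V" and "0 < d"
    and h: "h \<longlonglongrightarrow> 0" "\<And>n. 0 < h n" "\<And>n. h n \<le> d"
  shows "(\<lambda>n. integral {p..p + h n} V / h n) \<longlonglongrightarrow> V p"
proof -
  have "((\<lambda>x. integral {p..x} V) has_real_derivative V p) (at p within {p..p + d})"
    by (rule integral_has_real_derivative[OF V]) (use \<open>0 < d\<close> in auto)
  then have l: "((\<lambda>x. (integral {p..x} V - integral {p..p} V) / (x - p)) \<longlongrightarrow> V p) (at p within {p..p + d})"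
    by (simp add: has_field_derivative_iff)
  have "filterlim (\<lambda>n. p + h n) (at p within {p..p + d}) sequentially"
    unfolding filterlim_at
  proof
    show "\<forall>\<^sub>F n in sequentially. p + h n \<in> {p..p + d} \<and> p + h n \<noteq> p"
      using h(2,3) by (intro always_eventually allI) (auto simp: less_imp_le less_imp_neq[symmetric])
    show "(\<lambda>n. p + h n) \<longlonglongrightarrow> p" using tendsto_add[OF tendsto_const h(1), of p] by simp
  qed
  from filterlim_compose[OF l this] show ?thesis by simp
qed

lemma trapezoid_normalized_bound: "h > 0 \<Longrightarrow> p \<le> q \<Longrightarrow> \<bar>trapezoid p q h x / h\<bar> \<le> 1"
  by (auto simp: trapezoid_def abs_le_iff field_simps min_def max_def)

lemma trapezoid_normalized_tendsto:
  assumes h: "h \<longlonglongrightarrow> 0" "\<And>n. 0 < h n" and "p \<le> q"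
  shows "(\<lambda>n. trapezoid p q (h n) x / h n) \<longlonglongrightarrow> indicator {p<..q} x"
proof -
  have *: "(\<lambda>n. min (max y 0) (h n) / h n) \<longlonglongrightarrow> (if y > 0 then 1 else 0)" for y :: real
  proof (cases "y > 0")
    case True
    have "\<forall>\<^sub>F n in sequentially. h n < y" using order_tendstoD(2)[OF h(1) True] .
    then have "\<forall>\<^sub>F n in sequentially. min (max y 0) (h n) / h n = 1"
    proof eventually_elim
      case (elim n)
      then show ?case using h(2)[of n] True by simp
    qed
    with True show ?thesis by (simp add: tendsto_eventually)
  next
    case False
    then have "min (max y 0) (h n) / h n = 0" for n using h(2)[of n] by auto
    then show ?thesis using False by (simp only: if_False tendsto_const)
  qed
  have "(\<lambda>n. min (max (x - p) 0) (h n) / h n - min (max (x - q) 0) (h n) / h n) \<longlonglongrightarrow>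
     (if x - p > 0 then 1 else 0) - (if x - q > 0 then 1 else 0)"
    by (intro tendsto_diff *)
  moreover have "(if x - p > 0 then 1 else 0) - (if x - q > 0 then 1 else 0) = (indicator {p<..q} x :: real)"
    using \<open>p \<le> q\<close> by (auto simp: indicator_def)
  ultimately show ?thesis by (simp add: trapezoid_def diff_divide_distrib)
qed

lemma integral_cong_AE_lebesgue_on:
  fixes V w :: "real \<Rightarrow> real"
  assumes "AE x in lebesgue_on {a<..<b}. V x = w x" "a < p" "q < b"
  shows "integral {p..q} V = integral {p..q} w"
proof -
  have "AE x in lebesgue. x \<in> {a<..<b} \<longrightarrow> V x = w x"
    using assms(1) by (simp add: AE_restrict_space_iff)
  then obtain N where N: "N \<in> null_sets lebesgue" "{x. \<not> (x \<in> {a<..<b} \<longrightarrow> V x = w x)} \<subseteq> N"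
    unfolding eventually_ae_filter by auto
  show ?thesis
  proof (rule integral_spike[of N])
    show "negligible N" using N by (simp add: negligible_iff_null_sets)
    show "w x = V x" if "x \<in> {p..q} - N" for x
    proof (rule ccontr)
      assume "w x \<noteq> V x"
      then have "x \<in> {x. \<not> (x \<in> {a<..<b} \<longrightarrow> V x = w x)}" using assms(2,3) that by auto
      with N(2) that show False by blast
    qed
  qed
qed

text \<open>Dividing the hypothesis by \<open>h\<close> and letting \<open>h \<rightarrow> 0\<close> turns the averages of the continuous function \<open>V\<close>
  into its values and the trapezoids into the indicator of \<open>(p, q]\<close>. The lemma is used in the space
  variable and in the time variable.\<close>

lemma primitive_of_trapezoid_identity:
  fixes V g :: "real \<Rightarrow> real"
  assumes Vc: "continuous_on {a..b} V" and g: "integrable (lebesgue_on {a<..<b}) g"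
    and trap: "\<And>p q h. a < p \<Longrightarrow> p \<le> q \<Longrightarrow> q + h < b \<Longrightarrow> 0 < h \<Longrightarrow>
      integral {p..p + h} V - integral {q..q + h} V = - (LINT x|lebesgue_on {a<..<b}. g x * trapezoid p q h x)"
    and "a < b" and pq: "a \<le> p" "p \<le> q" "q \<le> b"
  shows "V q - V p = integral {p..q} g" and "g absolutely_integrable_on {a..b}"
proof -
  show ga: "g absolutely_integrable_on {a..b}"
    unfolding absolutely_integrable_on_Icc_iff_Ioo
    using g by (simp add: integrable_restrict_space set_integrable_def)
  then have gi: "g integrable_on {a..b}" by (rule set_lebesgue_integral_eq_integral(1))
  have inner: "V y - V x = integral {x..y} g" if xy: "a < x" "x \<le> y" "y < b" for x y
  proof -
    define d where "d = (b - y) / 2"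
    define h where "h n = d / (real n + 1)" for n
    have d: "d > 0" "y + d < b" using xy by (auto simp: d_def field_simps)
    have h: "h \<longlonglongrightarrow> 0" "\<And>n. 0 < h n" "\<And>n. h n \<le> d"
      unfolding h_def using d LIMSEQ_ignore_initial_segment[OF lim_const_over_n[of d], of 1]
      by (auto simp: field_simps)
    have hb: "y + h n < b" for n using h(3)[of n] d by linarith
    have eq: "integral {x..x + h n} V / h n - integral {y..y + h n} V / h n =
       - (LINT z|lebesgue_on {a<..<b}. g z * (trapezoid x y (h n) z / h n))" for n
      using trap[OF xy(1,2) hb h(2), of n] by (simp flip: diff_divide_distrib)
    have "(\<lambda>n. LINT z|lebesgue_on {a<..<b}. g z * (trapezoid x y (h n) z / h n)) \<longlonglongrightarrow>
       (LINT z|lebesgue_on {a<..<b}. g z * indicator {x<..y} z)"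
      by (rule bounded_multiplier_convergence[OF g, where C = 1])
        (use xy h in \<open>auto intro!: borel_measurable_lebesgue_on trapezoid_normalized_bound trapezoid_normalized_tendsto
            simp del: abs_divide\<close>)
    then have r: "(\<lambda>n. - (LINT z|lebesgue_on {a<..<b}. g z * (trapezoid x y (h n) z / h n))) \<longlonglongrightarrow>
       - integral {x..y} g"
      using lebesgue_on_integral_subinterval(1)[OF g, of x y] xy by (auto intro: tendsto_minus)
    have "(\<lambda>n. integral {x..x + h n} V / h n - integral {y..y + h n} V / h n) \<longlonglongrightarrow> V x - V y"
      by (intro tendsto_diff tendsto_average_right[where d = d] h d continuous_on_subset[OF Vc])
        (use xy d in auto)
    from LIMSEQ_unique[OF this[unfolded eq] r] have "V x - V y = - integral {x..y} g" .
    then show ?thesis by simp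
  qed
  \<comment> \<open>The function \<open>V\<close> minus its candidate primitive is constant inside, hence by continuity also up to the end points.\<close>
  define F where "F x = V x - integral {a..x} g" for x
  have Fc: "continuous_on {a..b} F"
    unfolding F_def by (intro continuous_intros Vc indefinite_integral_continuous_1 gi)
  define m where "m = (a + b) / 2"
  have m: "a < m" "m < b" using \<open>a < b\<close> by (auto simp: m_def)
  have comb: "integral {a..x} g + integral {x..y} g = integral {a..y} g" if "a \<le> x" "x \<le> y" "y \<le> b" for x y
    by (rule Henstock_Kurzweil_Integration.integral_combine)
      (use that in \<open>auto intro: integrable_subinterval_real[OF gi]\<close>)
  have Fm: "F x = F m" if "x \<in> {a<..<b}" for x
    using inner[of x m] inner[of m x] comb[of x m] comb[of m x] m that unfolding F_def
    by (cases "x \<le> m") auto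
  have "F x = F m" if "x \<in> {a..b}" for x
    using continuous_constant_on_closure[of "{a<..<b}" F "F m" x] Fc Fm that \<open>a < b\<close>
    by (simp add: closure_greaterThanLessThan)
  then show "V q - V p = integral {p..q} g"
    using comb[of p q] pq unfolding F_def by (smt (verit) atLeastAtMost_iff)
qed

lemma W11_continuous_primitive:
  assumes W: "W11_deriv a b w g" and V: "continuous_rep a b w V" and "a < b"
    and pq: "a \<le> p" "p \<le> q" "q \<le> b"
  shows "V q - V p = integral {p..q} g"
proof (rule primitive_of_trapezoid_identity(1)[OF _ _ _ \<open>a < b\<close> pq])
  have w: "integrable (lebesgue_on {a<..<b}) w"
    and weak: "\<And>\<phi>. test_fun {a<..<b} \<phi> \<Longrightarrow> (LINT x|lebesgue_on {a<..<b}. w x * deriv \<phi> x)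
       = - (LINT x|lebesgue_on {a<..<b}. g x * \<phi> x)"
    using W unfolding W11_deriv_def by auto
  show g: "integrable (lebesgue_on {a<..<b}) g" using W unfolding W11_deriv_def by auto
  show "continuous_on {a..b} V" using V unfolding continuous_rep_def by auto
  have Vw: "AE x in lebesgue_on {a<..<b}. V x = w x" using V unfolding continuous_rep_def by auto
  show "integral {p..p + h} V - integral {q..q + h} V = - (LINT x|lebesgue_on {a<..<b}. g x * trapezoid p q h x)"
    if "a < p" "p \<le> q" "q + h < b" "0 < h" for p q h
    using weak_derivative_trapezoid[OF w g weak that]
      integral_cong_AE_lebesgue_on[OF Vw, of p "p + h"]
      integral_cong_AE_lebesgue_on[OF Vw, of q "q + h"] that by simp
qed

lemma test_fun_mono: "test_fun A \<phi> \<Longrightarrow> A \<subseteq> B \<Longrightarrow> test_fun B \<phi>"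
  unfolding test_fun_def by blast

text \<open>If \<open>V \<nu> \<le> V \<mu>\<close> as measures on an interval where \<open>V > 0\<close>, then also \<open>\<nu> \<le> \<mu>\<close> there: integrate \<open>\<phi> / V\<close>
  against the two weighted measures.\<close>

lemma integral_le_of_weighted_measures_le:
  fixes V \<phi> :: "real \<Rightarrow> real"
  assumes fin: "finite_measure \<mu>" "finite_measure \<nu>"
    and sets: "sets \<mu> = sets (restrict_space borel {a<..<b})" "sets \<nu> = sets (restrict_space borel {a<..<b})"
    and pr: "a < p" "r < b" and Vc: "continuous_on {p..r} V" and Vpos: "\<And>x. x \<in> {p..r} \<Longrightarrow> V x > 0"
    and le: "\<And>B. B \<in> sets borel \<Longrightarrow> B \<subseteq> {p..r} \<Longrightarrow> (LINT x:B|\<nu>. V x) \<le> (LINT x:B|\<mu>. V x)"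
    and \<phi>: "continuous_on UNIV \<phi>" "\<And>x. 0 \<le> \<phi> x" "\<And>x. \<phi> x \<le> C" "\<And>x. x \<notin> {p..r} \<Longrightarrow> \<phi> x = 0"
  shows "(LINT x|\<nu>. \<phi> x) \<le> (LINT x|\<mu>. \<phi> x)"
proof -
  let ?A = "{p..r}"
  define W where "W x = indicator ?A x * V x" for x
  have Wm: "W \<in> borel_measurable borel"
  proof -
    have "(\<lambda>x. indicator ?A x *\<^sub>R V x) \<in> borel_measurable borel"
      by (rule borel_measurable_continuous_on_indicator[OF _ Vc]) simp
    then show ?thesis by (simp add: W_def[abs_def])
  qed
  obtain K where K: "\<And>x. x \<in> ?A \<Longrightarrow> \<bar>V x\<bar> \<le> K"
    using compact_imp_bounded[OF compact_continuous_image[OF Vc compact_Icc]]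
    unfolding bounded_iff by (metis imageI real_norm_def)
  have K': "\<bar>W x\<bar> \<le> max K 0" "0 \<le> W x" for x
    using K[of x] Vpos[of x] by (auto simp: W_def indicator_def)
  have meas: "f \<in> borel_measurable M" if "sets M = sets (restrict_space borel {a<..<b})" "f \<in> borel_measurable borel"
    for M and f :: "real \<Rightarrow> real"
    using that(2) by (simp add: measurable_cong_sets[OF that(1) refl] measurable_restrict_space1)
  have space: "space M = {a<..<b}" if "sets M = sets (restrict_space borel {a<..<b})" for M
    using sets_eq_imp_space_eq[OF that] by (simp add: space_restrict_space)
  have dens: "emeasure (density M W) B = ennreal (LINT x:B \<inter> ?A|M. V x)"
    if M: "finite_measure M" "sets M = sets (restrict_space borel {a<..<b})" and B: "B \<in> sets M" for M B
  proof -
    interpret finite_measure M by fact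
    have [measurable]: "W \<in> borel_measurable M" using meas[OF M(2) Wm] .
    have i: "integrable M (\<lambda>x. W x * indicator B x)"
      by (rule integrable_const_bound[where B = "max K 0"])
        (use B K' in \<open>auto simp: indicator_def intro!: AE_I2\<close>)
    have "emeasure (density M W) B = (\<integral>\<^sup>+x. ennreal (W x * indicator B x) \<partial>M)"
      using B by (subst emeasure_density) (auto intro!: nn_integral_cong simp: indicator_def)
    also have "\<dots> = ennreal (LINT x|M. W x * indicator B x)"
      by (rule nn_integral_eq_integral[OF i]) (use K' in auto)
    also have "(LINT x|M. W x * indicator B x) = (LINT x:B \<inter> ?A|M. V x)"
      unfolding set_lebesgue_integral_def W_def
      by (intro Bochner_Integration.integral_cong) (auto simp: indicator_def)
    finally show ?thesis .
  qed
  have "density \<nu> W \<le> density \<mu> W"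
  proof (subst le_measure)
    show "sets (density \<nu> W) = sets (density \<mu> W)" by (simp add: sets)
    show "\<forall>B\<in>sets (density \<nu> W). emeasure (density \<nu> W) B \<le> emeasure (density \<mu> W) B"
    proof
      fix B assume "B \<in> sets (density \<nu> W)"
      then have B: "B \<in> sets \<nu>" "B \<in> sets \<mu>" using sets by auto
      then have "B \<in> sets borel" using sets by (auto simp: sets_restrict_space)
      then have "(LINT x:B \<inter> ?A|\<nu>. V x) \<le> (LINT x:B \<inter> ?A|\<mu>. V x)"
        by (intro le) auto
      then show "emeasure (density \<nu> W) B \<le> emeasure (density \<mu> W) B"
        unfolding dens[OF fin(2) sets(2) B(1)] dens[OF fin(1) sets(1) B(2)] by (rule ennreal_leI)
    qed
  qed
  then have "(\<integral>\<^sup>+x. ennreal (\<phi> x / W x) \<partial>density \<nu> W) \<le> (\<integral>\<^sup>+x. ennreal (\<phi> x / W x) \<partial>density \<mu> W)"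
    by (intro nn_integral_mono_measure) (simp_all add: sets)
  moreover have "(\<integral>\<^sup>+x. ennreal (\<phi> x / W x) \<partial>density M W) = ennreal (LINT x|M. \<phi> x)"
    if M: "finite_measure M" "sets M = sets (restrict_space borel {a<..<b})" for M
  proof -
    interpret finite_measure M by fact
    have [measurable]: "W \<in> borel_measurable M" "\<phi> \<in> borel_measurable M"
      using meas[OF M(2) Wm] meas[OF M(2) borel_measurable_continuous_onI[OF \<phi>(1)]] .
    have "(\<integral>\<^sup>+x. ennreal (\<phi> x / W x) \<partial>density M W) = (\<integral>\<^sup>+x. ennreal (W x) * ennreal (\<phi> x / W x) \<partial>M)"
      by (rule nn_integral_density) auto
    also have "\<dots> = (\<integral>\<^sup>+x. ennreal (\<phi> x) \<partial>M)"
    proof (rule nn_integral_cong)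
      fix x
      show "ennreal (W x) * ennreal (\<phi> x / W x) = ennreal (\<phi> x)"
        using Vpos[of x] \<phi>(2,4)[of x] by (cases "x \<in> ?A") (auto simp: W_def ennreal_mult[symmetric])
    qed
    also have "\<dots> = ennreal (LINT x|M. \<phi> x)"
      by (rule nn_integral_eq_integral[OF integrable_const_bound[where B = C]])
        (use \<phi> in \<open>auto intro!: AE_I2\<close>)
    finally show ?thesis .
  qed
  ultimately have "ennreal (LINT x|\<nu>. \<phi> x) \<le> ennreal (LINT x|\<mu>. \<phi> x)"
    using fin sets by simp
  then show ?thesis using \<phi>(2) by (simp add: ennreal_le_iff integral_nonneg)
qed

text \<open>Lebesgue's differentiation theorem on an interval, with averages to the right of the point.\<close>

lemma right_lebesgue_points:
  fixes w :: "real \<Rightarrow> real"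
  assumes w: "integrable (lebesgue_on {a<..<b}) w"
  obtains N where "negligible N"
    "\<And>x. a < x \<Longrightarrow> x < b \<Longrightarrow> x \<notin> N \<Longrightarrow> ((\<lambda>h. integral {x..x + h} w / h) \<longlongrightarrow> w x) (at_right 0)"
proof -
  define f where "f x = (if x \<in> {a<..<b} then w x else 0)" for x
  have "w absolutely_integrable_on {a<..<b}"
    using w by (simp add: integrable_restrict_space set_integrable_def)
  then have "w integrable_on {a<..<b}" by (rule set_lebesgue_integral_eq_integral(1))
  then have "f integrable_on UNIV"
    unfolding f_def by (subst integrable_restrict_UNIV)
  then have "f integrable_on cbox c d" for c d
    by (rule integrable_on_subcbox) auto
  then obtain N where N: "negligible N" "\<And>x e. \<lbrakk>x \<notin> N; 0 < e\<rbrakk> \<Longrightarrow>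
     \<exists>d>0. \<forall>h. 0 < h \<and> h < d \<longrightarrow> norm (integral (cbox x (x + h *\<^sub>R One)) f /\<^sub>R h ^ DIM(real) - f x) < e"
    using integrable_ccontinuous_explicit[of f] by metis
  show ?thesis
  proof (rule that[OF N(1)], rule tendstoI)
    fix x e :: real assume x: "a < x" "x < b" "x \<notin> N" "0 < e"
    obtain d where d: "d > 0" "\<And>h. 0 < h \<Longrightarrow> h < d \<Longrightarrow>
        norm (integral (cbox x (x + h *\<^sub>R One)) f /\<^sub>R h ^ DIM(real) - f x) < e"
      using N(2)[OF x(3,4)] by blast
    show "\<forall>\<^sub>F h in at_right 0. dist (integral {x..x + h} w / h) (w x) < e"
    proof (rule eventually_at_rightI[of 0 "min d (b - x)"])
      fix h assume "h \<in> {0<..<min d (b - x)}"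
      then have h: "0 < h" "h < min d (b - x)" by auto
      have "integral {x..x + h} f = integral {x..x + h} w"
        by (rule integral_cong) (use x h in \<open>auto simp: f_def\<close>)
      then show "dist (integral {x..x + h} w / h) (w x) < e"
        using d(2)[of h] h x by (simp add: f_def divide_inverse mult.commute dist_real_def)
    qed (use d(1) x in auto)
  qed
qed

text \<open>The sign condition says that \<open>Du \<ge> 0\<close> where \<open>V > 0\<close>. Tested with a trapezoid it compares the
  averages of \<open>w\<close> over two intervals of length \<open>h\<close> to the right of \<open>p\<close> and of \<open>q\<close>, and \<open>h \<rightarrow> 0\<close> gives the
  comparison of the values at Lebesgue points.\<close>

lemma monotone_where_positive:
  assumes BV: "BV_deriv a b w \<mu> \<nu>" and Vc: "continuous_on {a..b} V" and nn: "nonneg_product a b V \<mu> \<nu>"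
  obtains N where "negligible N"
    "\<And>p q. a < p \<Longrightarrow> p < q \<Longrightarrow> q < b \<Longrightarrow> p \<notin> N \<Longrightarrow> q \<notin> N \<Longrightarrow> (\<And>x. x \<in> {p..q} \<Longrightarrow> V x > 0) \<Longrightarrow> w p \<le> w q"
proof -
  have w: "integrable (lebesgue_on {a<..<b}) w"
    and \<mu>: "finite_measure \<mu>" "finite_measure \<nu>"
      "sets \<mu> = sets (restrict_space borel {a<..<b})" "sets \<nu> = sets (restrict_space borel {a<..<b})"
    and weak: "\<And>\<phi>. test_fun {a<..<b} \<phi> \<Longrightarrow> (LINT x|lebesgue_on {a<..<b}. w x * deriv \<phi> x) =
        - ((LINT x|\<mu>. \<phi> x) - (LINT x|\<nu>. \<phi> x))"
    using BV unfolding BV_deriv_def by auto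
  obtain N where N: "negligible N"
    "\<And>x. a < x \<Longrightarrow> x < b \<Longrightarrow> x \<notin> N \<Longrightarrow> ((\<lambda>h. integral {x..x + h} w / h) \<longlongrightarrow> w x) (at_right 0)"
    by (rule right_lebesgue_points[OF w]) (rule that)
  show ?thesis
  proof (rule that[OF N(1)])
    fix p q assume pq: "a < p" "p < q" "q < b" "p \<notin> N" "q \<notin> N" and pos: "\<And>x. x \<in> {p..q} \<Longrightarrow> V x > 0"
    have "isCont V q"
      using continuous_on_interior[OF Vc, of q] pq by simp
    then have "\<forall>\<^sub>F x in at q. V x > 0"
      using pos[of q] pq order_tendstoD(1)[of V "V q" "at q" 0] by (simp add: isCont_def)
    then obtain d0 where d0: "d0 > 0" "\<And>x. x \<noteq> q \<Longrightarrow> dist x q < d0 \<Longrightarrow> V x > 0"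
      unfolding eventually_at by auto
    \<comment> \<open>The supports extend beyond \<open>q\<close>, so positivity of \<open>V\<close> is needed on a larger interval \<open>[p, r]\<close>.\<close>
    define r where "r = q + min (d0 / 2) ((b - q) / 2)"
    have r: "q < r" "r < b" using d0 pq by (auto simp: r_def min_def field_simps)
    have posr: "V x > 0" if "x \<in> {p..r}" for x
    proof (cases "x \<le> q")
      case False
      then have "dist x q < d0" using that d0(1) by (auto simp: r_def dist_real_def)
      with False show ?thesis using d0 by auto
    qed (use pos that in auto)
    have avg: "integral {p..p + h} w \<le> integral {q..q + h} w" if h: "0 < h" "q + h < r" for h
    proof -
      obtain \<phi> c where \<phi>: "c < r" "\<And>n. test_fun {a<..<r} (\<phi> n)"
        "\<And>n x. x \<notin> {p..c} \<Longrightarrow> \<phi> n x = 0"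
        "\<And>n x. 0 \<le> \<phi> n x" "\<And>n x. \<phi> n x \<le> h" "\<And>n x. \<bar>deriv (\<phi> n) x\<bar> \<le> 1"
        "\<And>x. (\<lambda>n. deriv (\<phi> n) x) \<longlonglongrightarrow> trapezoid_deriv p q h x"
        "\<And>n. continuous_on UNIV (deriv (\<phi> n))"
        using trapezoid_approx[of a p q h r] pq h by (metis less_imp_le)
      have tf: "test_fun {a<..<b} (\<phi> n)" for n
        by (rule test_fun_mono[OF \<phi>(2)]) (use r in auto)
      have "(LINT x|\<nu>. \<phi> n x) \<le> (LINT x|\<mu>. \<phi> n x)" for n
      proof (rule integral_le_of_weighted_measures_le[OF \<mu> pq(1) r(2) _ posr _ _ \<phi>(4,5)])
        show "continuous_on {p..r} V" by (rule continuous_on_subset[OF Vc]) (use pq r in auto)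
        show "continuous_on UNIV (\<phi> n)" using \<phi>(2) by (auto simp: test_fun_def intro: smooth_continuous_on)
        show "(LINT x:B|\<nu>. V x) \<le> (LINT x:B|\<mu>. V x)" if "B \<in> sets borel" "B \<subseteq> {p..r}" for B
        proof -
          have "B = {a<..<b} \<inter> B" using that pq r by fastforce
          then have "B \<in> sets (restrict_space borel {a<..<b})"
            using that(1) unfolding sets_restrict_space by blast
          then show ?thesis using nn unfolding nonneg_product_def by fastforce
        qed
        show "\<phi> n x = 0" if "x \<notin> {p..r}" for x using \<phi>(1,3) that by auto
      qed auto
      then have le: "(LINT x|lebesgue_on {a<..<b}. w x * deriv (\<phi> n) x) \<le> 0" for n
        using weak[OF tf, of n] by auto
      have "(\<lambda>n. LINT x|lebesgue_on {a<..<b}. w x * deriv (\<phi> n) x) \<longlonglongrightarrow>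
          (LINT x|lebesgue_on {a<..<b}. w x * trapezoid_deriv p q h x)"
        by (rule bounded_multiplier_convergence[OF w _ \<phi>(6,7)])
          (auto intro!: borel_measurable_lebesgue_on borel_measurable_continuous_onI \<phi>)
      then have "(LINT x|lebesgue_on {a<..<b}. w x * trapezoid_deriv p q h x) \<le> 0"
        by (rule LIMSEQ_le_const2) (use le in auto)
      then show ?thesis
        using integral_trapezoid_deriv[OF w pq(1), of q h] pq h r by simp
    qed
    show "w p \<le> w q"
    proof (rule tendsto_le)
      show "((\<lambda>h. integral {q..q + h} w / h) \<longlongrightarrow> w q) (at_right 0)"
        "((\<lambda>h. integral {p..p + h} w / h) \<longlongrightarrow> w p) (at_right 0)"
        using pq by (auto intro!: N(2))
      show "\<forall>\<^sub>F h in at_right 0. integral {p..p + h} w / h \<le> integral {q..q + h} w / h"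
        by (rule eventually_at_rightI[of 0 "r - q"]) (use avg r in \<open>auto intro!: divide_right_mono\<close>)
    qed simp
  qed
qed

lemma BV_deriv_uminus: "BV_deriv a b w \<mu> \<nu> \<Longrightarrow> BV_deriv a b (\<lambda>x. - w x) \<nu> \<mu>"
  unfolding BV_deriv_def by auto

lemma nonneg_product_uminus: "nonneg_product a b V \<mu> \<nu> \<Longrightarrow> nonneg_product a b (\<lambda>x. - V x) \<nu> \<mu>"
  unfolding nonneg_product_def set_lebesgue_integral_def by auto


section \<open>Sign of the flux against a monotone function of the solution\<close>

text \<open>Choose a rational number between each right-isolated point and the next point of \<open>Z\<close>.\<close>

lemma countable_right_isolated:
  fixes Z :: "real set"
  shows "countable {x \<in> Z. \<exists>d>0. {x<..<x + d} \<inter> Z = {}}" (is "countable ?R")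
proof -
  have "\<exists>r\<in>\<rat>. x < r \<and> {x<..r} \<inter> Z = {}" if x: "x \<in> ?R" for x
  proof -
    from x obtain d where d: "d > 0" "{x<..<x + d} \<inter> Z = {}" by auto
    obtain r where "r \<in> \<rat>" "x < r" "r < x + d" using Rats_dense_in_real[of x "x + d"] d(1) by auto
    moreover from this have "{x<..r} \<subseteq> {x<..<x + d}" by auto
    ultimately show ?thesis using d(2) by (intro bexI[of _ r]) blast+
  qed
  then have "\<forall>x\<in>?R. \<exists>r. r \<in> \<rat> \<and> x < r \<and> {x<..r} \<inter> Z = {}" by blast
  from bchoice[OF this] obtain r where r: "\<And>x. x \<in> ?R \<Longrightarrow> r x \<in> \<rat> \<and> x < r x \<and> {x<..r x} \<inter> Z = {}"
    by blast
  have le: "y \<le> x" if "x \<in> ?R" "y \<in> ?R" "r x = r y" for x y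
  proof (rule ccontr)
    assume "\<not> y \<le> x"
    then have "y \<in> {x<..r x} \<inter> Z" using r[OF that(2)] that by auto
    then show False using r[OF that(1)] by auto
  qed
  have "inj_on r ?R"
  proof (rule inj_onI)
    fix x y assume "x \<in> ?R" "y \<in> ?R" "r x = r y"
    then show "x = y" using le[of x y] le[of y x] by linarith
  qed
  moreover have "countable (r ` ?R)"
    using r by (intro countable_subset[OF _ countable_rat]) auto
  ultimately show ?thesis by (rule countable_image_inj_on[rotated])
qed

text \<open>By the second mean value theorem the integral is \<open>h \<alpha> * \<integral> g\<close> over an initial interval plus
  \<open>h \<beta> * \<integral> g\<close> over the remaining final one. Redefining \<open>h\<close> as \<open>0\<close> at the left end point keeps it increasing
  and leaves only the final interval.\<close>

lemma increasing_flux_le: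
  fixes h g :: "real \<Rightarrow> real"
  assumes ab: "\<alpha> \<le> \<beta>" and gi: "g integrable_on {\<alpha>..\<beta>}" and N: "negligible N"
    and tail: "\<And>c. c \<in> {\<alpha>..\<beta>} \<Longrightarrow> integral {c..\<beta>} g \<le> 0"
    and h01: "\<And>x. 0 \<le> h x" "\<And>x. h x \<le> 1"
    and mono: "\<And>x y. \<alpha> < x \<Longrightarrow> x < y \<Longrightarrow> y < \<beta> \<Longrightarrow> x \<notin> N \<Longrightarrow> y \<notin> N \<Longrightarrow> h x \<le> h y"
  shows "integral {\<alpha>..\<beta>} (\<lambda>x. h x * g x) \<le> 0"
proof -
  \<comment> \<open>The increasing envelope of \<open>h\<close> off \<open>N\<close>; the supremum of \<open>{0}\<close> makes it vanish at \<open>\<alpha>\<close>.\<close>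
  define S where "S x = insert 0 (h ` {y. \<alpha> < y \<and> y \<le> x \<and> y < \<beta> \<and> y \<notin> N})" for x
  define H where "H x = Sup (S x)" for x
  have bdd: "bdd_above (S x)" for x
    unfolding bdd_above_def S_def using h01(2) by (intro exI[of _ 1]) auto
  have H_mono: "H x \<le> H y" if "x \<le> y" for x y
    unfolding H_def by (rule cSup_subset_mono[OF _ bdd]) (use that in \<open>auto simp: S_def\<close>)
  have H0: "H x \<ge> 0" for x
    unfolding H_def by (rule cSup_upper[OF _ bdd]) (simp add: S_def)
  have "S \<alpha> = {0}" by (auto simp: S_def)
  then have H\<alpha>: "H \<alpha> = 0" by (simp add: H_def)
  have Hh: "H x = h x" if x: "\<alpha> < x" "x < \<beta>" "x \<notin> N" for x
    unfolding H_def
  proof (rule cSup_eq_maximum)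
    show "h x \<in> S x" using x by (auto simp: S_def)
    show "z \<le> h x" if "z \<in> S x" for z
    proof -
      from that consider "z = 0" | y where "z = h y" "\<alpha> < y" "y \<le> x" "y \<notin> N" by (auto simp: S_def)
      then show ?thesis
      proof cases
        case 2
        then show ?thesis using mono[of y x] x by (cases "y = x") auto
      qed (use h01 in auto)
    qed
  qed
  obtain c where c: "c \<in> {\<alpha>..\<beta>}"
    "integral {\<alpha>..\<beta>} (\<lambda>x. H x * g x) = H \<alpha> * integral {\<alpha>..c} g + H \<beta> * integral {c..\<beta>} g"
    using second_mean_value_theorem[OF gi ab, of H] H_mono by blast
  have "integral {\<alpha>..\<beta>} (\<lambda>x. H x * g x) \<le> 0"
    using c H\<alpha> H0[of \<beta>] tail[OF c(1)] by (simp add: mult_nonneg_nonpos)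
  moreover have "integral {\<alpha>..\<beta>} (\<lambda>x. H x * g x) = integral {\<alpha>..\<beta>} (\<lambda>x. h x * g x)"
  proof (rule integral_spike[of "N \<union> {\<alpha>, \<beta>}"])
    show "negligible (N \<union> {\<alpha>, \<beta>})" using N by auto
    show "h x * g x = H x * g x" if "x \<in> {\<alpha>..\<beta>} - (N \<union> {\<alpha>, \<beta>})" for x
      using Hh[of x] that by auto
  qed
  ultimately show ?thesis by simp
qed

lemma decreasing_flux_le:
  fixes h g :: "real \<Rightarrow> real"
  assumes ab: "\<alpha> \<le> \<beta>" and gi: "g integrable_on {\<alpha>..\<beta>}" and N: "negligible N"
    and tail: "\<And>c. c \<in> {\<alpha>..\<beta>} \<Longrightarrow> integral {\<alpha>..c} g \<le> 0"
    and h01: "\<And>x. 0 \<le> h x" "\<And>x. h x \<le> 1"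
    and mono: "\<And>x y. \<alpha> < x \<Longrightarrow> x < y \<Longrightarrow> y < \<beta> \<Longrightarrow> x \<notin> N \<Longrightarrow> y \<notin> N \<Longrightarrow> h y \<le> h x"
  shows "integral {\<alpha>..\<beta>} (\<lambda>x. h x * g x) \<le> 0"
proof -
  have "integral {- \<beta>..- \<alpha>} (\<lambda>x. h (- x) * g (- x)) \<le> 0"
  proof (rule increasing_flux_le[where N = "uminus ` N"])
    show "(\<lambda>x. g (- x)) integrable_on {- \<beta>..- \<alpha>}"
      using gi by (simp add: integrable_reflect_real)
    show "negligible (uminus ` N)"
      by (rule negligible_differentiable_image_negligible[OF _ N]) (auto intro!: derivative_intros)
    show "integral {c..- \<alpha>} (\<lambda>x. g (- x)) \<le> 0" if "c \<in> {- \<beta>..- \<alpha>}" for c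
      using tail[of "- c"] that Henstock_Kurzweil_Integration.integral_reflect_real[of "- c" \<alpha> g] by simp
    show "h (- x) \<le> h (- y)" if "- \<beta> < x" "x < y" "y < - \<alpha>" "x \<notin> uminus ` N" "y \<notin> uminus ` N" for x y
    proof -
      have "- x \<notin> N" "- y \<notin> N" using that(4,5) by force+
      then show ?thesis using mono[of "- y" "- x"] that by auto
    qed
  qed (use ab h01 in auto)
  then show ?thesis
    using Henstock_Kurzweil_Integration.integral_reflect_real[of \<beta> \<alpha> "\<lambda>x. h x * g x"] by simp
qed

lemma open_connected_bounded_real:
  fixes C :: "real set"
  assumes "open C" "connected C" "bounded C" "C \<noteq> {}"
  obtains \<alpha> \<beta> where "\<alpha> < \<beta>" "C = {\<alpha><..<\<beta>}"
proof -
  have bdd: "bdd_below C" "bdd_above C"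
    using \<open>bounded C\<close> by (auto intro: bounded_imp_bdd_below bounded_imp_bdd_above)
  have sub: "C \<subseteq> {Inf C<..<Sup C}"
  proof
    fix x assume "x \<in> C"
    with \<open>open C\<close> obtain e where e: "e > 0" "ball x e \<subseteq> C" unfolding open_contains_ball by blast
    have "x - e / 2 \<in> C" "x + e / 2 \<in> C" using e by (auto simp: subset_iff dist_real_def)
    then have "Inf C \<le> x - e / 2" "x + e / 2 \<le> Sup C" using bdd by (auto intro: cInf_lower cSup_upper)
    then show "x \<in> {Inf C<..<Sup C}" using e(1) by auto
  qed
  moreover have "{Inf C<..<Sup C} \<subseteq> C"
  proof
    fix x assume x: "x \<in> {Inf C<..<Sup C}"
    then obtain y z where "y \<in> C" "y < x" "z \<in> C" "x < z"
      using cInf_less_iff[OF \<open>C \<noteq> {}\<close> bdd(1), of x] less_cSup_iff[OF \<open>C \<noteq> {}\<close> bdd(2), of x] by auto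
    then show "x \<in> C"
      using \<open>connected C\<close> unfolding connected_iff_interval by (meson less_imp_le)
  qed
  ultimately have "C = {Inf C<..<Sup C}" by blast
  with \<open>C \<noteq> {}\<close> show ?thesis
    by (metis greaterThanLessThan_empty_iff not_less that)
qed

text \<open>What the proof needs to know about the evolution at one fixed time: \<open>V\<close> is the flux, \<open>g\<close> its
  derivative, \<open>w\<close> the solution, and the sign condition is expressed as monotonicity of \<open>w\<close> off a null
  set on intervals where \<open>V\<close> has a strict sign.\<close>

locale flux_slice =
  fixes a b :: real and w g V :: "real \<Rightarrow> real" and N :: "real set"
  assumes ab: "a < b" and Vc: "continuous_on {a..b} V" and V0: "V a = 0" "V b = 0"
    and ga: "g absolutely_integrable_on {a..b}"
    and prim: "\<And>x y. a \<le> x \<Longrightarrow> x \<le> y \<Longrightarrow> y \<le> b \<Longrightarrow> V y - V x = integral {x..y} g"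
    and wm: "w \<in> borel_measurable borel" and N: "negligible N"
    and incr: "\<And>x y. a < x \<Longrightarrow> x < y \<Longrightarrow> y < b \<Longrightarrow> x \<notin> N \<Longrightarrow> y \<notin> N \<Longrightarrow>
       (\<And>z. z \<in> {x..y} \<Longrightarrow> V z > 0) \<Longrightarrow> w x \<le> w y"
    and decr: "\<And>x y. a < x \<Longrightarrow> x < y \<Longrightarrow> y < b \<Longrightarrow> x \<notin> N \<Longrightarrow> y \<notin> N \<Longrightarrow>
       (\<And>z. z \<in> {x..y} \<Longrightarrow> V z < 0) \<Longrightarrow> w y \<le> w x"
begin

text \<open>At a zero of \<open>V\<close> that is a limit of zeros from the right, all these zeros give difference quotients of
  \<open>V\<close> equal to \<open>0\<close>, so the derivative vanishes; the other zeros are countably many.\<close>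

lemma density_zero_on_zero_set:
  obtains M where "negligible M" "\<And>x. x \<in> {a<..<b} \<Longrightarrow> V x = 0 \<Longrightarrow> x \<notin> M \<Longrightarrow> g x = 0"
proof -
  define Z where "Z = {x \<in> {a<..<b}. V x = 0}"
  have "integrable (lebesgue_on {a<..<b}) g"
    using ga unfolding absolutely_integrable_on_Icc_iff_Ioo
    by (simp add: integrable_restrict_space set_integrable_def)
  then obtain L where L: "negligible L"
    "\<And>x. a < x \<Longrightarrow> x < b \<Longrightarrow> x \<notin> L \<Longrightarrow> ((\<lambda>h. integral {x..x + h} g / h) \<longlongrightarrow> g x) (at_right 0)"
    by (rule right_lebesgue_points) (rule that)
  define R where "R = {x \<in> Z. \<exists>d>0. {x<..<x + d} \<inter> Z = {}}"
  show ?thesis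
  proof (rule that[of "L \<union> R"])
    show "negligible (L \<union> R)"
      using L(1) countable_right_isolated[of Z] by (auto simp: R_def intro: countable_imp_null_set_lborel null_sets_completionI simp: negligible_iff_null_sets)
    fix x assume x: "x \<in> {a<..<b}" "V x = 0" "x \<notin> L \<union> R"
    then have xZ: "x \<in> Z" by (simp add: Z_def)
    show "g x = 0"
    proof (rule ccontr)
      assume "g x \<noteq> 0"
      then have "\<forall>\<^sub>F h in at_right 0. integral {x..x + h} g / h \<noteq> 0"
        by (rule tendsto_imp_eventually_ne[rotated]) (use L(2) x in auto)
      then obtain d where d: "d > 0" "\<And>h. 0 < h \<Longrightarrow> h < d \<Longrightarrow> integral {x..x + h} g \<noteq> 0"
        unfolding eventually_at_right_field by auto
      have "{x<..<x + d} \<inter> Z \<noteq> {}" using x(3) xZ d(1) unfolding R_def by blast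
      then obtain y where y: "x < y" "y < x + d" "y \<in> Z" by auto
      have "integral {x..y} g = 0"
        using prim[of x y] x y by (auto simp: Z_def)
      then show False using d(2)[of "y - x"] y by auto
    qed
  qed
qed

text \<open>The interval is split into the components of \<open>{V \<noteq> 0}\<close> and the zero set of \<open>V\<close>, where \<open>g = 0\<close>. On a
  component with \<open>V > 0\<close> the function \<open>f \<circ> w\<close> increases, so only the value of \<open>V\<close> at the right end
  matters. That value is zero unless the component ends at \<open>q < b\<close>, and then \<open>f (w q) = 0\<close> forces
  \<open>f \<circ> w = 0\<close> on the component. Components with \<open>V < 0\<close> are symmetric.\<close>

lemma flux_nonpos:
  assumes f: "mono f" "\<And>x. 0 \<le> f x" "\<And>x. f x \<le> 1"
    and pq: "a \<le> p" "p < q" "q \<le> b"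
    and left: "p = a \<or> p \<notin> N \<and> f (w p) = 0"
    and right: "q = b \<or> q \<notin> N \<and> f (w q) = 0"
  shows "(\<lambda>x. f (w x) * g x) absolutely_integrable_on {p..q}"
    and "integral {p..q} (\<lambda>x. f (w x) * g x) \<le> 0"
proof -
  let ?h = "\<lambda>x. f (w x)"
  let ?F = "\<lambda>x. ?h x * g x"
  have hm: "?h \<in> borel_measurable borel"
    using borel_measurable_mono[OF f(1)] wm by (rule measurable_compose[rotated])
  have ai: "?F absolutely_integrable_on {a..b}"
  proof (rule absolutely_integrable_bounded_measurable_product_real[OF _ _ _ ga])
    show "?h \<in> borel_measurable (lebesgue_on {a..b})"
      by (rule borel_measurable_lebesgue_on[OF hm])
    show "bounded (?h ` {a..b})"
      unfolding bounded_iff using f(2,3) by (intro exI[of _ 1]) auto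
  qed auto
  then show ai': "?F absolutely_integrable_on {p..q}"
    by (rule absolutely_integrable_on_subinterval) (use pq in auto)
  have gi: "g integrable_on {x..y}" if "a \<le> x" "y \<le> b" for x y
    by (rule integrable_subinterval_real[OF set_lebesgue_integral_eq_integral(1)[OF ga]]) (use that in auto)
  define O' where "O' = {p<..<q} \<inter> V -` (- {0})"
  have Oo: "open O'"
    unfolding O'_def
    by (rule continuous_open_preimage) (use pq in \<open>auto intro: continuous_on_subset[OF Vc]\<close>)
  have Osub: "O' \<subseteq> {p<..<q}" by (auto simp: O'_def)
  have comp: "(LINT x:C|lebesgue. ?F x) \<le> 0" if C: "C \<in> components O'" for C
  proof -
    have Co: "open C" and Cc: "connected C" and Cn: "C \<noteq> {}" and CO: "C \<subseteq> O'"
      using open_components[OF Oo C] in_components_connected[OF C] in_components_nonempty[OF C] in_components_subset[OF C]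
      by auto
    have "bounded C"
      by (rule bounded_subset[OF bounded_closed_interval[of p q]]) (use CO Osub in auto)
    then obtain \<alpha> \<beta> where Ce: "\<alpha> < \<beta>" "C = {\<alpha><..<\<beta>}"
      using open_connected_bounded_real[OF Co Cc _ Cn] by blast
    have "closure C \<subseteq> {p..q}"
      by (rule closure_minimal) (use CO Osub in auto)
    then have r: "p \<le> \<alpha>" "\<beta> \<le> q" using Ce by (auto simp: closure_greaterThanLessThan)
    \<comment> \<open>By maximality of the component, \<open>V\<close> vanishes at an end point that lies inside \<open>(p, q)\<close>.\<close>
    have ends: "e = p \<or> e = q \<or> V e = 0" if e: "e \<in> {\<alpha>, \<beta>}" for e
    proof (rule ccontr)
      assume n: "\<not> ?thesis"
      then have "e \<in> O'" using e r Ce by (auto simp: O'_def)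
      moreover have "connected (insert e C)"
        by (rule connected_intermediate_closure[OF Cc])
          (use Ce e in \<open>auto simp: closure_greaterThanLessThan\<close>)
      ultimately have "insert e C \<subseteq> C"
        using components_maximal[OF C, of "insert e C"] CO Cn by auto
      then show False using Ce e by auto
    qed
    have nz: "V x \<noteq> 0" if "\<alpha> < x" "x < \<beta>" for x using CO Ce that by (auto simp: O'_def)
    have contC: "continuous_on {\<alpha>..\<beta>} V" by (rule continuous_on_subset[OF Vc]) (use r pq in auto)
    have sign: "(\<forall>x. \<alpha> < x \<and> x < \<beta> \<longrightarrow> V x > 0) \<or> (\<forall>x. \<alpha> < x \<and> x < \<beta> \<longrightarrow> V x < 0)"
    proof (rule ccontr)
      assume "\<not> ?thesis"
      then obtain x y where xy: "\<alpha> < x" "x < \<beta>" "V x \<le> 0" "\<alpha> < y" "y < \<beta>" "0 \<le> V y" by (auto simp: not_less)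
      have "connected (V ` C)"
        by (rule connected_continuous_image[OF continuous_on_subset[OF contC] Cc]) (use Ce in auto)
      moreover have "V x \<in> V ` C" "V y \<in> V ` C" using Ce xy by auto
      ultimately have "0 \<in> V ` C" using xy unfolding connected_iff_interval by blast
      then show False using nz Ce by auto
    qed
    have endpos: "V e \<ge> 0" if "\<forall>x. \<alpha> < x \<and> x < \<beta> \<longrightarrow> V x > 0" "e \<in> {\<alpha>..\<beta>}" for e
      using continuous_ge_on_closure[of "{\<alpha><..<\<beta>}" V e 0] contC that Ce
      by (auto simp: closure_greaterThanLessThan less_imp_le)
    have endneg: "V e \<le> 0" if "\<forall>x. \<alpha> < x \<and> x < \<beta> \<longrightarrow> V x < 0" "e \<in> {\<alpha>..\<beta>}" for e
      using continuous_le_on_closure[of "{\<alpha><..<\<beta>}" V e 0] contC that Ce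
      by (auto simp: closure_greaterThanLessThan less_imp_le)
    have zero: "integral {\<alpha>..\<beta>} ?F = 0" if z: "\<And>x. \<alpha> < x \<Longrightarrow> x < \<beta> \<Longrightarrow> x \<notin> N \<Longrightarrow> ?h x = 0"
    proof -
      have "integral {\<alpha>..\<beta>} (\<lambda>x. 0) = integral {\<alpha>..\<beta>} ?F"
        by (rule integral_spike[of "N \<union> {\<alpha>, \<beta>}"]) (use N z in auto)
      then show ?thesis by simp
    qed
    have "integral {\<alpha>..\<beta>} ?F \<le> 0"
      using sign
    proof
      assume pos: "\<forall>x. \<alpha> < x \<and> x < \<beta> \<longrightarrow> V x > 0"
      show ?thesis
      proof (cases "V \<beta> = 0")
        case True
        show ?thesis
        proof (rule increasing_flux_le[OF _ gi N])
          show "integral {c..\<beta>} g \<le> 0" if "c \<in> {\<alpha>..\<beta>}" for c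
            using prim[of c \<beta>] endpos[OF pos that] True that r pq by auto
          show "?h x \<le> ?h y" if "\<alpha> < x" "x < y" "y < \<beta>" "x \<notin> N" "y \<notin> N" for x y
            using that r pq pos by (intro monoD[OF f(1)] incr) auto
        qed (use Ce r pq f in auto)
      next
        case False
        then have \<beta>: "\<beta> = q" using ends[of \<beta>] Ce r by auto
        with False V0 right have q: "q \<noteq> b" "q \<notin> N" "f (w q) = 0" by auto
        have "V \<beta> > 0" using endpos[OF pos, of \<beta>] False Ce by auto
        have "?h x = 0" if "\<alpha> < x" "x < \<beta>" "x \<notin> N" for x
        proof -
          have "w x \<le> w q"
            by (rule incr) (use that pos \<open>V \<beta> > 0\<close> \<beta> q pq r in \<open>auto simp: le_less\<close>)
          then show ?thesis using monoD[OF f(1), of "w x" "w q"] q f(2)[of "w x"] by simp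
        qed
        then show ?thesis using zero by simp
      qed
    next
      assume neg: "\<forall>x. \<alpha> < x \<and> x < \<beta> \<longrightarrow> V x < 0"
      show ?thesis
      proof (cases "V \<alpha> = 0")
        case True
        show ?thesis
        proof (rule decreasing_flux_le[OF _ gi N])
          show "integral {\<alpha>..c} g \<le> 0" if "c \<in> {\<alpha>..\<beta>}" for c
            using prim[of \<alpha> c] endneg[OF neg that] True that r pq by auto
          show "?h y \<le> ?h x" if "\<alpha> < x" "x < y" "y < \<beta>" "x \<notin> N" "y \<notin> N" for x y
            using that r pq neg by (intro monoD[OF f(1)] decr) auto
        qed (use Ce r pq f in auto)
      next
        case False
        then have \<alpha>: "\<alpha> = p" using ends[of \<alpha>] Ce r by auto
        with False V0 left have p: "p \<noteq> a" "p \<notin> N" "f (w p) = 0" by auto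
        have "V \<alpha> < 0" using endneg[OF neg, of \<alpha>] False Ce by auto
        have "?h x = 0" if "\<alpha> < x" "x < \<beta>" "x \<notin> N" for x
        proof -
          have "w x \<le> w p"
            by (rule decr) (use that neg \<open>V \<alpha> < 0\<close> \<alpha> p pq r in \<open>auto simp: le_less\<close>)
          then show ?thesis using monoD[OF f(1), of "w x" "w p"] p f(2)[of "w x"] by simp
        qed
        then show ?thesis using zero by simp
      qed
    qed
    moreover have "(LINT x:C|lebesgue. ?F x) = integral {\<alpha>..\<beta>} ?F"
    proof -
      have "?F absolutely_integrable_on {\<alpha>..\<beta>}"
        by (rule absolutely_integrable_on_subinterval[OF ai]) (use r pq in auto)
      then have "?F absolutely_integrable_on {\<alpha><..<\<beta>}"
        by (simp add: absolutely_integrable_on_Icc_iff_Ioo)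
      then have "(LINT x:C|lebesgue. ?F x) = integral {\<alpha><..<\<beta>} ?F"
        using set_lebesgue_integral_eq_integral(2) Ce by blast
      then show ?thesis by (simp add: integral_open_interval_real)
    qed
    ultimately show ?thesis by simp
  qed
  have Oi: "set_integrable lebesgue O' ?F"
    by (rule set_integrable_subset[OF ai']) (use Osub Oo in auto)
  have "(LINT x:O'|lebesgue. ?F x) \<le> 0"
  proof (cases "components O' = {}")
    case True
    then have "O' = {}" by (metis Union_components Union_empty)
    then show ?thesis by (simp add: set_lebesgue_integral_def)
  next
    case False
    \<comment> \<open>Countable additivity over the components, by exhaustion with finite unions.\<close>
    define e where "e = from_nat_into (components O')"
    have cc: "countable (components O')"
    proof (rule countable_disjoint_open_subsets)
      show "open C" if "C \<in> components O'" for C using open_components[OF Oo that] .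
      show "disjoint (components O')"
        unfolding disjoint_def using components_nonoverlap by metis
    qed
    have re: "range e = components O'"
      unfolding e_def by (rule range_from_nat_into[OF False cc])
    let ?A = "\<lambda>n. \<Union>C\<in>e ` {..n}. C"
    have U: "(\<Union>n. ?A n) = O'"
    proof -
      have "(\<Union>n. ?A n) = \<Union>(range e)" by auto
      then show ?thesis using re Union_components by metis
    qed
    have "(\<lambda>n. LINT x:?A n|lebesgue. ?F x) \<longlonglongrightarrow> (LINT x:(\<Union>n. ?A n)|lebesgue. ?F x)"
    proof (rule set_integral_cont_up)
      show "?A n \<in> sets lebesgue" for n
      proof (rule sets.finite_UN)
        show "C \<in> sets lebesgue" if "C \<in> e ` {..n}" for C
        proof -
          have "C \<in> components O'" using that re by auto
          then show ?thesis using open_components[OF Oo] by simp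
        qed
      qed auto
      show "incseq ?A" unfolding incseq_def by force
      show "set_integrable lebesgue (\<Union>n. ?A n) ?F" unfolding U by (rule Oi)
    qed
    moreover have "(LINT x:?A n|lebesgue. ?F x) \<le> 0" for n
    proof -
      have Cs: "C \<in> components O'" if "C \<in> e ` {..n}" for C using that re by auto
      have "(LINT x:?A n|lebesgue. ?F x) = (\<Sum>C\<in>e ` {..n}. LINT x:C|lebesgue. ?F x)"
      proof (rule set_integral_finite_Union)
        show "disjoint_family_on (\<lambda>C. C) (e ` {..n})"
          unfolding disjoint_family_on_def using Cs components_nonoverlap by metis
        show m: "C \<in> sets lebesgue" if "C \<in> e ` {..n}" for C
          using open_components[OF Oo Cs[OF that]] by simp
        show "set_integrable lebesgue C ?F" if "C \<in> e ` {..n}" for C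
          by (rule set_integrable_subset[OF Oi m[OF that]]) (use Cs[OF that] in_components_subset in auto)
      qed auto
      also have "\<dots> \<le> 0" by (rule sum_nonpos) (use comp Cs in auto)
      finally show ?thesis .
    qed
    ultimately show ?thesis unfolding U by (intro LIMSEQ_le_const2) auto
  qed
  moreover have "integral {p..q} ?F = (LINT x:O'|lebesgue. ?F x)"
  proof -
    obtain M where M: "negligible M" "\<And>x. x \<in> {a<..<b} \<Longrightarrow> V x = 0 \<Longrightarrow> x \<notin> M \<Longrightarrow> g x = 0"
      using density_zero_on_zero_set by blast
    have "integral {p..q} ?F = integral {p..q} (\<lambda>x. if x \<in> O' then ?F x else 0)"
    proof (rule integral_spike[of "M \<union> {p, q}"])
      show "negligible (M \<union> {p, q})" using M(1) by auto
      show "(if x \<in> O' then ?F x else 0) = ?F x" if "x \<in> {p..q} - (M \<union> {p, q})" for x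
        using M(2)[of x] that pq by (auto simp: O'_def)
    qed
    also have "\<dots> = integral O' ?F"
    proof -
      have "O' \<inter> {p..q} = O'" using Osub by auto
      then show ?thesis by (simp add: integral_restrict_Int)
    qed
    also have "\<dots> = (LINT x:O'|lebesgue. ?F x)"
      using set_lebesgue_integral_eq_integral(2)[OF Oi] by simp
    finally show ?thesis .
  qed
  ultimately show "integral {p..q} ?F \<le> 0" by simp
qed

lemma flux_slice_uminus: "flux_slice a b (\<lambda>x. - w x) (\<lambda>x. - g x) (\<lambda>x. - V x) N"
proof
  show "(\<lambda>x. - g x) absolutely_integrable_on {a..b}"
    using set_integrable_mult_right[of "-1" lebesgue "{a..b}" g] ga by simp
  show "- V y - - V x = integral {x..y} (\<lambda>x. - g x)" if "a \<le> x" "x \<le> y" "y \<le> b" for x y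
    using prim[OF that] by simp
qed (use ab Vc V0 wm N incr decr in \<open>auto intro!: continuous_intros\<close>)

end


section \<open>Alternating sums\<close>

definition alternating_sum :: "nat \<Rightarrow> (real \<Rightarrow> real) \<Rightarrow> (nat \<Rightarrow> real) \<Rightarrow> real" where
  "alternating_sum n w x = (\<Sum>i=1..n. (-1) ^ i * w (x i))"

definition ordered_chain :: "real \<Rightarrow> real \<Rightarrow> nat \<Rightarrow> (nat \<Rightarrow> real) \<Rightarrow> bool" where
  "ordered_chain a b n x \<longleftrightarrow> (\<forall>i\<in>{1..n}. a < x i \<and> x i < b) \<and> (\<forall>i\<in>{1..<n}. x i < x (Suc i))"

text \<open>The exceptional set is a null set of the line rather than of \<open>\<real>\<^sup>n\<close>. This makes it possible to
  add, remove and merge points in the arguments below.\<close>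

definition oscillation_le :: "real \<Rightarrow> real \<Rightarrow> nat \<Rightarrow> (real \<Rightarrow> real) \<Rightarrow> real \<Rightarrow> bool" where
  "oscillation_le a b n w k \<longleftrightarrow> (\<exists>N. negligible N \<and>
     (\<forall>x. ordered_chain a b n x \<longrightarrow> (\<forall>i\<in>{1..n}. x i \<notin> N) \<longrightarrow> alternating_sum n w x \<le> k))"

lemma oscillation_le_cong_AE:
  assumes "oscillation_le a b n w k" and eq: "AE x in lborel. a < x \<longrightarrow> x < b \<longrightarrow> w x = w' x"
  shows "oscillation_le a b n w' k"
proof -
  obtain N where N: "negligible N"
    "\<And>x. ordered_chain a b n x \<Longrightarrow> (\<forall>i\<in>{1..n}. x i \<notin> N) \<Longrightarrow> alternating_sum n w x \<le> k"
    using assms(1) unfolding oscillation_le_def by blast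
  have "AE x in lebesgue. a < x \<longrightarrow> x < b \<longrightarrow> w x = w' x"
    using eq by (simp add: AE_completion_iff)
  then obtain M where "M \<in> null_sets lebesgue" and M2: "{x. \<not> (a < x \<longrightarrow> x < b \<longrightarrow> w x = w' x)} \<subseteq> M"
    unfolding eventually_ae_filter by auto
  then have M: "negligible M" by (simp add: negligible_iff_null_sets)
  have "alternating_sum n w' x \<le> k" if x: "ordered_chain a b n x" "\<forall>i\<in>{1..n}. x i \<notin> N \<union> M" for x
  proof -
    have "w (x i) = w' (x i)" if "i \<in> {1..n}" for i
      using x that M2 unfolding ordered_chain_def by blast
    then have "alternating_sum n w' x = alternating_sum n w x"
      unfolding alternating_sum_def by (intro sum.cong) auto
    then show ?thesis using N(2)[OF x(1)] x(2) by auto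
  qed
  then show ?thesis
    unfolding oscillation_le_def using N(1) M by (intro exI[of _ "N \<union> M"]) auto
qed

text \<open>Uncountably many points cannot be distinguished by the countably many values of \<open>\<lfloor>w y / e\<rfloor>\<close>.\<close>

lemma close_values_in_interval:
  fixes w :: "real \<Rightarrow> real"
  assumes "l < b" "negligible N" "e > 0"
  obtains y z where "l < y" "y < z" "z < b" "y \<notin> N" "z \<notin> N" "\<bar>w y - w z\<bar> < e"
proof -
  let ?J = "{l<..<b} - N"
  have "\<not> countable ?J"
  proof
    assume "countable ?J"
    then have "negligible ?J"
      by (intro null_sets_completionI countable_imp_null_set_lborel[THEN null_sets_completionI] iffD2[OF negligible_iff_null_sets])
    then have "negligible (?J \<union> N)" using assms(2) by (rule negligible_Un)
    then have "negligible {l<..<b}" by (rule negligible_subset) auto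
    then show False using open_not_negligible[of "{l<..<b}"] \<open>l < b\<close> by auto
  qed
  then have "\<not> inj_on (\<lambda>y. \<lfloor>w y / e\<rfloor>) ?J"
    using countable_image_inj_on[of "\<lambda>y. \<lfloor>w y / e\<rfloor>" ?J] by auto
  then obtain y z where yz: "y \<in> ?J" "z \<in> ?J" "y \<noteq> z" "\<lfloor>w y / e\<rfloor> = \<lfloor>w z / e\<rfloor>"
    unfolding inj_on_def by auto
  have "\<bar>w y / e - w z / e\<bar> < 1" using yz(4) by linarith
  then have "\<bar>w y - w z\<bar> < e" using \<open>e > 0\<close> by (simp add: abs_less_iff field_simps)
  then show ?thesis using that[of y z] that[of z y] yz by (cases "y < z") (auto simp: abs_minus_commute)
qed

text \<open>Two points to the right of the given ones, at which \<open>w\<close> takes almost the same value, change the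
  alternating sum by an arbitrarily small amount.\<close>

lemma oscillation_le_fewer_points:
  assumes "oscillation_le a b (n + 2) w k" "a < b"
  shows "oscillation_le a b n w k"
proof -
  obtain N where N: "negligible N"
    "\<And>x. ordered_chain a b (n + 2) x \<Longrightarrow> (\<forall>i\<in>{1..n + 2}. x i \<notin> N) \<Longrightarrow> alternating_sum (n + 2) w x \<le> k"
    using assms(1) unfolding oscillation_le_def by blast
  have "alternating_sum n w x \<le> k" if x: "ordered_chain a b n x" "\<forall>i\<in>{1..n}. x i \<notin> N" for x
  proof (rule field_le_epsilon)
    fix e :: real assume e: "e > 0"
    define l where "l = (if n = 0 then a else x n)"
    have "a < x n \<and> x n < b" if "n \<noteq> 0"
    proof -
      have "n \<in> {1..n}" using that by simp
      then show ?thesis using x(1) unfolding ordered_chain_def by blast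
    qed
    then have l: "a \<le> l" "l < b" using \<open>a < b\<close> unfolding l_def by auto
    obtain y z where yz: "l < y" "y < z" "z < b" "y \<notin> N" "z \<notin> N" "\<bar>w y - w z\<bar> < e"
      using close_values_in_interval[OF l(2) N(1) e] by blast
    define x' where "x' = x(Suc n := y, Suc (Suc n) := z)"
    have x': "x' i = x i" if "i \<le> n" for i using that by (auto simp: x'_def)
    have "ordered_chain a b (n + 2) x'"
      unfolding ordered_chain_def
    proof (intro conjI ballI)
      fix i assume "i \<in> {1..n + 2}"
      then consider "i \<in> {1..n}" | "i = Suc n" | "i = Suc (Suc n)" by fastforce
      then have "a < x' i \<and> x' i < b"
        using x(1) l yz x'[of i] unfolding ordered_chain_def by cases (auto simp: x'_def)
      then show "a < x' i" "x' i < b" by auto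
    next
      fix i assume "i \<in> {1..<n + 2}"
      then consider "i \<in> {1..<n}" | "i = n" "n > 0" | "i = Suc n" by fastforce
      then show "x' i < x' (Suc i)"
        using x(1) yz x'[of i] x'[of "Suc i"] unfolding ordered_chain_def
        by cases (auto simp: x'_def l_def)
    qed
    moreover have "\<forall>i\<in>{1..n + 2}. x' i \<notin> N"
      using x(2) yz by (auto simp: x'_def)
    ultimately have "alternating_sum (n + 2) w x' \<le> k" by (rule N(2))
    moreover have "alternating_sum (n + 2) w x' = alternating_sum n w x + (-1) ^ Suc n * (w y - w z)"
    proof -
      have "(\<Sum>i=1..n. (-1) ^ i * w (x' i)) = alternating_sum n w x"
        unfolding alternating_sum_def using x' by (intro sum.cong) auto
      then show ?thesis by (simp add: alternating_sum_def x'_def algebra_simps)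
    qed
    moreover have "\<bar>(-1) ^ Suc n * (w y - w z)\<bar> < e" using yz(6) by (simp add: abs_mult)
    ultimately show "alternating_sum n w x \<le> k + e" by linarith
  qed
  then show ?thesis unfolding oscillation_le_def using N(1) by blast
qed

lemma alternating_sum_remove_pair:
  assumes i: "1 \<le> i" "Suc i \<le> n" and eq: "x i = x (Suc i)"
  shows "alternating_sum n w x = alternating_sum (n - 2) w (\<lambda>j. if j < i then x j else x (j + 2))"
proof -
  let ?f = "\<lambda>j. (-1) ^ j * w (x j)"
  have split: "{1..n} = {1..<i} \<union> {i, Suc i} \<union> {i + 2..n}" using i by auto
  have "alternating_sum n w x = (\<Sum>j\<in>{1..<i}. ?f j) + (\<Sum>j\<in>{i, Suc i}. ?f j) + (\<Sum>j\<in>{i + 2..n}. ?f j)"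
    unfolding alternating_sum_def split
    by (subst sum.union_disjoint, auto)+
  also have "(\<Sum>j\<in>{i, Suc i}. ?f j) = 0" using eq by simp
  also have "(\<Sum>j\<in>{i + 2..n}. ?f j) = (\<Sum>j\<in>{i..n - 2}. ?f (j + 2))"
    by (rule sym, rule sum.reindex_bij_witness[of _ "\<lambda>j. j - 2" "\<lambda>j. j + 2"]) (use i in auto)
  also have "(\<Sum>j\<in>{1..<i}. ?f j) + 0 + (\<Sum>j\<in>{i..n - 2}. ?f (j + 2)) =
     (\<Sum>j\<in>{1..<i} \<union> {i..n - 2}. (-1) ^ j * w (if j < i then x j else x (j + 2)))"
    by (subst sum.union_disjoint) auto
  also have "{1..<i} \<union> {i..n - 2} = {1..n - 2}" using i by auto
  finally show ?thesis by (simp add: alternating_sum_def)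
qed

text \<open>Almost every point \<open>x\<close> is such that the values of \<open>w\<close> close to \<open>w x\<close> are attained near \<open>x\<close> on a set of
  positive measure. The exceptional points lie in the union of those preimages of rational intervals,
  intersected with rational intervals, that are null sets.\<close>

lemma essential_value_points:
  fixes w :: "real \<Rightarrow> real"
  assumes [measurable]: "w \<in> borel_measurable borel"
  obtains N where "negligible N"
    "\<And>x d e. a < x \<Longrightarrow> x < b \<Longrightarrow> x \<notin> N \<Longrightarrow> d > 0 \<Longrightarrow> e > 0 \<Longrightarrow>
       emeasure lborel {y. a < y \<and> y < b \<and> \<bar>y - x\<bar> < d \<and> \<bar>w y - w x\<bar> < e} \<noteq> 0"
proof -
  define E where "E p q r s = {y. a < y \<and> y < b \<and> p < y \<and> y < q \<and> r < w y \<and> w y < s}" for p q r s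
  have Em: "E p q r s \<in> sets borel" for p q r s unfolding E_def by measurable
  define I where "I = {(p, q, r, s). p \<in> \<rat> \<and> q \<in> \<rat> \<and> r \<in> \<rat> \<and> s \<in> \<rat> \<and> emeasure lborel (E p q r s) = 0}"
  have "countable (\<rat> \<times> \<rat> \<times> \<rat> \<times> \<rat> :: (real \<times> real \<times> real \<times> real) set)"
    by (intro countable_SIGMA countable_rat)
  then have cI: "countable I" by (rule countable_subset[rotated]) (auto simp: I_def)
  define N where "N = (\<Union>(p, q, r, s)\<in>I. E p q r s)"
  have "N \<in> null_sets lborel"
    unfolding N_def using cI by (rule null_sets_UN') (use Em in \<open>auto simp: I_def null_sets_def\<close>)
  then have "negligible N" by (simp add: negligible_iff_null_sets null_sets_completionI)
  then show ?thesis
  proof (rule that)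
    fix x d e :: real assume x: "a < x" "x < b" "x \<notin> N" "d > 0" "e > 0"
    obtain p where p: "p \<in> \<rat>" "x - d < p" "p < x" using Rats_dense_in_real[of "x - d" x] x by auto
    obtain q where q: "q \<in> \<rat>" "x < q" "q < x + d" using Rats_dense_in_real[of x "x + d"] x by auto
    obtain r where r: "r \<in> \<rat>" "w x - e < r" "r < w x" using Rats_dense_in_real[of "w x - e" "w x"] x by auto
    obtain s where s: "s \<in> \<rat>" "w x < s" "s < w x + e" using Rats_dense_in_real[of "w x" "w x + e"] x by auto
    have "x \<in> E p q r s" using x p q r s by (auto simp: E_def)
    with x(3) p q r s have "emeasure lborel (E p q r s) \<noteq> 0" by (auto simp: N_def I_def)
    moreover have "emeasure lborel (E p q r s) \<le>
        emeasure lborel {y. a < y \<and> y < b \<and> \<bar>y - x\<bar> < d \<and> \<bar>w y - w x\<bar> < e}"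
      using p q r s by (intro emeasure_mono) (auto simp: E_def)
    ultimately show "emeasure lborel {y. a < y \<and> y < b \<and> \<bar>y - x\<bar> < d \<and> \<bar>w y - w x\<bar> < e} \<noteq> 0"
      by auto
  qed
qed

lemma finite_positive_lower_bound:
  fixes f :: "'a \<Rightarrow> real"
  assumes "finite A" "\<And>i. i \<in> A \<Longrightarrow> f i > 0"
  obtains d where "d > 0" "\<And>i. i \<in> A \<Longrightarrow> d \<le> f i"
proof (rule that[of "Min (insert 1 (f ` A))"])
  show "Min (insert 1 (f ` A)) > 0" using assms by (subst Min_gr_iff) auto
  show "Min (insert 1 (f ` A)) \<le> f i" if "i \<in> A" for i using assms that by (intro Min_le) auto
qed

text \<open>If the bound failed at a point whose coordinates are all as in \<open>essential_value_points\<close>, it would fail on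
  a product of sets of positive measure around that point. The measure \<open>M\<close> is general because the lemma
  is applied to Lebesgue measure and to the uniform distribution on \<open>(a,b)\<close>.\<close>

lemma oscillation_le_of_AE_PiM:
  fixes w :: "real \<Rightarrow> real" and M :: "real measure"
  assumes sf: "sigma_finite_measure M" and sM: "sets M = sets borel"
    and ac: "\<And>A. A \<in> sets borel \<Longrightarrow> A \<subseteq> {a<..<b} \<Longrightarrow> emeasure M A = 0 \<Longrightarrow> emeasure lborel A = 0"
    and wm: "w \<in> borel_measurable borel"
    and ae: "AE x in PiM {1..n} (\<lambda>_. M). ordered_chain a b n x \<longrightarrow> alternating_sum n w x \<le> k"
  shows "oscillation_le a b n w k"
proof -
  interpret product_sigma_finite "\<lambda>_::nat. M" using sf by (simp add: product_sigma_finite_def)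
  interpret finite_product_sigma_finite "\<lambda>_::nat. M" "{1..n}" by standard simp
  note wm[measurable]
  obtain N where N: "negligible N"
    "\<And>x d e. a < x \<Longrightarrow> x < b \<Longrightarrow> x \<notin> N \<Longrightarrow> d > 0 \<Longrightarrow> e > 0 \<Longrightarrow>
       emeasure lborel {y. a < y \<and> y < b \<and> \<bar>y - x\<bar> < d \<and> \<bar>w y - w x\<bar> < e} \<noteq> 0"
    using essential_value_points[OF wm, of a b] by blast
  have "alternating_sum n w x \<le> k" if x: "ordered_chain a b n x" "\<forall>i\<in>{1..n}. x i \<notin> N" for x
  proof (rule ccontr)
    assume "\<not> ?thesis"
    then have gap: "alternating_sum n w x - k > 0" by simp
    \<comment> \<open>Moving each value by less than \<open>e\<close> moves the sum by at most \<open>n * e\<close>, less than its excess over \<open>k\<close>.\<close>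
    define e where "e = (alternating_sum n w x - k) / (real n + 1)"
    have e: "e > 0" "real n * e < alternating_sum n w x - k" using gap by (auto simp: e_def field_simps)
    obtain d where d: "d > 0" "\<And>i. i \<in> {1..<n} \<Longrightarrow> d \<le> (x (Suc i) - x i) / 2"
      using finite_positive_lower_bound[of "{1..<n}" "\<lambda>i. (x (Suc i) - x i) / 2"] x(1)
      unfolding ordered_chain_def by auto
    define A where "A i = {y. a < y \<and> y < b \<and> \<bar>y - x i\<bar> < d \<and> \<bar>w y - w (x i)\<bar> < e}" for i
    have Am: "A i \<in> sets borel" for i unfolding A_def by measurable
    have Asub: "A i \<subseteq> {a<..<b}" for i by (auto simp: A_def)
    have Apos: "emeasure M (A i) \<noteq> 0" if "i \<in> {1..n}" for i
    proof -
      have "emeasure lborel (A i) \<noteq> 0"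
        unfolding A_def by (rule N(2)) (use x d(1) e(1) that in \<open>auto simp: ordered_chain_def\<close>)
      then show ?thesis using ac[OF Am Asub] by blast
    qed
    have bad: "\<not> (ordered_chain a b n z \<longrightarrow> alternating_sum n w z \<le> k)" if z: "z \<in> PiE {1..n} A" for z
    proof -
      have zA: "z i \<in> A i" if "i \<in> {1..n}" for i using z that by (auto simp: PiE_iff)
      have "ordered_chain a b n z"
        unfolding ordered_chain_def
      proof (intro conjI ballI)
        fix i assume "i \<in> {1..n}" then show "a < z i" "z i < b" using zA[of i] by (auto simp: A_def)
      next
        fix i assume i: "i \<in> {1..<n}"
        then have "\<bar>z i - x i\<bar> < d" "\<bar>z (Suc i) - x (Suc i)\<bar> < d"
          using zA[of i] zA[of "Suc i"] by (auto simp: A_def)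
        with d(2)[OF i] show "z i < z (Suc i)" by (simp add: field_simps abs_less_iff)
      qed
      moreover have "\<bar>alternating_sum n w x - alternating_sum n w z\<bar> \<le> (\<Sum>i=1..n. e)"
        unfolding alternating_sum_def sum_subtractf[symmetric]
      proof (rule order_trans[OF sum_abs sum_mono])
        fix i assume "i \<in> {1..n}"
        then have "\<bar>w (z i) - w (x i)\<bar> < e" using zA[of i] by (auto simp: A_def)
        then show "\<bar>(-1) ^ i * w (x i) - (-1) ^ i * w (z i)\<bar> \<le> e"
          by (simp add: right_diff_distrib[symmetric] abs_mult abs_minus_commute)
      qed
      ultimately show ?thesis using e(2) by auto
    qed
    have "PiE {1..n} A \<in> null_sets (PiM {1..n} (\<lambda>_. M))"
    proof -
      obtain B where B: "B \<in> null_sets (PiM {1..n} (\<lambda>_. M))"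
        "{x \<in> space (PiM {1..n} (\<lambda>_. M)). \<not> (ordered_chain a b n x \<longrightarrow> alternating_sum n w x \<le> k)} \<subseteq> B"
        using ae unfolding eventually_ae_filter by blast
      have "PiE {1..n} A \<in> sets (PiM {1..n} (\<lambda>_. M))"
        by (rule sets_PiM_I_finite) (use Am sM in auto)
      moreover from sets.sets_into_space[OF this] have "PiE {1..n} A \<subseteq> B" using B(2) bad by blast
      ultimately show ?thesis using B(1) null_sets_subset by blast
    qed
    moreover have "emeasure (PiM {1..n} (\<lambda>_. M)) (PiE {1..n} A) = (\<Prod>i\<in>{1..n}. emeasure M (A i))"
      by (rule emeasure_PiM) (use Am sM in auto)
    ultimately have "(\<Prod>i\<in>{1..n}. emeasure M (A i)) = 0" by (simp add: null_sets_def)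
    then show False using Apos by auto
  qed
  then show ?thesis unfolding oscillation_le_def using N(1) by blast
qed

lemma AE_PiM_coordinates:
  fixes M :: "real measure"
  assumes sf: "sigma_finite_measure M" and fin: "finite I" and ae: "AE y in M. Q y"
  shows "AE x in PiM I (\<lambda>_. M). \<forall>i\<in>I. Q (x i)"
proof -
  interpret product_sigma_finite "\<lambda>_. M" using sf by (simp add: product_sigma_finite_def)
  interpret finite_product_sigma_finite "\<lambda>_. M" I by standard fact
  obtain N where N: "N \<in> null_sets M" "{y \<in> space M. \<not> Q y} \<subseteq> N"
    using ae unfolding eventually_ae_filter by blast
  have "AE x in PiM I (\<lambda>_. M). Q (x i)" if i: "i \<in> I" for i
  proof (rule AE_I')
    let ?B = "\<lambda>j. if j = i then N else space M"
    show "PiE I ?B \<in> null_sets (PiM I (\<lambda>_. M))"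
    proof (rule null_setsI)
      have "emeasure (PiM I (\<lambda>_. M)) (PiE I ?B) = (\<Prod>j\<in>I. emeasure M (?B j))"
        using N(1) fin by (intro emeasure_PiM) auto
      also have "\<dots> = 0" using N(1) i fin by (intro prod_zero bexI[of _ i]) auto
      finally show "emeasure (PiM I (\<lambda>_. M)) (PiE I ?B) = 0" .
      show "PiE I ?B \<in> sets (PiM I (\<lambda>_. M))"
        using N(1) fin by (intro sets_PiM_I_finite) auto
    qed
    show "{x \<in> space (PiM I (\<lambda>_. M)). \<not> Q (x i)} \<subseteq> PiE I ?B"
      using N(2) i by (auto simp: space_PiM PiE_iff extensional_def)
  qed
  then show ?thesis using fin by (simp add: AE_finite_all)
qed

lemma AE_PiM_of_oscillation_le:
  fixes M :: "real measure"
  assumes sf: "sigma_finite_measure M" and ac: "\<And>Q. (AE y in lborel. Q y) \<Longrightarrow> AE y in M. Q y"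
    and osc: "oscillation_le a b n w k"
  shows "AE x in PiM {1..n} (\<lambda>_. M). ordered_chain a b n x \<longrightarrow> alternating_sum n w x \<le> k"
proof -
  obtain N where N: "negligible N"
    "\<And>x. ordered_chain a b n x \<Longrightarrow> (\<forall>i\<in>{1..n}. x i \<notin> N) \<Longrightarrow> alternating_sum n w x \<le> k"
    using osc unfolding oscillation_le_def by blast
  have "AE y in lebesgue. y \<notin> N" using N(1) by (intro AE_not_in) (simp add: negligible_iff_null_sets)
  then have "AE y in M. y \<notin> N" by (intro ac) (simp add: AE_completion_iff)
  from AE_PiM_coordinates[OF sf finite_atLeastAtMost this, of 1 n]
  show ?thesis by eventually_elim (use N(2) in auto)
qed


section \<open>A chain rule inequality\<close>

text \<open>A convex function with continuous bounded derivative that vanishes exactly on \<open>(-\<infinity>, 0]\<close>. With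
  the positive part itself the chain rule below would have to deal with the level set where its
  derivative jumps.\<close>

definition soft_pos :: "real \<Rightarrow> real" where
  "soft_pos y = max 0 y + exp (- max 0 y) - 1"

definition soft_pos_slope :: "real \<Rightarrow> real" where
  "soft_pos_slope y = 1 - exp (- max 0 y)"

lemma soft_pos_slope_bounds: "0 \<le> soft_pos_slope y" "soft_pos_slope y \<le> 1"
  by (auto simp: soft_pos_slope_def)

lemma soft_pos_slope_mono: "mono soft_pos_slope"
  by (rule monoI) (auto simp: soft_pos_slope_def)

lemma soft_pos_slope_eq_0: "y \<le> 0 \<Longrightarrow> soft_pos_slope y = 0"
  by (simp add: soft_pos_slope_def)

lemma soft_pos_nonneg: "0 \<le> soft_pos y"
  using exp_ge_add_one_self[of "- max 0 y"] by (simp add: soft_pos_def)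

lemma soft_pos_eq_0: "y \<le> 0 \<Longrightarrow> soft_pos y = 0"
  by (simp add: soft_pos_def)

lemma soft_pos_le_0D: "soft_pos y \<le> 0 \<Longrightarrow> y \<le> 0"
proof (rule ccontr)
  assume "soft_pos y \<le> 0" "\<not> y \<le> 0"
  then have "exp (- y) \<le> 1 + (- y)" by (simp add: soft_pos_def)
  moreover have "1 + (- y) < exp (- y)"
    using \<open>\<not> y \<le> 0\<close> exp_minus_greater[of y] by simp
  ultimately show False by simp
qed

lemma soft_pos_tangent: "soft_pos y - soft_pos z \<le> soft_pos_slope y * (y - z)"
proof -
  let ?y = "max 0 y" and ?z = "max 0 z"
  have "exp (- ?z) = exp (- ?y) * exp (?y - ?z)" by (simp flip: exp_add)
  also have "\<dots> \<ge> exp (- ?y) * (1 + (?y - ?z))"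
    by (intro mult_left_mono exp_ge_add_one_self) auto
  finally have "soft_pos y - soft_pos z \<le> soft_pos_slope y * (?y - ?z)"
    by (simp add: soft_pos_def soft_pos_slope_def algebra_simps)
  also have "\<dots> \<le> soft_pos_slope y * (y - z)"
    by (cases "y \<le> 0") (auto simp: soft_pos_slope_eq_0 intro!: mult_left_mono soft_pos_slope_bounds)
  finally show ?thesis .
qed

lemma continuous_primitive:
  fixes G :: "real \<Rightarrow> real"
  assumes G: "integrable lborel G"
  shows "continuous_on UNIV (\<lambda>t. LINT r|lborel. indicator {s<..t} r * G r)"
  unfolding continuous_on_sequentially
proof (intro allI ballI impI)
  fix X :: "nat \<Rightarrow> real" and t assume "(\<forall>n. X n \<in> UNIV) \<and> X \<longlonglongrightarrow> t"
  then have X: "X \<longlonglongrightarrow> t" by simp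
  have [measurable]: "G \<in> borel_measurable borel" using G by auto
  have "(\<lambda>n. LINT r|lborel. indicator {s<..X n} r * G r) \<longlonglongrightarrow> (LINT r|lborel. indicator {s<..t} r * G r)"
  proof (rule integral_dominated_convergence[where w = "\<lambda>r. \<bar>G r\<bar>"])
    have "AE r in lborel. r \<noteq> t" by (rule AE_lborel_singleton)
    then show "AE r in lborel. (\<lambda>n. indicator {s<..X n} r * G r) \<longlonglongrightarrow> indicator {s<..t} r * G r"
    proof eventually_elim
      case (elim r)
      have "\<forall>\<^sub>F n in sequentially. indicator {s<..X n} r * G r = indicator {s<..t} r * G r"
      proof (cases "r < t")
        case True
        from order_tendstoD(1)[OF X this] show ?thesis
          by eventually_elim (use True in \<open>auto simp: indicator_def\<close>)
      next
        case False
        with elim have "t < r" by simp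
        from order_tendstoD(2)[OF X this] show ?thesis
          by eventually_elim (use \<open>t < r\<close> in \<open>auto simp: indicator_def\<close>)
      qed
      then show ?case by (rule tendsto_eventually)
    qed
  qed (use G in \<open>auto simp: indicator_def intro!: AE_I2\<close>)
  then show "((\<lambda>t. LINT r|lborel. indicator {s<..t} r * G r) \<circ> X) \<longlonglongrightarrow> (LINT r|lborel. indicator {s<..t} r * G r)"
    by (simp add: o_def)
qed

text \<open>The chain rule for an absolutely continuous \<open>W\<close>, as the inequality that convexity provides. On each
  cell of a uniform grid the tangent inequality at the later time bounds the increment of \<open>soft_pos\<close> by
  its slope times the increment of \<open>W\<close>; the sum over the cells converges by dominated convergence as the
  grid is refined.\<close>

lemma soft_pos_chain_rule:
  fixes G W :: "real \<Rightarrow> real"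
  assumes G: "integrable lborel G" and "s \<le> T"
    and W: "\<And>t. W t = W0 + (LINT r|lborel. indicator {s<..t} r * G r)"
  shows "soft_pos (W T - k) \<le> soft_pos (W0 - k) +
    (LINT r|lborel. indicator {s<..T} r * (soft_pos_slope (W r - k) * G r))"
proof (cases "s = T")
  case True
  then show ?thesis by (simp add: W)
next
  case False
  with \<open>s \<le> T\<close> have sT: "s < T" by simp
  have [measurable]: "G \<in> borel_measurable borel" using G by auto
  have Wc: "continuous_on UNIV W"
    unfolding W by (intro continuous_intros continuous_primitive G)
  have Wm[measurable]: "W \<in> borel_measurable borel" by (rule borel_measurable_continuous_onI[OF Wc])
  have Sc: "continuous_on UNIV soft_pos_slope" unfolding soft_pos_slope_def by (intro continuous_intros)
  have Sm[measurable]: "soft_pos_slope \<in> borel_measurable borel" by (rule borel_measurable_continuous_onI[OF Sc])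
  define h where "h n = (T - s) / (real n + 1)" for n :: nat
  have h: "h n > 0" for n using sT by (simp add: h_def)
  \<comment> \<open>The right end point of the cell that contains \<open>r\<close>: the tangent inequality uses the slope at the later time.\<close>
  define c where "c n r = s + of_int \<lceil>(r - s) / h n\<rceil> * h n" for n r
  have cm[measurable]: "c n \<in> borel_measurable borel" for n unfolding c_def by measurable
  have c_cell: "c n r = s + (real j + 1) * h n" if "s + real j * h n < r" "r \<le> s + (real j + 1) * h n" for n r j
  proof -
    have "real j < (r - s) / h n" "(r - s) / h n \<le> real j + 1" using that h[of n] by (auto simp: field_simps)
    then have "\<lceil>(r - s) / h n\<rceil> = int j + 1" by (intro ceiling_unique) auto
    then show ?thesis by (simp add: c_def)
  qed
  have c_dist: "r \<le> c n r" "c n r \<le> r + h n" for n r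
  proof -
    have e: "(r - s) / h n * h n = r - s" using h[of n] by simp
    have "(r - s) / h n \<le> of_int \<lceil>(r - s) / h n\<rceil>" "of_int \<lceil>(r - s) / h n\<rceil> \<le> (r - s) / h n + 1" by linarith+
    then have "(r - s) / h n * h n \<le> of_int \<lceil>(r - s) / h n\<rceil> * h n"
      "of_int \<lceil>(r - s) / h n\<rceil> * h n \<le> ((r - s) / h n + 1) * h n"
      using h[of n] by (intro mult_right_mono; simp)+
    then have "r - s \<le> of_int \<lceil>(r - s) / h n\<rceil> * h n" "of_int \<lceil>(r - s) / h n\<rceil> * h n \<le> r - s + h n"
      unfolding e distrib_right by simp_all
    then show "r \<le> c n r" "c n r \<le> r + h n" by (simp_all add: c_def)
  qed
  have bnd: "integrable lborel (\<lambda>r. indicator A r * (soft_pos_slope (W (f r) - k) * G r))"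
    if [measurable]: "A \<in> sets borel" "f \<in> borel_measurable borel" for A f
  proof (rule Bochner_Integration.integrable_bound[OF G])
    show "AE x in lborel. norm (indicator A x * (soft_pos_slope (W (f x) - k) * G x)) \<le> norm (G x)"
      using soft_pos_slope_bounds by (intro AE_I2) (auto simp: indicator_def abs_mult intro!: mult_left_le_one_le)
  qed measurable
  have indG: "integrable lborel (\<lambda>r. indicator A r * G r)" if [measurable]: "A \<in> sets borel" for A
    by (rule Bochner_Integration.integrable_bound[OF G]) (auto simp: indicator_def)
  have step: "soft_pos (W (s + real j * h n) - k) \<le> soft_pos (W0 - k) +
      (LINT r|lborel. indicator {s<..s + real j * h n} r * (soft_pos_slope (W (c n r) - k) * G r))" for n j
  proof (induction j)
    case 0
    then show ?case by (simp add: W)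
  next
    case (Suc j)
    let ?t = "s + real j * h n" and ?t' = "s + (real j + 1) * h n"
    have t: "s \<le> ?t" "?t < ?t'" using h[of n] by (auto simp: field_simps)
    have split: "indicator {s<..?t'} r * F = indicator {s<..?t} r * F + indicator {?t<..?t'} r * F" for r F :: real
      using t by (auto simp: indicator_def)
    have "W ?t' - W ?t = (LINT r|lborel. indicator {?t<..?t'} r * G r)"
      unfolding W split using indG by (subst Bochner_Integration.integral_add) auto
    then have "soft_pos_slope (W ?t' - k) * (W ?t' - W ?t) =
        (LINT r|lborel. soft_pos_slope (W ?t' - k) * (indicator {?t<..?t'} r * G r))"
      by simp
    also have "\<dots> = (LINT r|lborel. indicator {?t<..?t'} r * (soft_pos_slope (W (c n r) - k) * G r))"
      by (intro Bochner_Integration.integral_cong) (auto simp: indicator_def c_cell)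
    finally have *: "soft_pos_slope (W ?t' - k) * (W ?t' - W ?t) = \<dots>" .
    have "soft_pos (W ?t' - k) \<le> soft_pos (W ?t - k) + soft_pos_slope (W ?t' - k) * (W ?t' - W ?t)"
      using soft_pos_tangent[of "W ?t' - k" "W ?t - k"] by simp
    also have "\<dots> \<le> soft_pos (W0 - k) +
       (LINT r|lborel. indicator {s<..?t} r * (soft_pos_slope (W (c n r) - k) * G r)) +
       (LINT r|lborel. indicator {?t<..?t'} r * (soft_pos_slope (W (c n r) - k) * G r))"
      using Suc * by simp
    also have "\<dots> = soft_pos (W0 - k) + (LINT r|lborel. indicator {s<..?t'} r * (soft_pos_slope (W (c n r) - k) * G r))"
      unfolding split by (subst Bochner_Integration.integral_add) (auto intro!: bnd)
    finally show ?case by (simp add: add.commute)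
  qed
  have "(\<lambda>n. LINT r|lborel. indicator {s<..T} r * (soft_pos_slope (W (c n r) - k) * G r)) \<longlonglongrightarrow>
     (LINT r|lborel. indicator {s<..T} r * (soft_pos_slope (W r - k) * G r))"
  proof (rule integral_dominated_convergence[where w = "\<lambda>r. \<bar>G r\<bar>"])
    have h0: "h \<longlonglongrightarrow> 0"
      using LIMSEQ_ignore_initial_segment[OF lim_const_over_n[of "T - s"], of 1]
      by (simp add: h_def[abs_def] add.commute)
    have "(\<lambda>n. c n r) \<longlonglongrightarrow> r" for r
    proof (rule tendsto_sandwich[of "\<lambda>n. r" _ _ "\<lambda>n. r + h n"])
      show "(\<lambda>n. r + h n) \<longlonglongrightarrow> r" using tendsto_add[OF tendsto_const h0, of r] by simp
    qed (use c_dist in auto)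
    then have "(\<lambda>n. soft_pos_slope (W (c n r) - k)) \<longlonglongrightarrow> soft_pos_slope (W r - k)" for r
      by (intro continuous_on_tendsto_compose[OF Sc] tendsto_diff tendsto_const continuous_on_tendsto_compose[OF Wc]) auto
    then show "AE r in lborel. (\<lambda>n. indicator {s<..T} r * (soft_pos_slope (W (c n r) - k) * G r)) \<longlonglongrightarrow>
        indicator {s<..T} r * (soft_pos_slope (W r - k) * G r)"
      by (intro AE_I2 tendsto_intros)
    show "AE x in lborel. norm (indicator {s<..T} x * (soft_pos_slope (W (c n x) - k) * G x)) \<le> \<bar>G x\<bar>" for n
      using soft_pos_slope_bounds by (intro AE_I2) (auto simp: indicator_def abs_mult intro!: mult_left_le_one_le)
  qed (use G in auto)
  then have "(\<lambda>n. soft_pos (W0 - k) + (LINT r|lborel. indicator {s<..T} r * (soft_pos_slope (W (c n r) - k) * G r))) \<longlonglongrightarrow>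
     soft_pos (W0 - k) + (LINT r|lborel. indicator {s<..T} r * (soft_pos_slope (W r - k) * G r))"
    by (intro tendsto_intros)
  moreover have "soft_pos (W T - k) \<le> soft_pos (W0 - k) +
     (LINT r|lborel. indicator {s<..T} r * (soft_pos_slope (W (c n r) - k) * G r))" for n
  proof -
    have "s + real (Suc n) * h n = T" by (simp add: h_def field_simps)
    then show ?thesis using step[of "Suc n" n] by simp
  qed
  ultimately show ?thesis by (intro LIMSEQ_le_const) auto
qed


section \<open>Propagation of bounds on alternating sums\<close>

text \<open>The uniform distribution on \<open>(a,b)\<close>; with a probability measure the coordinates of a product space have
  the factor as their distribution.\<close>

definition interval_prob :: "real \<Rightarrow> real \<Rightarrow> real measure" where
  "interval_prob a b = density lborel (\<lambda>x. ennreal (indicator {a<..<b} x / (b - a)))"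

lemma sets_interval_prob [simp, measurable_cong]: "sets (interval_prob a b) = sets borel"
  by (simp add: interval_prob_def)

lemma integral_interval_prob:
  fixes f :: "real \<Rightarrow> real"
  shows "a < b \<Longrightarrow> f \<in> borel_measurable borel \<Longrightarrow>
    (LINT x|interval_prob a b. f x) = (LINT x|lborel. indicator {a<..<b} x / (b - a) * f x)"
  unfolding interval_prob_def by (subst integral_density) auto

lemma integrable_interval_prob:
  fixes f :: "real \<Rightarrow> real"
  assumes "a < b" "integrable lborel f"
  shows "integrable (interval_prob a b) f"
proof -
  have [measurable]: "f \<in> borel_measurable borel" using assms(2) by auto
  have "integrable lborel (\<lambda>x. f x * (indicator {a<..<b} x / (b - a)))"
    by (rule integrable_bounded_multiplier[OF assms(2), where C = "1 / (b - a)"])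
      (use assms(1) in \<open>auto simp: indicator_def\<close>)
  then show ?thesis
    unfolding interval_prob_def by (subst integrable_density) (use assms(1) in \<open>auto simp: mult.commute\<close>)
qed

lemma prob_space_interval_prob:
  assumes "a < b" shows "prob_space (interval_prob a b)"
proof
  have "emeasure (interval_prob a b) (space (interval_prob a b)) =
      (\<integral>\<^sup>+x. ennreal (1 / (b - a)) * indicator {a<..<b} x \<partial>lborel)"
    unfolding interval_prob_def
    by (subst emeasure_density) (auto intro!: nn_integral_cong simp: indicator_def)
  also have "\<dots> = ennreal (1 / (b - a)) * ennreal (b - a)"
    using assms by (subst nn_integral_cmult_indicator) auto
  also have "\<dots> = 1" using assms by (simp flip: ennreal_mult)
  finally show "emeasure (interval_prob a b) (space (interval_prob a b)) = 1" .
qed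

lemma AE_interval_prob: "(AE y in lborel. Q y) \<Longrightarrow> AE y in interval_prob a b. Q y"
  unfolding interval_prob_def by (subst AE_density) auto

lemma null_interval_probD:
  assumes "a < b" "A \<in> sets borel" "A \<subseteq> {a<..<b}" "emeasure (interval_prob a b) A = 0"
  shows "emeasure lborel A = 0"
proof -
  have "emeasure (interval_prob a b) A = (\<integral>\<^sup>+x. ennreal (1 / (b - a)) * indicator A x \<partial>lborel)"
    unfolding interval_prob_def using assms(2,3)
    by (subst emeasure_density) (auto intro!: nn_integral_cong simp: indicator_def)
  also have "\<dots> = ennreal (1 / (b - a)) * emeasure lborel A"
    using assms(2) by (subst nn_integral_cmult_indicator) auto
  finally show ?thesis using assms(1,4) by simp
qed

lemma ordered_chain_measurable [measurable]:
  assumes "sets M = sets (borel :: real measure)"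
  shows "Measurable.pred (PiM {1..n} (\<lambda>_. M)) (ordered_chain a b n)"
proof -
  have c: "(\<lambda>x. x i) \<in> borel_measurable (PiM {1..n} (\<lambda>_. M))" if "i \<in> {1..n}" for i
    using measurable_component_singleton[OF that, of "\<lambda>_. M"] measurable_cong_sets[OF refl assms] by blast
  have 1: "Measurable.pred (PiM {1..n} (\<lambda>_. M)) (\<lambda>x. a < x i \<and> x i < b)" if "i \<in> {1..n}" for i
  proof -
    note c[OF that, measurable]
    show ?thesis by measurable
  qed
  have 2: "Measurable.pred (PiM {1..n} (\<lambda>_. M)) (\<lambda>x. x i < x (Suc i))" if "i \<in> {1..<n}" for i
  proof -
    have "i \<in> {1..n}" "Suc i \<in> {1..n}" using that by auto
    note c[OF this(1), measurable] c[OF this(2), measurable]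
    show ?thesis by measurable
  qed
  show ?thesis
    unfolding ordered_chain_def
    by (rule pred_intros_logic(3)[OF pred_intros_finite(3)[OF _ 1] pred_intros_finite(3)[OF _ 2]]) simp_all
qed

lemma of_bool_ordered_chain_measurable [measurable]:
  assumes "sets M = sets (borel :: real measure)"
  shows "(\<lambda>x. of_bool (ordered_chain a b n x) :: real) \<in> borel_measurable (PiM {1..n} (\<lambda>_. M))"
proof -
  note ordered_chain_measurable[OF assms, measurable]
  show ?thesis unfolding of_bool_def by measurable
qed

lemma alternating_sum_measurable_PiM [measurable]:
  assumes "sets M = sets (borel :: real measure)" "w \<in> borel_measurable borel"
  shows "alternating_sum n w \<in> borel_measurable (PiM {1..n} (\<lambda>_. M))"
proof -
  have c: "(\<lambda>x. x i) \<in> borel_measurable (PiM {1..n} (\<lambda>_. M))" if "i \<in> {1..n}" for i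
    using measurable_component_singleton[OF that, of "\<lambda>_. M"] measurable_cong_sets[OF refl assms(1)] by blast
  have "(\<lambda>x. \<Sum>i\<in>{1..n}. (-1) ^ i * w (x i)) \<in> borel_measurable (PiM {1..n} (\<lambda>_. M))"
    using measurable_compose[OF c assms(2)] by (intro borel_measurable_sum borel_measurable_times) auto
  then show ?thesis by (simp add: alternating_sum_def[abs_def])
qed

lemma integrable_PiM_component:
  fixes f :: "real \<Rightarrow> real"
  assumes "prob_space M" "i \<in> I" "integrable M f"
  shows "integrable (PiM I (\<lambda>_. M)) (\<lambda>x. f (x i))"
proof -
  have "distr (PiM I (\<lambda>_. M)) M (\<lambda>x. x i) = M"
    by (rule distr_PiM_component[OF assms(1,2)])
  then have "integrable (distr (PiM I (\<lambda>_. M)) M (\<lambda>x. x i)) f" using assms(3) by simp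
  then show ?thesis by (rule integrable_distr[rotated]) (rule measurable_component_singleton[OF assms(2)])
qed

lemma soft_pos_slope_measurable [measurable]: "soft_pos_slope \<in> borel_measurable borel"
  by (intro borel_measurable_continuous_onI) (auto simp: soft_pos_slope_def intro!: continuous_intros)

text \<open>Integrate first over the coordinate \<open>x\<^sub>i\<close>, which ranges between its neighbours \<open>p\<close> and \<open>q\<close>. As a
  function of \<open>(-1)\<^sup>i w(x\<^sub>i)\<close> the weight is nondecreasing, so \<open>flux_nonpos\<close> applies once the weight is known
  to vanish when \<open>x\<^sub>i\<close> reaches a neighbour. There two terms of the alternating sum cancel, and the bound
  \<open>sub\<close> for \<open>n - 2\<close> points applies.\<close>

lemma single_coordinate_flux_nonpos:
  assumes fs: "flux_slice a b w g V N" and gi: "integrable lborel g"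
    and i: "i \<in> {1..n}" and sub: "2 \<le> n \<Longrightarrow> oscillation_le a b (n - 2) w k"
  shows "(LINT x|PiM {1..n} (\<lambda>_. interval_prob a b).
      of_bool (ordered_chain a b n x) * (soft_pos_slope (alternating_sum n w x - k) * ((-1) ^ i * g (x i)))) \<le> 0"
proof -
  let ?M = "interval_prob a b" and ?S = "soft_pos_slope"
  define I where "I = {1..n} - {i}"
  have I: "finite I" "i \<notin> I" "insert i I = {1..n}" using i by (auto simp: I_def)
  interpret fs: flux_slice a b w g V N by fact
  have ab: "a < b" by (rule fs.ab)
  have [measurable]: "w \<in> borel_measurable borel" "g \<in> borel_measurable borel"
    using fs.wm gi by auto
  have prob: "prob_space ?M" by (rule prob_space_interval_prob[OF ab])
  interpret M: prob_space ?M by fact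
  interpret product_sigma_finite "\<lambda>_::nat. ?M" by (simp add: product_sigma_finite_def M.sigma_finite_measure_axioms)
  define F where "F x = of_bool (ordered_chain a b n x) * (?S (alternating_sum n w x - k) * ((-1) ^ i * g (x i)))"
    for x :: "nat \<Rightarrow> real"
  have Fi: "integrable (PiM {1..n} (\<lambda>_. ?M)) F"
  proof -
    have "integrable (PiM {1..n} (\<lambda>_. ?M)) (\<lambda>x. g (x i))"
      by (rule integrable_PiM_component[OF prob i integrable_interval_prob[OF ab gi]])
    then have "integrable (PiM {1..n} (\<lambda>_. ?M)) (\<lambda>x. g (x i) * (of_bool (ordered_chain a b n x) * (?S (alternating_sum n w x - k) * (-1) ^ i)))"
    proof (rule integrable_bounded_multiplier[where C = 1])
      show "(\<lambda>x. of_bool (ordered_chain a b n x) * (?S (alternating_sum n w x - k) * (-1) ^ i))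
          \<in> borel_measurable (PiM {1..n} (\<lambda>_. ?M))"
      proof -
        note of_bool_ordered_chain_measurable[OF sets_interval_prob, measurable]
          alternating_sum_measurable_PiM[OF sets_interval_prob fs.wm, measurable]
        show ?thesis by measurable
      qed
      show "\<bar>of_bool (ordered_chain a b n x) * (?S (alternating_sum n w x - k) * (-1) ^ i)\<bar> \<le> 1" for x
        using soft_pos_slope_bounds by (simp add: abs_mult)
    qed
    then show ?thesis unfolding F_def by (simp add: mult_ac)
  qed
  obtain N2 where N2: "negligible N2" "\<And>x. 2 \<le> n \<Longrightarrow> ordered_chain a b (n - 2) x \<Longrightarrow> (\<forall>j\<in>{1..n - 2}. x j \<notin> N2) \<Longrightarrow>
      alternating_sum (n - 2) w x \<le> k"
    using sub unfolding oscillation_le_def by (cases "2 \<le> n") auto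
  have inner: "(LINT y|?M. F (x(i := y))) \<le> 0" if x: "\<forall>j\<in>I. x j \<notin> N \<union> N2" for x
  proof -
    define p where "p = (if i = 1 then a else x (i - 1))"
    define q where "q = (if i = n then b else x (Suc i))"
    define C where "C \<longleftrightarrow> (\<forall>j\<in>I. a < x j \<and> x j < b) \<and> (\<forall>j\<in>{1..<n}. j \<noteq> i \<longrightarrow> Suc j \<noteq> i \<longrightarrow> x j < x (Suc j))"
    define rest where "rest = (\<Sum>j\<in>I. (-1) ^ j * w (x j))"
    let ?\<sigma> = "(-1) ^ i :: real"
    have as: "alternating_sum n w (x(i := y)) = ?\<sigma> * w y + rest" for y
    proof -
      have "alternating_sum n w (x(i := y)) = (\<Sum>j\<in>insert i I. (-1) ^ j * w ((x(i := y)) j))"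
        unfolding alternating_sum_def I(3) ..
      also have "\<dots> = ?\<sigma> * w y + (\<Sum>j\<in>I. (-1) ^ j * w ((x(i := y)) j))"
        using I(1,2) by simp
      also have "(\<Sum>j\<in>I. (-1) ^ j * w ((x(i := y)) j)) = rest"
        unfolding rest_def using I(2) by (intro sum.cong) auto
      finally show ?thesis .
    qed
    have bounds: "a < x j \<and> x j < b" if C "j \<in> {1..n}" "j \<noteq> i" for j
      using that unfolding C_def I_def by auto
    have pq: "a \<le> p" "q \<le> b" if C
    proof -
      have "i - 1 \<in> {1..n} \<and> i - 1 \<noteq> i" if "i \<noteq> 1" using that i by auto
      then show "a \<le> p" using bounds[OF that, of "i - 1"] by (cases "i = 1") (auto simp: p_def)
      have "Suc i \<in> {1..n} \<and> Suc i \<noteq> i" if "i \<noteq> n" using that i by auto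
      then show "q \<le> b" using bounds[OF that, of "Suc i"] by (cases "i = n") (auto simp: q_def)
    qed
    have chain: "ordered_chain a b n (x(i := y)) \<longleftrightarrow> C \<and> p < y \<and> y < q" for y
    proof
      assume oc: "ordered_chain a b n (x(i := y))"
      have 1: "a < (x(i := y)) j" "(x(i := y)) j < b" if "j \<in> {1..n}" for j
        using oc that unfolding ordered_chain_def by blast+
      have 2: "(x(i := y)) j < (x(i := y)) (Suc j)" if "j \<in> {1..<n}" for j
        using oc that unfolding ordered_chain_def by blast
      have C
        unfolding C_def
      proof (intro conjI ballI impI)
        fix j assume "j \<in> I" then show "a < x j" "x j < b" using 1[of j] by (auto simp: I_def)
      next
        fix j assume "j \<in> {1..<n}" "j \<noteq> i" "Suc j \<noteq> i"
        then show "x j < x (Suc j)" using 2[of j] by auto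
      qed
      moreover have "p < y"
      proof (cases "i = 1")
        case True
        then show ?thesis using 1[of i] i by (simp add: p_def)
      next
        case False
        then have "i - 1 \<in> {1..<n}" "Suc (i - 1) = i" "i - 1 \<noteq> i" using i by auto
        then show ?thesis using 2[of "i - 1"] False by (simp add: p_def)
      qed
      moreover have "y < q"
      proof (cases "i = n")
        case True
        then show ?thesis using 1[of i] i by (simp add: q_def)
      next
        case False
        then have "i \<in> {1..<n}" using i by auto
        then show ?thesis using 2[of i] False by (simp add: q_def)
      qed
      ultimately show "C \<and> p < y \<and> y < q" by blast
    next
      assume R: "C \<and> p < y \<and> y < q"
      show "ordered_chain a b n (x(i := y))"
        unfolding ordered_chain_def
      proof (intro conjI ballI)
        fix j assume "j \<in> {1..n}"
        then have "a < (x(i := y)) j \<and> (x(i := y)) j < b"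
          using R pq unfolding C_def I_def by auto
        then show "a < (x(i := y)) j" "(x(i := y)) j < b" by auto
      next
        fix j assume j: "j \<in> {1..<n}"
        consider "j = i" | "Suc j = i" | "j \<noteq> i" "Suc j \<noteq> i" by blast
        then show "(x(i := y)) j < (x(i := y)) (Suc j)"
          using R j unfolding C_def p_def q_def by cases auto
      qed
    qed
    show ?thesis
    proof (cases "C \<and> p < q")
      case False
      then have "F (x(i := y)) = 0" for y unfolding F_def chain by auto
      then show ?thesis by simp
    next
      case True
      then have C: C and "p < q" by auto
      have Cin: "a < x j" "x j < b" if "j \<in> {1..n}" "j \<noteq> i" for j
        using C that unfolding C_def I_def by auto
      have Cord: "x j < x (Suc j)" if "1 \<le> j" "j < n" "j \<noteq> i" "Suc j \<noteq> i" for j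
        using C that unfolding C_def by auto
      have fs\<sigma>: "flux_slice a b (\<lambda>y. ?\<sigma> * w y) (\<lambda>y. ?\<sigma> * g y) (\<lambda>y. ?\<sigma> * V y) N"
        using fs fs.flux_slice_uminus by (cases "even i") auto
      have f: "mono (\<lambda>z. ?S (z + rest - k))" "\<And>z. 0 \<le> ?S (z + rest - k)" "\<And>z. ?S (z + rest - k) \<le> 1"
        using soft_pos_slope_bounds by (auto intro!: monoI monoD[OF soft_pos_slope_mono])
      have drop: "?S (?\<sigma> * w (x j) + rest - k) = 0"
        if j: "j = i - 1 \<and> 1 < i \<or> j = Suc i \<and> i < n" for j
      proof -
        \<comment> \<open>Put \<open>x\<^sub>i\<close> on its neighbour \<open>x\<^sub>j\<close>; then \<open>m\<close> and \<open>Suc m\<close> are the indices of the merged pair and \<open>z\'\<close> lists the other points.\<close>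
        define m where "m = min i j"
        have m: "1 \<le> m" "Suc m \<le> n" using j i by (auto simp: m_def)
        define z where "z = x(i := x j)"
        define z' where "z' l = (if l < m then z l else z (l + 2))" for l
        have "z m = z (Suc m)" using j by (auto simp: z_def m_def min_def)
        then have eq: "alternating_sum n w z = alternating_sum (n - 2) w z'"
          using alternating_sum_remove_pair[OF m, of z w] unfolding z'_def by simp
        have idx: "l < m \<Longrightarrow> l < i" "m \<le> l \<Longrightarrow> i < l + 2" for l using j by (auto simp: m_def)
        have z'x: "z' l = x (if l < m then l else l + 2)" for l
          using idx[of l] by (auto simp: z'_def z_def)
        have "ordered_chain a b (n - 2) z'"
          unfolding ordered_chain_def
        proof (intro conjI ballI)
          fix l assume "l \<in> {1..n - 2}"
          then show "a < z' l" "z' l < b"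
            unfolding z'x using idx[of l] m by (auto intro!: Cin)
        next
          fix l assume l: "l \<in> {1..<n - 2}"
          consider "Suc l < m" | "Suc l = m" | "m \<le> l" by linarith
          then show "z' l < z' (Suc l)"
          proof cases
            case 1
            then show ?thesis unfolding z'x using l idx[of "Suc l"] by (auto intro!: Cord)
          next
            case 3
            then show ?thesis unfolding z'x using l idx[of l] by (auto intro!: Cord)
          next
            case 2
            \<comment> \<open>The pair is removed between \<open>x\<^sub>l\<close> and \<open>x\<^sub>l\<^sub>+\<^sub>3\<close>, which are ordered because \<open>p < q\<close>.\<close>
            have "x l < x (l + 3)"
              using j
            proof
              assume "j = i - 1 \<and> 1 < i"
              then have "i = Suc (Suc l)" using 2 by (auto simp: m_def)
              moreover have "x l < x (Suc l)" using l \<open>i = Suc (Suc l)\<close> by (intro Cord) auto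
              ultimately show ?thesis
                using \<open>p < q\<close> l by (auto simp: p_def q_def numeral_3_eq_3 split: if_splits)
            next
              assume "j = Suc i \<and> i < n"
              then have "i = Suc l" using 2 by (auto simp: m_def)
              moreover have "x (Suc (Suc l)) < x (Suc (Suc (Suc l)))" using l \<open>i = Suc l\<close> by (intro Cord) auto
              ultimately show ?thesis
                using \<open>p < q\<close> l by (auto simp: p_def q_def numeral_3_eq_3 split: if_splits)
            qed
            then show ?thesis unfolding z'x using 2 by (simp add: numeral_3_eq_3 numeral_2_eq_2)
          qed
        qed
        moreover have "\<forall>l\<in>{1..n - 2}. z' l \<notin> N2"
        proof
          fix l assume "l \<in> {1..n - 2}"
          then have "(if l < m then l else l + 2) \<in> I"
            using idx[of l] m by (auto simp: I_def)
          then show "z' l \<notin> N2" unfolding z'x using x by blast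
        qed
        ultimately have "alternating_sum (n - 2) w z' \<le> k" using N2(2) m by simp
        then show ?thesis
          using eq as[of "x j"] unfolding z_def by (intro soft_pos_slope_eq_0) simp
      qed
      have left: "p = a \<or> p \<notin> N \<and> ?S (?\<sigma> * w p + rest - k) = 0"
      proof (cases "i = 1")
        case False
        then have "i - 1 \<in> I" "1 < i" using i by (auto simp: I_def)
        then show ?thesis using drop[of "i - 1"] x False by (auto simp: p_def)
      qed (simp add: p_def)
      have right: "q = b \<or> q \<notin> N \<and> ?S (?\<sigma> * w q + rest - k) = 0"
      proof (cases "i = n")
        case False
        then have "Suc i \<in> I" "i < n" using i by (auto simp: I_def)
        then show ?thesis using drop[of "Suc i"] x False by (auto simp: q_def)
      qed (simp add: q_def)
      let ?G = "\<lambda>y. ?S (?\<sigma> * w y + rest - k) * (?\<sigma> * g y)"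
      have le: "integral {p..q} ?G \<le> 0"
        by (rule flux_slice.flux_nonpos(2)[OF fs\<sigma> f pq(1)[OF C] \<open>p < q\<close> pq(2)[OF C] left right])
      have Gm[measurable]: "?G \<in> borel_measurable borel" by measurable
      have Gi: "set_integrable lborel {p<..<q} ?G"
      proof -
        have "integrable lborel (\<lambda>y. g y * (indicator {p<..<q} y * (?S (?\<sigma> * w y + rest - k) * ?\<sigma>)))"
          by (rule integrable_bounded_multiplier[OF gi, where C = 1])
            (use soft_pos_slope_bounds in \<open>auto simp: abs_mult indicator_def\<close>)
        then show ?thesis unfolding set_integrable_def by (simp add: mult_ac)
      qed
      have "(LINT y|?M. F (x(i := y))) = (LINT y|?M. indicator {p<..<q} y * ?G y)"
        unfolding F_def chain as using C by (intro Bochner_Integration.integral_cong) (auto simp: indicator_def)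
      also have "\<dots> = (LINT y|lborel. indicator {a<..<b} y / (b - a) * (indicator {p<..<q} y * ?G y))"
        by (rule integral_interval_prob[OF ab]) measurable
      also have "\<dots> = (LINT y|lborel. 1 / (b - a) * (indicator {p<..<q} y *\<^sub>R ?G y))"
        using pq[OF C] by (intro Bochner_Integration.integral_cong) (auto simp: indicator_def)
      also have "\<dots> = 1 / (b - a) * (LINT y:{p<..<q}|lborel. ?G y)"
        unfolding set_lebesgue_integral_def by simp
      also have "(LINT y:{p<..<q}|lborel. ?G y) = integral {p..q} ?G"
        using set_borel_integral_eq_integral(2)[OF Gi] by (simp add: integral_open_interval_real)
      also have "1 / (b - a) * integral {p..q} ?G \<le> 0"
        using le ab by (simp add: divide_nonpos_pos)
      finally show ?thesis .
    qed
  qed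
  have "integral\<^sup>L (PiM {1..n} (\<lambda>_. ?M)) F = (LINT x|PiM I (\<lambda>_. ?M). LINT y|?M. F (x(i := y)))"
    using product_integral_insert[OF I(1,2), of F] Fi unfolding I(3) by blast
  also have "\<dots> \<le> 0"
  proof -
    have "AE y in lebesgue. y \<notin> N \<union> N2"
      using fs.N N2(1) by (intro AE_not_in) (auto simp: negligible_iff_null_sets)
    then have "AE y in ?M. y \<notin> N \<union> N2" by (intro AE_interval_prob) (simp add: AE_completion_iff)
    from AE_PiM_coordinates[OF M.sigma_finite_measure_axioms I(1) this]
    have "AE x in PiM I (\<lambda>_. ?M). 0 \<le> - (LINT y|?M. F (x(i := y)))"
      by eventually_elim (use inner in auto)
    from integral_nonneg_AE[OF this] show ?thesis by simp
  qed
  finally show ?thesis unfolding F_def .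
qed


lemma integrable_PiM_time_component:
  fixes g :: "real \<Rightarrow> real \<Rightarrow> real"
  assumes ab: "a < b" and gi: "integrable (lborel \<Otimes>\<^sub>M lborel) (\<lambda>(r, x). g r x)"
    and I: "finite I" "i \<in> I"
  shows "integrable (PiM I (\<lambda>_. interval_prob a b) \<Otimes>\<^sub>M lborel) (\<lambda>(x, r). g r (x i))"
proof -
  let ?M = "interval_prob a b" let ?P = "PiM I (\<lambda>_. interval_prob a b)"
  have prob: "prob_space ?M" by (rule prob_space_interval_prob[OF ab])
  interpret M: prob_space ?M by fact
  interpret P: prob_space ?P by (rule prob_space_PiM) (rule prob)
  interpret pair_sigma_finite ?P lborel
    unfolding pair_sigma_finite_def
    using P.sigma_finite_measure_axioms lborel.sigma_finite_measure_axioms by blast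
  have gm: "(\<lambda>(r, x). g r x) \<in> borel_measurable (lborel \<Otimes>\<^sub>M lborel)" using gi by auto
  have [measurable]: "(\<lambda>x. x i) \<in> ?P \<rightarrow>\<^sub>M lborel"
    using measurable_component_singleton[OF I(2), of "\<lambda>_. ?M"]
    by (simp add: measurable_cong_sets[OF refl, of ?M lborel])
  have "(\<lambda>(x, r). (r, x i)) \<in> ?P \<Otimes>\<^sub>M lborel \<rightarrow>\<^sub>M lborel \<Otimes>\<^sub>M lborel" by measurable
  from measurable_compose[OF this gm]
  have m: "(\<lambda>(x, r). g r (x i)) \<in> borel_measurable (?P \<Otimes>\<^sub>M lborel)" by (simp add: case_prod_beta')
  have "integrable (lborel \<Otimes>\<^sub>M lborel) (\<lambda>(r, x). \<bar>g r x\<bar>)"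
    using integrable_abs[OF gi] by (simp add: case_prod_beta')
  from integrable_interval_prob[OF ab lborel_pair.integrable_snd[OF this]]
  have n: "integrable ?P (\<lambda>x. LINT r|lborel. \<bar>g r (x i)\<bar>)"
    by (rule integrable_PiM_component[OF prob I(2)])
  have "AE y in ?M. integrable lborel (\<lambda>r. g r y)"
    by (rule AE_interval_prob[OF lborel_pair.AE_integrable_snd[OF gi]])
  from AE_PiM_coordinates[OF M.sigma_finite_measure_axioms I(1) this]
  have "AE x in ?P. integrable lborel (\<lambda>r. g r (x i))"
    by eventually_elim (use I(2) in blast)
  with m n show ?thesis by (intro Fubini_integrable) auto
qed

text \<open>The function \<open>R\<close> bounds \<open>soft_pos (W - k)\<close> at time \<open>T\<close> from above, pointwise by the chain rule, and its
  integral is nonpositive by Fubini and \<open>single_coordinate_flux_nonpos\<close>. Hence \<open>soft_pos (W - k)\<close> vanishes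
  almost everywhere.\<close>

lemma oscillation_le_propagates_step:
  fixes w0 :: "real \<Rightarrow> real" and g w :: "real \<Rightarrow> real \<Rightarrow> real"
  assumes ab: "a < b" and sT: "s \<le> T" and w0: "w0 \<in> borel_measurable borel"
    and gi: "integrable (lborel \<Otimes>\<^sub>M lborel) (\<lambda>(r, x). g r x)"
    and w: "\<And>t x. w t x = w0 x + (LINT r|lborel. indicator {s<..t} r * g r x)"
    and slices: "AE t in lborel. s < t \<longrightarrow> t < T \<longrightarrow> (\<exists>V N. flux_slice a b (w t) (g t) V N)"
    and sub: "\<And>t. s \<le> t \<Longrightarrow> t \<le> T \<Longrightarrow> 2 \<le> n \<Longrightarrow> oscillation_le a b (n - 2) (w t) k"
    and init: "oscillation_le a b n w0 k"
  shows "oscillation_le a b n (w T) k"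
proof -
  let ?M = "interval_prob a b" let ?P = "PiM {1..n} (\<lambda>_. interval_prob a b)" let ?S = "soft_pos_slope"
  have prob: "prob_space ?M" by (rule prob_space_interval_prob[OF ab])
  interpret M: prob_space ?M by fact
  interpret P: prob_space ?P by (rule prob_space_PiM) (rule prob)
  interpret PL: pair_sigma_finite ?P lborel
    unfolding pair_sigma_finite_def
    using P.sigma_finite_measure_axioms lborel.sigma_finite_measure_axioms by blast
  have gm[measurable]: "(\<lambda>(r, x). g r x) \<in> borel_measurable (lborel \<Otimes>\<^sub>M lborel)" using gi by auto
  note w0[measurable]
  have wm[measurable]: "(\<lambda>(t, x). w t x) \<in> borel_measurable (lborel \<Otimes>\<^sub>M lborel)"
  proof -
    have "(\<lambda>(z, r). (if s < r \<and> r \<le> fst z then 1 else 0) * g r (snd z))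
        \<in> borel_measurable ((lborel \<Otimes>\<^sub>M lborel) \<Otimes>\<^sub>M lborel)" by measurable
    from lborel.borel_measurable_lebesgue_integral[OF this]
    have "(\<lambda>z. LINT r|lborel. (if s < r \<and> r \<le> fst z then 1 else 0) * g r (snd z))
        \<in> borel_measurable (lborel \<Otimes>\<^sub>M (lborel :: real measure))" .
    moreover have "(\<lambda>(t, x). w t x) =
        (\<lambda>z. w0 (snd z) + (LINT r|lborel. (if s < r \<and> r \<le> fst z then 1 else 0) * g r (snd z)))"
      unfolding w by (auto simp: fun_eq_iff indicator_def intro!: Bochner_Integration.integral_cong)
    ultimately show ?thesis by simp
  qed
  have wt: "w t \<in> borel_measurable borel" for t
    using measurable_Pair2[OF wm, of t] by simp
  have comp: "(\<lambda>x. x i) \<in> ?P \<rightarrow>\<^sub>M lborel" if "i \<in> {1..n}" for i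
    using measurable_component_singleton[OF that, of "\<lambda>_. ?M"]
    by (simp add: measurable_cong_sets[OF refl, of ?M lborel])
  note of_bool_ordered_chain_measurable[OF sets_interval_prob, measurable]
  define D where "D z = (\<Sum>i\<in>{1..n}. (-1) ^ i * g (snd z) (fst z i))" for z :: "(nat \<Rightarrow> real) \<times> real"
  define \<Psi> where "\<Psi> z = of_bool (ordered_chain a b n (fst z)) * (indicator {s<..T} (snd z) *
      ?S (alternating_sum n (w (snd z)) (fst z) - k))" for z :: "(nat \<Rightarrow> real) \<times> real"
  have Di: "integrable (?P \<Otimes>\<^sub>M lborel) D"
    unfolding D_def
  proof (intro Bochner_Integration.integrable_sum integrable_mult_right)
    fix i assume "i \<in> {1..n}"
    from integrable_PiM_time_component[OF ab gi finite_atLeastAtMost this]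
    show "integrable (?P \<Otimes>\<^sub>M lborel) (\<lambda>z. g (snd z) (fst z i))" by (simp add: case_prod_beta')
  qed
  have asm: "(\<lambda>z. alternating_sum n (w (snd z)) (fst z)) \<in> borel_measurable (?P \<Otimes>\<^sub>M lborel)"
    unfolding alternating_sum_def
  proof (intro borel_measurable_sum borel_measurable_times)
    fix i assume "i \<in> {1..n}"
    note comp[OF this, measurable]
    have "(\<lambda>z. (snd z, fst z i)) \<in> ?P \<Otimes>\<^sub>M lborel \<rightarrow>\<^sub>M lborel \<Otimes>\<^sub>M lborel" by measurable
    from measurable_compose[OF this wm]
    show "(\<lambda>z. w (snd z) (fst z i)) \<in> borel_measurable (?P \<Otimes>\<^sub>M lborel)" by simp
  qed auto
  have \<Psi>m: "\<Psi> \<in> borel_measurable (?P \<Otimes>\<^sub>M lborel)"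
    unfolding \<Psi>_def[abs_def] using asm by measurable
  have \<Psi>b: "\<bar>\<Psi> z\<bar> \<le> 1" for z
    using soft_pos_slope_bounds unfolding \<Psi>_def by (auto simp: abs_mult indicator_def)
  have Hi: "integrable (?P \<Otimes>\<^sub>M lborel) (\<lambda>z. D z * \<Psi> z)"
    by (rule integrable_bounded_multiplier[OF Di \<Psi>m \<Psi>b])
  define R where "R x = (LINT r|lborel. D (x, r) * \<Psi> (x, r))" for x
  have Ri: "integrable ?P R"
    unfolding R_def using PL.integrable_fst'[OF Hi] by simp
  have gsec: "AE r in lborel. integrable lborel (g r)"
    using lborel_pair.AE_integrable_fst'[OF gi] by simp
  \<comment> \<open>At a fixed time the integrand is a sum over the coordinates whose summands have nonpositive integrals.\<close>
  have slice_le: "AE r in lborel. (LINT x|?P. D (x, r) * \<Psi> (x, r)) \<le> 0"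
    using slices gsec AE_lborel_singleton[of T]
  proof eventually_elim
    case (elim r)
    show ?case
    proof (cases "s < r \<and> r < T")
      case False
      with elim(3) have "\<Psi> (x, r) = 0" for x by (auto simp: \<Psi>_def)
      then show ?thesis by simp
    next
      case True
      then obtain V N where fs: "flux_slice a b (w r) (g r) V N" using elim(1) by blast
      define F where "F i x = of_bool (ordered_chain a b n x) *
          (?S (alternating_sum n (w r) x - k) * ((-1) ^ i * g r (x i)))" for i x
      have "D (x, r) * \<Psi> (x, r) = (\<Sum>i\<in>{1..n}. F i x)" for x
        using True unfolding D_def \<Psi>_def F_def
        by (simp add: sum_distrib_left sum_distrib_right mult_ac)
      then have "(LINT x|?P. D (x, r) * \<Psi> (x, r)) = (LINT x|?P. (\<Sum>i\<in>{1..n}. F i x))" by simp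
      also have "\<dots> = (\<Sum>i\<in>{1..n}. LINT x|?P. F i x)"
      proof (rule Bochner_Integration.integral_sum)
        fix i assume i: "i \<in> {1..n}"
        have "integrable ?P (\<lambda>x. g r (x i))"
          by (rule integrable_PiM_component[OF prob i integrable_interval_prob[OF ab elim(2)]])
        then have "integrable ?P (\<lambda>x. g r (x i) * (of_bool (ordered_chain a b n x) * (?S (alternating_sum n (w r) x - k) * (-1) ^ i)))"
        proof (rule integrable_bounded_multiplier[where C = 1])
          note alternating_sum_measurable_PiM[OF sets_interval_prob wt, measurable]
          show "(\<lambda>x. of_bool (ordered_chain a b n x) * (?S (alternating_sum n (w r) x - k) * (-1) ^ i)) \<in> borel_measurable ?P"
            by measurable
          show "\<bar>of_bool (ordered_chain a b n x) * (?S (alternating_sum n (w r) x - k) * (-1) ^ i)\<bar> \<le> 1" for x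
            using soft_pos_slope_bounds by (simp add: abs_mult)
        qed
        then show "integrable ?P (F i)" unfolding F_def[abs_def] by (simp add: mult_ac)
      qed
      also have "\<dots> \<le> 0"
        unfolding F_def using True
        by (intro sum_nonpos single_coordinate_flux_nonpos[OF fs elim(2)] sub) auto
      finally show ?thesis .
    qed
  qed
  have R_le: "(LINT x|?P. R x) \<le> 0"
  proof -
    have "(LINT x|?P. R x) = (LINT r|lborel. LINT x|?P. D (x, r) * \<Psi> (x, r))"
      unfolding R_def using PL.Fubini_integral[of "\<lambda>x r. D (x, r) * \<Psi> (x, r)"] Hi by (simp add: case_prod_beta')
    also have "\<dots> \<le> 0"
    proof -
      have "AE r in lborel. 0 \<le> - (LINT x|?P. D (x, r) * \<Psi> (x, r))" using slice_le by eventually_elim simp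
      from integral_nonneg_AE[OF this] show ?thesis by simp
    qed
    finally show ?thesis .
  qed
  have "AE y in lborel. integrable lborel (\<lambda>r. g r y)"
    by (rule lborel_pair.AE_integrable_snd[OF gi])
  then have "AE x in ?P. \<forall>i\<in>{1..n}. integrable lborel (\<lambda>r. g r (x i))"
    by (intro AE_PiM_coordinates[OF M.sigma_finite_measure_axioms] AE_interval_prob) auto
  moreover have "AE x in ?P. ordered_chain a b n x \<longrightarrow> alternating_sum n w0 x \<le> k"
    by (rule AE_PiM_of_oscillation_le[OF M.sigma_finite_measure_axioms AE_interval_prob init])
  ultimately have key: "AE x in ?P. of_bool (ordered_chain a b n x) * soft_pos (alternating_sum n (w T) x - k) \<le> R x"
  proof eventually_elim
    case (elim x)
    show ?case
    proof (cases "ordered_chain a b n x")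
      case False
      then show ?thesis by (simp add: R_def \<Psi>_def)
    next
      case True
      let ?G = "\<lambda>r. D (x, r)" and ?W = "\<lambda>t. alternating_sum n (w t) x"
      have indi: "integrable lborel (\<lambda>r. indicator {s<..t} r * g r (x i))" if "i \<in> {1..n}" for t i
        using elim(1) that by (intro integrable_mult_indicator[of _ lborel "\<lambda>r. g r (x i)", simplified]) auto
      have Gi: "integrable lborel ?G"
        unfolding D_def using elim(1) by (auto intro!: Bochner_Integration.integrable_sum integrable_mult_right)
      have W: "?W t = alternating_sum n w0 x + (LINT r|lborel. indicator {s<..t} r * ?G r)" for t
      proof -
        have "(LINT r|lborel. indicator {s<..t} r * ?G r) =
            (LINT r|lborel. (\<Sum>i\<in>{1..n}. (-1) ^ i * (indicator {s<..t} r * g r (x i))))"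
          unfolding D_def by (simp add: sum_distrib_left mult_ac)
        also have "\<dots> = (\<Sum>i\<in>{1..n}. (-1) ^ i * (LINT r|lborel. indicator {s<..t} r * g r (x i)))"
          by (subst Bochner_Integration.integral_sum) (auto intro!: indi)
        finally show ?thesis
          by (simp add: alternating_sum_def w sum.distrib distrib_left)
      qed
      have "soft_pos (?W T - k) \<le> soft_pos (alternating_sum n w0 x - k) +
          (LINT r|lborel. indicator {s<..T} r * (?S (?W r - k) * ?G r))"
        by (rule soft_pos_chain_rule[OF Gi sT W])
      also have "soft_pos (alternating_sum n w0 x - k) = 0"
        using elim(2) True by (intro soft_pos_eq_0) simp
      also have "(LINT r|lborel. indicator {s<..T} r * (?S (?W r - k) * ?G r)) = R x"
        unfolding R_def \<Psi>_def using True by (simp add: mult_ac)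
      finally show ?thesis using True by simp
    qed
  qed
  have Rnn: "AE x in ?P. 0 \<le> R x"
    using key
  proof eventually_elim
    case (elim x)
    have "0 \<le> of_bool (ordered_chain a b n x) * soft_pos (alternating_sum n (w T) x - k)"
      using soft_pos_nonneg by simp
    with elim show ?case by linarith
  qed
  then have "(LINT x|?P. R x) = 0" using R_le integral_nonneg_AE[OF Rnn] by simp
  then have "AE x in ?P. R x = 0"
    using integral_nonneg_eq_0_iff_AE[OF Ri Rnn] by simp
  with key have "AE x in ?P. ordered_chain a b n x \<longrightarrow> alternating_sum n (w T) x \<le> k"
  proof eventually_elim
    case (elim x)
    then show ?case using soft_pos_le_0D[of "alternating_sum n (w T) x - k"] by auto
  qed
  from oscillation_le_of_AE_PiM[OF M.sigma_finite_measure_axioms sets_interval_prob _ wt this]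
  show ?thesis using null_interval_probD[OF ab] by blast
qed

text \<open>Induction on the number of points in steps of two; for \<open>n \<le> 1\<close> the hypothesis on \<open>n - 2\<close> points is void.\<close>

theorem oscillation_le_propagates:
  fixes w0 :: "real \<Rightarrow> real" and g w :: "real \<Rightarrow> real \<Rightarrow> real"
  assumes ab: "a < b" and w0: "w0 \<in> borel_measurable borel"
    and gi: "integrable (lborel \<Otimes>\<^sub>M lborel) (\<lambda>(r, x). g r x)"
    and w: "\<And>t x. w t x = w0 x + (LINT r|lborel. indicator {s<..t} r * g r x)"
    and slices: "AE t in lborel. s < t \<longrightarrow> t < T \<longrightarrow> (\<exists>V N. flux_slice a b (w t) (g t) V N)"
  shows "oscillation_le a b n w0 k \<Longrightarrow> s \<le> t \<Longrightarrow> t \<le> T \<Longrightarrow> oscillation_le a b n (w t) k"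
proof (induction n arbitrary: t rule: less_induct)
  case (less n)
  show ?case
  proof (rule oscillation_le_propagates_step[OF ab less.prems(2) w0 gi w])
    show "AE r in lborel. s < r \<longrightarrow> r < t \<longrightarrow> (\<exists>V N. flux_slice a b (w r) (g r) V N)"
      using slices by eventually_elim (use less.prems in auto)
    show "oscillation_le a b (n - 2) (w r) k" if "s \<le> r" "r \<le> t" "2 \<le> n" for r
    proof (rule less.IH)
      have "n - 2 + 2 = n" using that by simp
      then have "oscillation_le a b (n - 2 + 2) w0 k" using less.prems(1) by metis
      then show "oscillation_le a b (n - 2) w0 k" by (rule oscillation_le_fewer_points[OF _ ab])
    qed (use that less.prems in auto)
  qed (rule less.prems)
qed


section \<open>The evolution equation in integrated form\<close>

lemma AE_zero_of_trapezoid_orthogonal: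
  fixes f :: "real \<Rightarrow> real"
  assumes ab: "a < b" and f: "integrable (lebesgue_on {a<..<b}) f"
    and orth: "\<And>p q h. a < p \<Longrightarrow> p \<le> q \<Longrightarrow> q + h < b \<Longrightarrow> 0 < h \<Longrightarrow>
      (LINT x|lebesgue_on {a<..<b}. f x * trapezoid p q h x) = 0"
  shows "AE x in lborel. a < x \<longrightarrow> x < b \<longrightarrow> f x = 0"
proof -
  have z: "integral {p..q} f = 0" if "a \<le> p" "p \<le> q" "q \<le> b" for p q
    using primitive_of_trapezoid_identity(1)[of a b "\<lambda>_. 0" f p q] f orth ab that by simp
  obtain N where N: "negligible N"
    "\<And>x. a < x \<Longrightarrow> x < b \<Longrightarrow> x \<notin> N \<Longrightarrow> ((\<lambda>h. integral {x..x + h} f / h) \<longlongrightarrow> f x) (at_right 0)"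
    by (rule right_lebesgue_points[OF f]) (rule that)
  have zero: "f x = 0" if x: "a < x" "x < b" "x \<notin> N" for x
  proof (rule tendsto_unique[OF _ N(2)[OF x]])
    have "\<forall>\<^sub>F h in at_right 0. integral {x..x + h} f / h = 0"
      by (rule eventually_at_rightI[of 0 "b - x"]) (use z x in auto)
    then show "((\<lambda>h. integral {x..x + h} f / h) \<longlongrightarrow> 0) (at_right 0)"
      by (rule tendsto_eventually)
  qed simp
  have "AE x in lebesgue. x \<notin> N" using N(1) by (intro AE_not_in) (simp add: negligible_iff_null_sets)
  then have "AE x in lborel. x \<notin> N" by (simp add: AE_completion_iff)
  then show ?thesis by eventually_elim (use zero in auto)
qed

lemma AE_lebesgue_on_iff:
  "S \<in> sets borel \<Longrightarrow> (AE z in lebesgue_on S. P z) \<longleftrightarrow> (AE z in lborel. z \<in> S \<longrightarrow> P z)"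
  for S :: "'a::euclidean_space set"
  by (simp add: AE_restrict_space_iff AE_completion_iff)

text \<open>The weak formulation is stated for Lebesgue measurable functions, while Fubini's theorem needs Borel
  ones; this lemma and the next pass from the former to the latter.\<close>

lemma lebesgue_on_integral_eq_lborel:
  fixes F F' :: "'a::euclidean_space \<Rightarrow> real"
  assumes S: "S \<in> sets borel" and F': "F' \<in> borel_measurable borel"
    and eq: "AE z in lborel. indicator S z * F z = F' z"
  shows "(LINT z|lebesgue_on S. F z) = (LINT z|lborel. F' z)"
    and "integrable (lebesgue_on S) F \<longleftrightarrow> integrable lborel F'"
proof -
  have eq': "AE z in lebesgue. indicator S z * F z = F' z" using eq by (simp add: AE_completion_iff)
  have F'l: "F' \<in> borel_measurable lebesgue" using F' by (simp add: measurable_completion)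
  have Fl: "(\<lambda>z. indicator S z * F z) \<in> borel_measurable lebesgue"
    by (rule borel_measurable_AE[OF F'l]) (use eq' in eventually_elim, simp)
  have "(LINT z|lebesgue_on S. F z) = (LINT z|lebesgue. indicator S z * F z)"
    using S by (subst integral_restrict_space) auto
  also have "\<dots> = (LINT z|lebesgue. F' z)"
    by (rule integral_cong_AE[OF Fl F'l eq'])
  also have "\<dots> = (LINT z|lborel. F' z)"
    using F' by (intro integral_completion) simp
  finally show "(LINT z|lebesgue_on S. F z) = (LINT z|lborel. F' z)" .
  have "integrable (lebesgue_on S) F \<longleftrightarrow> integrable lebesgue (\<lambda>z. indicator S z * F z)"
    using S by (subst integrable_restrict_space) auto
  also have "\<dots> \<longleftrightarrow> integrable lebesgue F'"
    by (rule integrable_cong_AE[OF Fl F'l eq'])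
  also have "\<dots> \<longleftrightarrow> integrable lborel F'"
    using F' by (intro integrable_completion) simp
  finally show "integrable (lebesgue_on S) F \<longleftrightarrow> integrable lborel F'" .
qed

lemma integrable_borel_version:
  fixes f :: "'a::euclidean_space \<Rightarrow> real"
  assumes S: "S \<in> sets borel" and f: "integrable (lebesgue_on S) f"
  obtains f' where "f' \<in> borel_measurable borel" "integrable lborel f'"
    "\<And>z. z \<notin> S \<Longrightarrow> f' z = 0" "AE z in lborel. z \<in> S \<longrightarrow> f' z = f z"
proof -
  have "integrable lebesgue (\<lambda>z. indicator S z * f z)"
    using f S by (subst (asm) integrable_restrict_space) auto
  then have "(\<lambda>z. indicator S z * f z) \<in> borel_measurable lebesgue" by auto
  then obtain h where h: "h \<in> borel_measurable lborel" "AE z in lborel. indicator S z * f z = h z"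
    using completion_ex_borel_measurable_real[of "\<lambda>z. indicator S z * f z" lborel] by blast
  define f' where "f' z = indicator S z * h z" for z
  have m: "f' \<in> borel_measurable borel" unfolding f'_def[abs_def] using h(1) S by auto
  have eq: "AE z in lborel. indicator S z * f z = f' z"
    using h(2) by eventually_elim (auto simp: f'_def indicator_def)
  show ?thesis
  proof (rule that[OF m])
    show "integrable lborel f'" using lebesgue_on_integral_eq_lborel(2)[OF S m eq] f by simp
    show "f' z = 0" if "z \<notin> S" for z using that by (simp add: f'_def)
    show "AE z in lborel. z \<in> S \<longrightarrow> f' z = f z"
      using eq by eventually_elim (auto simp: indicator_def)
  qed
qed

lemma test_fun2_product:
  assumes \<eta>: "smooth \<eta>" "\<And>t. t \<notin> {p..c1} \<Longrightarrow> \<eta> t = 0"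
    and \<psi>: "smooth \<psi>" "\<And>x. x \<notin> {c..c2} \<Longrightarrow> \<psi> x = 0"
    and sub: "{p..c1} \<times> {c..c2} \<subseteq> \<Omega>"
  shows "test_fun2 \<Omega> (\<lambda>t x. \<eta> t * \<psi> x)"
proof -
  obtain D where D: "D 0 = \<eta>" "\<And>n x. (D n has_real_derivative D (Suc n) x) (at x)"
    using \<eta>(1) unfolding smooth_def by blast
  obtain E where E: "E 0 = \<psi>" "\<And>n x. (E n has_real_derivative E (Suc n) x) (at x)"
    using \<psi>(1) unfolding smooth_def by blast
  have Dc: "continuous_on UNIV (D n)" and Ec: "continuous_on UNIV (E n)" for n
    using D(2) E(2) by (meson DERIV_isCont continuous_at_imp_continuous_on)+
  have "smooth2 (\<lambda>t x. \<eta> t * \<psi> x)"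
    unfolding smooth2_def
  proof (intro exI[of _ "\<lambda>i j t x. D i t * E j x"] conjI allI)
    show "(\<lambda>t x. D 0 t * E 0 x) = (\<lambda>t x. \<eta> t * \<psi> x)" using D(1) E(1) by simp
    show "continuous_on UNIV (\<lambda>(t, x). D i t * E j x)" for i j
      unfolding case_prod_beta'
      by (intro continuous_on_mult continuous_on_compose2[OF Dc] continuous_on_compose2[OF Ec] continuous_intros) auto
    show "((\<lambda>s. D i s * E j x) has_real_derivative D (Suc i) t * E j x) (at t)" for i j t x
      by (rule DERIV_cmult_right[OF D(2)])
    show "((\<lambda>y. D i t * E j y) has_real_derivative D i t * E (Suc j) x) (at x)" for i j t x
      by (rule DERIV_cmult[OF E(2)])
  qed
  moreover have s: "closure {(t, x). \<eta> t * \<psi> x \<noteq> 0} \<subseteq> {p..c1} \<times> {c..c2}"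
  proof (rule closure_minimal)
    show "{(t, x). \<eta> t * \<psi> x \<noteq> 0} \<subseteq> {p..c1} \<times> {c..c2}"
    proof
      fix z assume "z \<in> {(t, x). \<eta> t * \<psi> x \<noteq> 0}"
      then have "\<eta> (fst z) \<noteq> 0" "\<psi> (snd z) \<noteq> 0" by (auto simp: case_prod_beta)
      then have "fst z \<in> {p..c1}" "snd z \<in> {c..c2}" using \<eta>(2) \<psi>(2) by blast+
      then show "z \<in> {p..c1} \<times> {c..c2}" by (cases z) auto
    qed
  qed (simp add: closed_Times)
  moreover have "compact (closure {(t, x). \<eta> t * \<psi> x \<noteq> 0})"
    using s compact_Times[OF compact_Icc compact_Icc, of p c1 c c2]
    by (meson bounded_subset closed_closure compact_eq_bounded_closed)
  ultimately show ?thesis unfolding test_fun2_def using sub by blast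
qed

lemma trapezoid_eq_0: "0 < h \<Longrightarrow> p \<le> q \<Longrightarrow> x \<notin> {p..q + h} \<Longrightarrow> trapezoid p q h x = 0"
  by (auto simp: trapezoid_def)

lemma trapezoid_deriv_eq_0: "0 < h \<Longrightarrow> p \<le> q \<Longrightarrow> x \<notin> {p..q + h} \<Longrightarrow> trapezoid_deriv p q h x = 0"
  by (auto simp: trapezoid_deriv_def indicator_def)

lemma trapezoid_bounds: "0 < h \<Longrightarrow> p \<le> q \<Longrightarrow> \<bar>trapezoid p q h x\<bar> \<le> h"
  by (auto simp: trapezoid_def)

lemma trapezoid_deriv_bound: "\<bar>trapezoid_deriv p q h x\<bar> \<le> 1"
  by (auto simp: trapezoid_deriv_def indicator_def)

text \<open>The weak equation for products of a trapezoid in time and a trapezoid in space. The indicator of the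
  compact rectangle that contains the supports of the approximating test functions makes the factors
  \<open>u\<close> and \<open>ut\<close> integrable.\<close>

lemma weak_time_deriv_trapezoid:
  assumes wd: "weak_time_deriv ({0<..} \<times> {a<..<b}) u ut"
    and t: "0 < p" "p \<le> q" "q + h < T" "0 < h"
    and x: "a < c" "c \<le> d" "d + e < b" "0 < e"
  obtains c1 c2 where "q + h < c1" "c1 < T" "d + e < c2" "c2 < b"
    "(LINT z|lebesgue_on ({0<..} \<times> {a<..<b}). (u (fst z) (snd z) * indicator ({p..c1} \<times> {c..c2}) z) *
        (trapezoid_deriv p q h (fst z) * trapezoid c d e (snd z))) =
     - (LINT z|lebesgue_on ({0<..} \<times> {a<..<b}). (ut (fst z) (snd z) * indicator ({p..c1} \<times> {c..c2}) z) *
        (trapezoid p q h (fst z) * trapezoid c d e (snd z)))"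
    "integrable (lebesgue_on ({p..c1} \<times> {c..c2})) (\<lambda>z. u (fst z) (snd z))"
proof -
  let ?\<Omega> = "{0<..} \<times> {a<..<b} :: (real \<times> real) set"
  obtain c1 \<eta> where \<eta>: "c1 < T" "q + h < c1"
    "\<And>n. test_fun {0<..<T} (\<eta> n)" "\<And>n x. x \<notin> {p..c1} \<Longrightarrow> \<eta> n x = 0"
    "\<And>n x. 0 \<le> \<eta> n x" "\<And>n x. \<eta> n x \<le> h" "\<And>n x. \<bar>deriv (\<eta> n) x\<bar> \<le> 1"
    "\<And>n x. x \<notin> {p..c1} \<Longrightarrow> deriv (\<eta> n) x = 0"
    "\<And>x. (\<lambda>n. \<eta> n x) \<longlonglongrightarrow> trapezoid p q h x"
    "\<And>x. (\<lambda>n. deriv (\<eta> n) x) \<longlonglongrightarrow> trapezoid_deriv p q h x"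
    "\<And>n. continuous_on UNIV (deriv (\<eta> n))"
    by (rule trapezoid_approx[OF t]) (rule that)
  obtain c2 \<psi> where \<psi>: "c2 < b" "d + e < c2"
    "\<And>n. test_fun {a<..<b} (\<psi> n)" "\<And>n x. x \<notin> {c..c2} \<Longrightarrow> \<psi> n x = 0"
    "\<And>n x. 0 \<le> \<psi> n x" "\<And>n x. \<psi> n x \<le> e" "\<And>n x. \<bar>deriv (\<psi> n) x\<bar> \<le> 1"
    "\<And>n x. x \<notin> {c..c2} \<Longrightarrow> deriv (\<psi> n) x = 0"
    "\<And>x. (\<lambda>n. \<psi> n x) \<longlonglongrightarrow> trapezoid c d e x"
    "\<And>x. (\<lambda>n. deriv (\<psi> n) x) \<longlonglongrightarrow> trapezoid_deriv c d e x"
    "\<And>n. continuous_on UNIV (deriv (\<psi> n))"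
    by (rule trapezoid_approx[OF x]) (rule that)
  let ?K = "{p..c1} \<times> {c..c2}"
  have K: "compact ?K" "?K \<subseteq> ?\<Omega>" using t x \<psi>(1) by (auto intro: compact_Times)
  have Kb: "?K \<in> sets borel" using K(1) by (simp add: borel_compact)
  have \<Omega>b: "?\<Omega> \<in> sets borel" by (intro borel_open open_Times) auto
  have sm: "smooth (\<eta> n)" "smooth (\<psi> n)" for n using \<eta>(3) \<psi>(3) by (auto simp: test_fun_def)
  have c\<eta>: "continuous_on UNIV (\<lambda>z. \<eta> n (fst z))" for n
    by (rule continuous_on_compose2[OF smooth_continuous_on[OF sm(1), of UNIV]]) (auto intro: continuous_intros)
  have c\<eta>': "continuous_on UNIV (\<lambda>z. deriv (\<eta> n) (fst z))" for n
    by (rule continuous_on_compose2[OF \<eta>(11)]) (auto intro: continuous_intros)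
  have c\<psi>: "continuous_on UNIV (\<lambda>z. \<psi> n (snd z))" for n
    by (rule continuous_on_compose2[OF smooth_continuous_on[OF sm(2), of UNIV]]) (auto intro: continuous_intros)
  have iK: "integrable (lebesgue_on ?K) (\<lambda>z. u (fst z) (snd z))" "integrable (lebesgue_on ?K) (\<lambda>z. ut (fst z) (snd z))"
    using wd K unfolding weak_time_deriv_def by (auto simp: case_prod_beta')
  have i\<Omega>: "integrable (lebesgue_on ?\<Omega>) (\<lambda>z. f z * indicator ?K z)"
    if f: "integrable (lebesgue_on ?K) f" for f :: "real \<times> real \<Rightarrow> real"
  proof -
    have "integrable lebesgue (\<lambda>z. indicator ?K z *\<^sub>R f z)"
      using f Kb by (subst (asm) integrable_restrict_space) auto
    also have "(\<lambda>z. indicator ?K z *\<^sub>R f z) = (\<lambda>z. indicator ?\<Omega> z *\<^sub>R (f z * indicator ?K z))"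
    proof
      fix z
      show "indicator ?K z *\<^sub>R f z = indicator ?\<Omega> z *\<^sub>R (f z * indicator ?K z)"
      proof (cases "z \<in> ?K")
        case True
        with K(2) have "z \<in> ?\<Omega>" by blast
        with True show ?thesis by (simp only: indicator_simps) simp
      next
        case False
        then have "indicator ?K z = (0 :: real)" by (rule indicator_simps(2))
        then show ?thesis by (simp only: mult_zero_right scale_zero_right scale_zero_left)
      qed
    qed
    finally show ?thesis using \<Omega>b by (subst integrable_restrict_space) auto
  qed
  have eq: "(LINT z|lebesgue_on ?\<Omega>. (u (fst z) (snd z) * indicator ?K z) * (deriv (\<eta> n) (fst z) * \<psi> n (snd z))) =
      - (LINT z|lebesgue_on ?\<Omega>. (ut (fst z) (snd z) * indicator ?K z) * (\<eta> n (fst z) * \<psi> n (snd z)))" for n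
  proof -
    have "test_fun2 ?\<Omega> (\<lambda>t x. \<eta> n t * \<psi> n x)"
      by (rule test_fun2_product[OF sm(1) \<eta>(4) sm(2) \<psi>(4) K(2)])
    then have "(LINT z|lebesgue_on ?\<Omega>. u (fst z) (snd z) * deriv (\<lambda>s. \<eta> n s * \<psi> n (snd z)) (fst z)) =
        - (LINT z|lebesgue_on ?\<Omega>. ut (fst z) (snd z) * (\<eta> n (fst z) * \<psi> n (snd z)))"
      using wd unfolding weak_time_deriv_def by (auto simp: case_prod_beta')
    moreover have "deriv (\<lambda>s. \<eta> n s * y) r = deriv (\<eta> n) r * y" for y r
    proof -
      have "(\<eta> n has_real_derivative deriv (\<eta> n) r) (at r)"
        using sm(1)[of n] unfolding smooth_def by (metis DERIV_imp_deriv)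
      then show ?thesis by (intro DERIV_imp_deriv DERIV_cmult_right)
    qed
    moreover have "u (fst z) (snd z) * indicator ?K z * (deriv (\<eta> n) (fst z) * \<psi> n (snd z)) =
        u (fst z) (snd z) * (deriv (\<eta> n) (fst z) * \<psi> n (snd z))" for z
      using \<eta>(8)[of "fst z" n] \<psi>(4)[of "snd z" n] by (cases z) (auto simp: indicator_def)
    moreover have "ut (fst z) (snd z) * indicator ?K z * (\<eta> n (fst z) * \<psi> n (snd z)) =
        ut (fst z) (snd z) * (\<eta> n (fst z) * \<psi> n (snd z))" for z
      using \<eta>(4)[of "fst z" n] \<psi>(4)[of "snd z" n] by (cases z) (auto simp: indicator_def)
    ultimately show ?thesis by (simp only:)
  qed
  have L1: "(\<lambda>n. LINT z|lebesgue_on ?\<Omega>. (u (fst z) (snd z) * indicator ?K z) * (deriv (\<eta> n) (fst z) * \<psi> n (snd z))) \<longlonglongrightarrow>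
      (LINT z|lebesgue_on ?\<Omega>. (u (fst z) (snd z) * indicator ?K z) * (trapezoid_deriv p q h (fst z) * trapezoid c d e (snd z)))"
  proof (rule bounded_multiplier_convergence[OF i\<Omega>[OF iK(1)], where C = "1 * e"])
    show "(\<lambda>z. deriv (\<eta> n) (fst z) * \<psi> n (snd z)) \<in> borel_measurable (lebesgue_on ?\<Omega>)" for n
      by (intro borel_measurable_lebesgue_on borel_measurable_continuous_onI continuous_on_mult c\<eta> c\<eta>' c\<psi>)
    show "\<bar>deriv (\<eta> n) (fst z) * \<psi> n (snd z)\<bar> \<le> 1 * e" for n z
      unfolding abs_mult by (rule mult_mono) (use \<eta>(7) \<psi>(5,6) in auto)
    show "(\<lambda>n. deriv (\<eta> n) (fst z) * \<psi> n (snd z)) \<longlonglongrightarrow> trapezoid_deriv p q h (fst z) * trapezoid c d e (snd z)" for z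
      by (intro tendsto_mult \<eta> \<psi>)
  qed
  have L2: "(\<lambda>n. LINT z|lebesgue_on ?\<Omega>. (ut (fst z) (snd z) * indicator ?K z) * (\<eta> n (fst z) * \<psi> n (snd z))) \<longlonglongrightarrow>
      (LINT z|lebesgue_on ?\<Omega>. (ut (fst z) (snd z) * indicator ?K z) * (trapezoid p q h (fst z) * trapezoid c d e (snd z)))"
  proof (rule bounded_multiplier_convergence[OF i\<Omega>[OF iK(2)], where C = "h * e"])
    show "(\<lambda>z. \<eta> n (fst z) * \<psi> n (snd z)) \<in> borel_measurable (lebesgue_on ?\<Omega>)" for n
      by (intro borel_measurable_lebesgue_on borel_measurable_continuous_onI continuous_on_mult c\<eta> c\<eta>' c\<psi>)
    show "\<bar>\<eta> n (fst z) * \<psi> n (snd z)\<bar> \<le> h * e" for n z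
      unfolding abs_mult by (rule mult_mono) (use \<eta>(5,6) \<psi>(5,6) t in auto)
    show "(\<lambda>n. \<eta> n (fst z) * \<psi> n (snd z)) \<longlonglongrightarrow> trapezoid p q h (fst z) * trapezoid c d e (snd z)" for z
      by (intro tendsto_mult \<eta> \<psi>)
  qed
  have "(LINT z|lebesgue_on ?\<Omega>. (u (fst z) (snd z) * indicator ?K z) * (trapezoid_deriv p q h (fst z) * trapezoid c d e (snd z))) =
      - (LINT z|lebesgue_on ?\<Omega>. (ut (fst z) (snd z) * indicator ?K z) * (trapezoid p q h (fst z) * trapezoid c d e (snd z)))"
    by (rule LIMSEQ_unique[OF L1[unfolded eq] tendsto_minus[OF L2]])
  then show ?thesis using that[of c1 c2] \<eta>(1,2) \<psi>(1,2) iK(1) by blast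
qed

lemma fst_snd_borel_measurable [measurable]:
  "(fst :: real \<times> real \<Rightarrow> real) \<in> borel_measurable borel"
  "(snd :: real \<times> real \<Rightarrow> real) \<in> borel_measurable borel"
  by (intro borel_measurable_continuous_onI continuous_intros)+

lemma measurable_comp_fst_snd:
  fixes f :: "real \<Rightarrow> real"
  assumes "f \<in> borel_measurable borel"
  shows "(\<lambda>z :: real \<times> real. f (fst z)) \<in> borel_measurable borel"
    and "(\<lambda>z :: real \<times> real. f (snd z)) \<in> borel_measurable borel"
  by (rule measurable_compose[OF fst_snd_borel_measurable(1) assms],
      rule measurable_compose[OF fst_snd_borel_measurable(2) assms])

lemma trapezoid_comp_measurable [simp]:
  "(\<lambda>z :: real \<times> real. trapezoid p q h (snd z)) \<in> borel_measurable borel"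
  "(\<lambda>z :: real \<times> real. indicator {p<..q} (fst z) :: real) \<in> borel_measurable borel"
  by (intro measurable_comp_fst_snd; measurable)+

text \<open>Fubini's theorem for a test function that is a product, with \<open>f'\<close> a Borel version of \<open>f\<close> on the set \<open>K\<close>
  that contains its support.\<close>

lemma lebesgue_on_integral_separated:
  fixes f f' :: "real \<times> real \<Rightarrow> real" and \<tau> \<psi> :: "real \<Rightarrow> real"
  assumes S: "S \<in> sets borel" and KS: "K \<subseteq> S"
    and f': "integrable lborel f'" "AE z in lborel. z \<in> K \<longrightarrow> f' z = f z"
    and \<tau>: "\<tau> \<in> borel_measurable borel" "\<And>t. \<bar>\<tau> t\<bar> \<le> A"
    and \<psi>: "\<psi> \<in> borel_measurable borel" "\<And>x. \<bar>\<psi> x\<bar> \<le> B"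
    and out: "\<And>z. z \<notin> K \<Longrightarrow> \<tau> (fst z) * \<psi> (snd z) = 0"
  shows "(LINT z|lebesgue_on S. (f z * indicator K z) * (\<tau> (fst z) * \<psi> (snd z))) =
    (LINT r|lborel. (LINT y|lborel. f' (r, y) * \<psi> y) * \<tau> r)"
proof -
  have m: "(\<lambda>z :: real \<times> real. \<tau> (fst z)) \<in> borel_measurable borel"
    "(\<lambda>z :: real \<times> real. \<psi> (snd z)) \<in> borel_measurable borel"
    by (rule measurable_comp_fst_snd[OF \<tau>(1)], rule measurable_comp_fst_snd[OF \<psi>(1)])
  have "integrable lborel (\<lambda>z. f' z * \<psi> (snd z))"
    by (rule integrable_bounded_multiplier[OF f'(1) _ \<psi>(2)]) (simp add: m)
  then have i: "integrable lborel (\<lambda>z. f' z * \<psi> (snd z) * \<tau> (fst z))"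
    by (rule integrable_bounded_multiplier[OF _ _ \<tau>(2)]) (simp add: m)
  have "(LINT z|lebesgue_on S. (f z * indicator K z) * (\<tau> (fst z) * \<psi> (snd z))) =
      (LINT z|lborel. f' z * \<psi> (snd z) * \<tau> (fst z))"
  proof (rule lebesgue_on_integral_eq_lborel(1)[OF S])
    show "(\<lambda>z. f' z * \<psi> (snd z) * \<tau> (fst z)) \<in> borel_measurable borel" using i by auto
    show "AE z in lborel. indicator S z * (f z * indicator K z * (\<tau> (fst z) * \<psi> (snd z))) =
        f' z * \<psi> (snd z) * \<tau> (fst z)"
      using f'(2)
    proof eventually_elim
      case (elim z)
      show ?case
      proof (cases "z \<in> K")
        case True
        with KS have "z \<in> S" by blast
        with True elim show ?thesis by simp
      next
        case False
        from out[OF this] show ?thesis by auto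
      qed
    qed
  qed
  also have "\<dots> = (LINT r|lborel. LINT y|lborel. f' (r, y) * \<psi> y * \<tau> r)"
    using lborel_pair.integral_fst'[of "\<lambda>z. f' z * \<psi> (snd z) * \<tau> (fst z)"] i by (simp add: lborel_prod)
  finally show ?thesis by simp
qed

text \<open>Testing the weak equation with a trapezoid in space shows that \<open>m(t) = \<integral> U t x \<psi>(x) dx\<close>, a continuous
  function of \<open>t\<close> by the continuity of \<open>U\<close> in \<open>L\<^sup>1\<close>, has the weak derivative \<open>G(t) = \<integral> g(t,x) \<psi>(x) dx\<close>. So \<open>m\<close> is
  a primitive of \<open>G\<close> on the closed interval \<open>[0, T]\<close>, and since \<open>\<psi>\<close> is arbitrary the identity holds
  almost everywhere in \<open>x\<close>.\<close>

lemma borel_representative_flow: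
  assumes ab: "a < b" and wd: "weak_time_deriv ({0<..} \<times> {a<..<b}) u ut" and L1: "L1_continuous_rep a b u U"
    and g: "g \<in> borel_measurable borel" "integrable lborel g"
    and gut: "AE z in lborel. z \<in> {0<..<T} \<times> {a<..<b} \<longrightarrow> g z = ut (fst z) (snd z)"
    and st: "0 \<le> s" "s \<le> t" "t \<le> T" "0 < T"
  shows "AE x in lborel. a < x \<longrightarrow> x < b \<longrightarrow> U t x = U s x + (LINT r|lborel. indicator {s<..t} r * g (r, x))"
proof -
  let ?L = "lebesgue_on {a<..<b}"
  have UI: "integrable ?L (U r)" if "0 \<le> r" for r
    using L1 that unfolding L1_continuous_rep_def by blast
  have Uc: "((\<lambda>r'. LINT x|?L. \<bar>U r' x - U r x\<bar>) \<longlongrightarrow> 0) (at r within {0..})" if "0 \<le> r" for r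
    using L1 that unfolding L1_continuous_rep_def by blast
  have Uu: "AE r in lborel. 0 < r \<longrightarrow> (AE x in lborel. a < x \<longrightarrow> x < b \<longrightarrow> U r x = u r x)"
    using L1 unfolding L1_continuous_rep_def by (simp add: AE_lebesgue_on_iff imp_conjL)
  have gp: "integrable (lborel \<Otimes>\<^sub>M lborel) g" using g(2) by (simp add: lborel_prod)
  note g(1)[measurable]
  define J where "J x = (LINT r|lborel. indicator {s<..t} r * g (r, x))" for x
  have gJ: "integrable (lborel \<Otimes>\<^sub>M lborel) (\<lambda>(r, x). indicator {s<..t} r * g (r, x))"
  proof -
    have "integrable lborel (\<lambda>z. g z * indicator {s<..t} (fst z))"
      by (rule integrable_bounded_multiplier[OF g(2), where C = 1])
        (simp, simp add: indicator_def)
    then show ?thesis by (simp add: lborel_prod case_prod_beta' mult.commute)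
  qed
  have Ji: "integrable lborel J"
    unfolding J_def by (rule lborel_pair.integrable_snd[OF gJ])
  have Jl: "integrable ?L J"
  proof -
    have "integrable lborel (\<lambda>x. J x * indicator {a<..<b} x)"
      by (rule integrable_bounded_multiplier[OF Ji, where C = 1]) (auto simp: indicator_def)
    then show ?thesis
      using Ji by (subst lebesgue_on_integral_eq_lborel(2)[where F' = "\<lambda>x. J x * indicator {a<..<b} x"]) (auto simp: mult.commute)
  qed
  have "AE x in lborel. a < x \<longrightarrow> x < b \<longrightarrow> U t x - U s x - J x = 0"
  proof (rule AE_zero_of_trapezoid_orthogonal[OF ab])
    show fi: "integrable ?L (\<lambda>x. U t x - U s x - J x)"
      using UI st Jl by (intro Bochner_Integration.integrable_diff) auto
    fix c d e assume x: "a < c" "c \<le> d" "d + e < b" "0 < e"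
    let ?\<psi> = "trapezoid c d e"
    have \<psi>b: "\<bar>?\<psi> y\<bar> \<le> e" for y using trapezoid_bounds x by auto
    have \<psi>l: "?\<psi> \<in> borel_measurable ?L" by (intro borel_measurable_lebesgue_on) simp
    define m where "m r = (LINT y|?L. U r y * ?\<psi> y)" for r
    define G where "G r = (LINT y|lborel. g (r, y) * ?\<psi> y)" for r
    have Um: "integrable ?L (\<lambda>y. U r y * ?\<psi> y)" if "0 \<le> r" for r
      by (rule integrable_bounded_multiplier[OF UI[OF that] \<psi>l \<psi>b])
    have mc: "continuous_on {0..T} m"
      unfolding continuous_on_def
    proof
      fix r assume "r \<in> {0..T}"
      then have r: "0 \<le> r" by simp
      have "((\<lambda>r'. e * (LINT y|?L. \<bar>U r' y - U r y\<bar>)) \<longlongrightarrow> e * 0) (at r within {0..T})"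
        by (intro tendsto_intros tendsto_within_subset[OF Uc[OF r]]) auto
      then have lim: "((\<lambda>r'. e * (LINT y|?L. \<bar>U r' y - U r y\<bar>)) \<longlongrightarrow> 0) (at r within {0..T})" by simp
      have "((\<lambda>r'. m r' - m r) \<longlongrightarrow> 0) (at r within {0..T})"
      proof (rule Lim_null_comparison[OF _ lim])
        show "\<forall>\<^sub>F r' in at r within {0..T}. norm (m r' - m r) \<le> e * (LINT y|?L. \<bar>U r' y - U r y\<bar>)"
          unfolding eventually_at_filter
        proof (intro always_eventually allI impI)
          fix r' assume "r' \<in> {0..T}"
          then have r': "0 \<le> r'" by simp
          have "m r' - m r = (LINT y|?L. U r' y * ?\<psi> y - U r y * ?\<psi> y)"
            unfolding m_def using Um r r' by simp
          then have "norm (m r' - m r) \<le> (LINT y|?L. norm (U r' y * ?\<psi> y - U r y * ?\<psi> y))"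
            by (simp only: integral_norm_bound)
          also have "\<dots> \<le> (LINT y|?L. e * \<bar>U r' y - U r y\<bar>)"
          proof (rule integral_mono)
            show "integrable ?L (\<lambda>y. norm (U r' y * ?\<psi> y - U r y * ?\<psi> y))"
              by (intro integrable_norm Bochner_Integration.integrable_diff Um r r')
            show "integrable ?L (\<lambda>y. e * \<bar>U r' y - U r y\<bar>)"
              by (intro integrable_mult_right integrable_abs Bochner_Integration.integrable_diff UI r r')
            show "norm (U r' y * ?\<psi> y - U r y * ?\<psi> y) \<le> e * \<bar>U r' y - U r y\<bar>" for y
            proof -
              have "norm (U r' y * ?\<psi> y - U r y * ?\<psi> y) = \<bar>?\<psi> y\<bar> * \<bar>U r' y - U r y\<bar>"
                by (simp only: real_norm_def left_diff_distrib[symmetric] abs_mult mult.commute)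
              also have "\<dots> \<le> e * \<bar>U r' y - U r y\<bar>" by (rule mult_right_mono[OF \<psi>b]) simp
              finally show ?thesis .
            qed
          qed
          finally show "norm (m r' - m r) \<le> e * (LINT y|?L. \<bar>U r' y - U r y\<bar>)" by simp
        qed
      qed
      then show "(m \<longlongrightarrow> m r) (at r within {0..T})" by (rule LIM_zero_cancel)
    qed
    have ml: "integrable (lebesgue_on {0<..<T}) m"
    proof -
      have "m absolutely_integrable_on {0..T}" by (rule absolutely_integrable_continuous_real[OF mc])
      then show ?thesis
        unfolding absolutely_integrable_on_Icc_iff_Ioo by (simp add: integrable_restrict_space set_integrable_def)
    qed
    have g\<psi>: "integrable (lborel \<Otimes>\<^sub>M lborel) (\<lambda>z. g z * ?\<psi> (snd z))"
      unfolding lborel_prod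
      by (rule integrable_bounded_multiplier[OF g(2), where C = e])
        (simp, rule \<psi>b)
    have Gi: "integrable lborel G"
      unfolding G_def using lborel_pair.integrable_fst'[OF g\<psi>] by simp
    have Gl: "integrable (lebesgue_on {0<..<T}) G"
    proof -
      have "integrable lborel (\<lambda>x. G x * indicator {0<..<T} x)"
        by (rule integrable_bounded_multiplier[OF Gi, where C = 1]) (auto simp: indicator_def)
      then show ?thesis
        using Gi by (subst lebesgue_on_integral_eq_lborel(2)[where F' = "\<lambda>x. G x * indicator {0<..<T} x"]) (auto simp: mult.commute)
    qed
    \<comment> \<open>The weak equation says that \<open>m\<close> has the weak derivative \<open>G\<close> on \<open>(0, T)\<close>.\<close>
    have trap: "integral {p..p + h} m - integral {q..q + h} m = - (LINT r|lebesgue_on {0<..<T}. G r * trapezoid p q h r)"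
      if t: "0 < p" "p \<le> q" "q + h < T" "0 < h" for p q h
    proof -
      let ?\<Omega> = "{0<..} \<times> {a<..<b} :: (real \<times> real) set"
      have \<Omega>b: "?\<Omega> \<in> sets borel" by (intro borel_open open_Times) auto
      obtain c1 c2 where c: "q + h < c1" "c1 < T" "d + e < c2" "c2 < b"
        and eq: "(LINT z|lebesgue_on ?\<Omega>. (u (fst z) (snd z) * indicator ({p..c1} \<times> {c..c2}) z) *
            (trapezoid_deriv p q h (fst z) * ?\<psi> (snd z))) =
          - (LINT z|lebesgue_on ?\<Omega>. (ut (fst z) (snd z) * indicator ({p..c1} \<times> {c..c2}) z) *
            (trapezoid p q h (fst z) * ?\<psi> (snd z)))"
        and uK: "integrable (lebesgue_on ({p..c1} \<times> {c..c2})) (\<lambda>z. u (fst z) (snd z))"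
        by (rule weak_time_deriv_trapezoid[OF wd t x]) (rule that)
      let ?K = "{p..c1} \<times> {c..c2}"
      have Kb: "?K \<in> sets borel" by (intro borel_closed closed_Times) auto
      have K\<Omega>: "z \<in> {0<..<T} \<times> {a<..<b}" "z \<in> ?\<Omega>" if "z \<in> ?K" for z
        using that t x c by auto
      have out: "trapezoid p q h (fst z) * ?\<psi> (snd z) = 0" "trapezoid_deriv p q h (fst z) * ?\<psi> (snd z) = 0"
        if "z \<notin> ?K" for z
      proof -
        have "fst z \<notin> {p..q + h} \<or> snd z \<notin> {c..d + e}" using that c by (cases z) auto
        then show "trapezoid p q h (fst z) * ?\<psi> (snd z) = 0" "trapezoid_deriv p q h (fst z) * ?\<psi> (snd z) = 0"
          using trapezoid_eq_0[OF t(4,2)] trapezoid_deriv_eq_0[OF t(4,2)] trapezoid_eq_0[OF x(4,2)] by auto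
      qed
      have RHS: "(LINT z|lebesgue_on ?\<Omega>. (ut (fst z) (snd z) * indicator ?K z) * (trapezoid p q h (fst z) * ?\<psi> (snd z)))
          = (LINT r|lebesgue_on {0<..<T}. G r * trapezoid p q h r)"
      proof -
        have "AE z in lborel. z \<in> ?K \<longrightarrow> g z = ut (fst z) (snd z)"
          using gut by eventually_elim (use K\<Omega> in blast)
        from lebesgue_on_integral_separated[OF \<Omega>b K\<Omega>(2)[THEN subsetI] g(2) this
            trapezoid_measurable trapezoid_bounds[OF t(4,2)] trapezoid_measurable \<psi>b out(1)]
        have "(LINT z|lebesgue_on ?\<Omega>. (ut (fst z) (snd z) * indicator ?K z) * (trapezoid p q h (fst z) * ?\<psi> (snd z)))
            = (LINT r|lborel. G r * trapezoid p q h r)" unfolding G_def .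
        also have "\<dots> = (LINT r|lebesgue_on {0<..<T}. G r * trapezoid p q h r)"
        proof (rule lebesgue_on_integral_eq_lborel(1)[symmetric])
          show "(\<lambda>r. G r * trapezoid p q h r) \<in> borel_measurable borel" using Gi by auto
          show "AE r in lborel. indicator {0<..<T} r * (G r * trapezoid p q h r) = G r * trapezoid p q h r"
          proof (rule AE_I2)
            fix r
            show "indicator {0<..<T} r * (G r * trapezoid p q h r) = G r * trapezoid p q h r"
              using trapezoid_eq_0[OF t(4,2), of r] t by (cases "r \<in> {0<..<T}") auto
          qed
        qed simp
        finally show ?thesis .
      qed
      have LHS: "(LINT z|lebesgue_on ?\<Omega>. (u (fst z) (snd z) * indicator ?K z) * (trapezoid_deriv p q h (fst z) * ?\<psi> (snd z)))
          = (LINT r|lebesgue_on {0<..<T}. m r * trapezoid_deriv p q h r)"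
      proof -
        \<comment> \<open>A Borel version of \<open>u\<close> on the rectangle; at almost every time it agrees with \<open>U\<close> there.\<close>
        obtain u' where u': "u' \<in> borel_measurable borel" "integrable lborel u'"
          "\<And>z. z \<notin> ?K \<Longrightarrow> u' z = 0" "AE z in lborel. z \<in> ?K \<longrightarrow> u' z = u (fst z) (snd z)"
          using integrable_borel_version[OF Kb uK] by blast
        note u'(1)[measurable]
        have "(LINT z|lebesgue_on ?\<Omega>. (u (fst z) (snd z) * indicator ?K z) * (trapezoid_deriv p q h (fst z) * ?\<psi> (snd z)))
            = (LINT r|lborel. (LINT y|lborel. u' (r, y) * ?\<psi> y) * trapezoid_deriv p q h r)"
          by (rule lebesgue_on_integral_separated[OF \<Omega>b K\<Omega>(2)[THEN subsetI] u'(2,4)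
                trapezoid_deriv_measurable trapezoid_deriv_bound trapezoid_measurable \<psi>b out(2)])
        also have "\<dots> = (LINT r|lebesgue_on {0<..<T}. m r * trapezoid_deriv p q h r)"
        proof (rule lebesgue_on_integral_eq_lborel(1)[symmetric])
          show "(\<lambda>r. (LINT y|lborel. u' (r, y) * ?\<psi> y) * trapezoid_deriv p q h r) \<in> borel_measurable borel" by measurable
          have "AE z in lborel \<Otimes>\<^sub>M lborel. z \<in> ?K \<longrightarrow> u' z = u (fst z) (snd z)" using u'(4) by (simp only: lborel_prod)
          from lborel_pair.AE_pair[OF this] Uu
          show "AE r in lborel. indicator {0<..<T} r * (m r * trapezoid_deriv p q h r) =
              (LINT y|lborel. u' (r, y) * ?\<psi> y) * trapezoid_deriv p q h r"
          proof eventually_elim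
            case (elim r)
            show ?case
            proof (cases "r \<in> {p..q + h}")
              case False
              then show ?thesis using trapezoid_deriv_eq_0[OF t(4,2)] by simp
            next
              case True
              then have r: "0 < r" "r < T" "r \<in> {p..c1}" using t c by auto
              have ur: "(\<lambda>y. u' (r, y) * ?\<psi> y) \<in> borel_measurable borel" by measurable
              have "m r = (LINT y|lborel. u' (r, y) * ?\<psi> y)"
                unfolding m_def
              proof (rule lebesgue_on_integral_eq_lborel(1)[OF _ ur])
                from elim(1) elim(2)[rule_format, OF r(1)]
                show "AE y in lborel. indicator {a<..<b} y * (U r y * ?\<psi> y) = u' (r, y) * ?\<psi> y"
                proof eventually_elim
                  case (elim y)
                  show ?case
                  proof (cases "y \<in> {c..d + e}")
                    case False
                    then show ?thesis using trapezoid_eq_0[OF x(4,2)] by simp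
                  next
                    case True
                    then show ?thesis using elim r x c by auto
                  qed
                qed
              qed simp
              then show ?thesis using r by simp
            qed
          qed
        qed simp
        finally show ?thesis .
      qed
      show ?thesis using eq unfolding LHS RHS integral_trapezoid_deriv[OF ml t] .
    qed
    have "m t - m s = integral {s..t} G"
      by (rule primitive_of_trapezoid_identity(1)[OF mc Gl trap]) (use st in auto)
    also have "\<dots> = (LINT r:{s..t}|lborel. G r)"
    proof (rule set_borel_integral_eq_integral(2)[symmetric])
      show "set_integrable lborel {s..t} G" unfolding set_integrable_def using Gi by (intro integrable_mult_indicator) auto
    qed
    also have "\<dots> = (LINT r|lborel. indicator {s<..t} r * G r)"
      unfolding set_lebesgue_integral_def
    proof (rule integral_cong_AE)
      show "AE r in lborel. indicator {s..t} r *\<^sub>R G r = indicator {s<..t} r * G r"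
        using AE_lborel_singleton[of s] by eventually_elim (auto simp: indicator_def)
    qed (use Gi in auto)
    also have "\<dots> = (LINT r|lborel. LINT y|lborel. indicator {s<..t} r * g (r, y) * ?\<psi> y)"
      unfolding G_def by (simp add: mult.assoc)
    also have "\<dots> = (LINT y|lborel. LINT r|lborel. indicator {s<..t} r * g (r, y) * ?\<psi> y)"
    proof (rule lborel_pair.Fubini_integral[symmetric])
      have "integrable (lborel \<Otimes>\<^sub>M lborel) (\<lambda>z. (\<lambda>(r, x). indicator {s<..t} r * g (r, x)) z * ?\<psi> (snd z))"
        by (rule integrable_bounded_multiplier[OF gJ, where C = e])
          (simp add: lborel_prod, rule \<psi>b)
      then show "integrable (lborel \<Otimes>\<^sub>M lborel) (\<lambda>(r, y). indicator {s<..t} r * g (r, y) * ?\<psi> y)"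
        by (simp add: case_prod_beta')
    qed
    also have "\<dots> = (LINT y|lborel. J y * ?\<psi> y)" unfolding J_def by simp
    also have "\<dots> = (LINT y|?L. J y * ?\<psi> y)"
    proof (rule lebesgue_on_integral_eq_lborel(1)[symmetric])
      show "(\<lambda>y. J y * ?\<psi> y) \<in> borel_measurable borel" using Ji by auto
      show "AE y in lborel. indicator {a<..<b} y * (J y * ?\<psi> y) = J y * ?\<psi> y"
      proof (rule AE_I2)
        fix y show "indicator {a<..<b} y * (J y * ?\<psi> y) = J y * ?\<psi> y"
          using trapezoid_eq_0[OF x(4,2), of y] x by (cases "y \<in> {a<..<b}") auto
      qed
    qed simp
    finally have key: "m t - m s = (LINT y|?L. J y * ?\<psi> y)" .
    have J\<psi>: "integrable ?L (\<lambda>y. J y * ?\<psi> y)" by (rule integrable_bounded_multiplier[OF Jl \<psi>l \<psi>b])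
    have "(LINT y|?L. (U t y - U s y - J y) * ?\<psi> y) = m t - m s - (LINT y|?L. J y * ?\<psi> y)"
      unfolding m_def left_diff_distrib using Um st J\<psi> by simp
    then show "(LINT y|?L. (U t y - U s y - J y) * ?\<psi> y) = 0" using key by simp
  qed
  then show ?thesis unfolding J_def by eventually_elim auto
qed


section \<open>Time slices of an evolution\<close>

lemma AE_lborel_obtain_negligible:
  fixes Q :: "real \<Rightarrow> bool"
  assumes "AE x in lborel. Q x"
  obtains M where "negligible M" "\<And>x. x \<notin> M \<Longrightarrow> Q x"
proof -
  have "AE x in lebesgue. Q x" using assms by (simp add: AE_completion_iff)
  then obtain M where "M \<in> null_sets lebesgue" "{x. \<not> Q x} \<subseteq> M"
    unfolding eventually_ae_filter by auto
  then show ?thesis using that[of M] by (auto simp: negligible_iff_null_sets)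
qed

text \<open>The flux of the boundary condition and the flux of the sign condition are a priori two continuous
  representatives \<open>V0\<close> and \<open>V\<close> of \<open>v\<close>; both are primitives of \<open>vx\<close> and they agree at some point, so they are
  equal.\<close>

lemma flux_sliceI:
  assumes ab: "a < b" and W: "W11_deriv a b v vx"
    and V0: "continuous_rep a b v V0" "V0 a = 0" "V0 b = 0"
    and V: "continuous_rep a b v V" and BV: "BV_deriv a b u \<mu> \<nu>" and nn: "nonneg_product a b V \<mu> \<nu>"
    and g: "AE x in lborel. a < x \<longrightarrow> x < b \<longrightarrow> g x = vx x"
    and wm: "w \<in> borel_measurable borel" and w: "AE x in lborel. a < x \<longrightarrow> x < b \<longrightarrow> w x = u x"
  shows "\<exists>V N. flux_slice a b w g V N"
proof -
  have Vc: "continuous_on {a..b} V" using V unfolding continuous_rep_def by auto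
  have eqV: "V y = V0 y" if y: "y \<in> {a..b}" for y
  proof -
    have "AE x in lborel. a < x \<longrightarrow> x < b \<longrightarrow> V x = V0 x"
    proof -
      have "AE x in lborel. x \<in> {a<..<b} \<longrightarrow> V x = v x" "AE x in lborel. x \<in> {a<..<b} \<longrightarrow> V0 x = v x"
        using V V0(1) unfolding continuous_rep_def by (simp_all only: AE_lebesgue_on_iff borel_open open_greaterThanLessThan)
      then show ?thesis by eventually_elim auto
    qed
    then obtain M where M: "negligible M" "\<And>x. x \<notin> M \<Longrightarrow> a < x \<longrightarrow> x < b \<longrightarrow> V x = V0 x"
      using AE_lborel_obtain_negligible by blast
    have "\<not> {a<..<b} \<subseteq> M"
      using M(1) open_not_negligible[of "{a<..<b}"] ab negligible_subset[of M "{a<..<b}"] by auto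
    then obtain x where "x \<in> {a<..<b}" "x \<notin> M" by blast
    with M(2)[of x] have x: "a < x" "x < b" "V x = V0 x" by simp_all
    have "V z - V a = V0 z - V0 a" if "z \<in> {a..b}" for z
      using W11_continuous_primitive[OF W V ab, of a z] W11_continuous_primitive[OF W V0(1) ab, of a z] that by simp
    from this[of x] this[of y] show ?thesis using x y by simp
  qed
  obtain M1 where M1: "negligible M1" "\<And>x. x \<notin> M1 \<Longrightarrow> a < x \<longrightarrow> x < b \<longrightarrow> g x = vx x"
    using AE_lborel_obtain_negligible[OF g] by blast
  obtain M2 where M2: "negligible M2" "\<And>x. x \<notin> M2 \<Longrightarrow> a < x \<longrightarrow> x < b \<longrightarrow> w x = u x"
    using AE_lborel_obtain_negligible[OF w] by blast
  obtain N1 where N1: "negligible N1" "\<And>p q. a < p \<Longrightarrow> p < q \<Longrightarrow> q < b \<Longrightarrow> p \<notin> N1 \<Longrightarrow> q \<notin> N1 \<Longrightarrow>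
      (\<And>x. x \<in> {p..q} \<Longrightarrow> V x > 0) \<Longrightarrow> u p \<le> u q"
    using monotone_where_positive[OF BV Vc nn] by blast
  have Vc': "continuous_on {a..b} (\<lambda>x. - V x)" using Vc by (intro continuous_intros)
  obtain N2 where N2: "negligible N2" "\<And>p q. a < p \<Longrightarrow> p < q \<Longrightarrow> q < b \<Longrightarrow> p \<notin> N2 \<Longrightarrow> q \<notin> N2 \<Longrightarrow>
      (\<And>x. x \<in> {p..q} \<Longrightarrow> - V x > 0) \<Longrightarrow> - u p \<le> - u q"
    using monotone_where_positive[OF BV_deriv_uminus[OF BV] Vc' nonneg_product_uminus[OF nn]] by blast
  have vxa: "vx absolutely_integrable_on {a..b}"
    using W unfolding W11_deriv_def absolutely_integrable_on_Icc_iff_Ioo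
    by (simp add: integrable_restrict_space set_integrable_def)
  have neg: "negligible (M1 \<union> {a, b})" using M1(1) by auto
  have "flux_slice a b w g V (N1 \<union> N2 \<union> M2)"
  proof
    show "a < b" "continuous_on {a..b} V" "w \<in> borel_measurable borel" by fact+
    show "V a = 0" "V b = 0" using eqV[of a] eqV[of b] V0 ab by auto
    show "g absolutely_integrable_on {a..b}"
      by (rule absolutely_integrable_spike[OF vxa neg]) (use M1(2) in auto)
    show "V y - V x = integral {x..y} g" if "a \<le> x" "x \<le> y" "y \<le> b" for x y
    proof -
      have "integral {x..y} g = integral {x..y} vx"
        by (rule integral_spike[OF neg]) (use M1(2) that in auto)
      then show ?thesis using W11_continuous_primitive[OF W V ab that] by simp
    qed
    show "negligible (N1 \<union> N2 \<union> M2)" using N1(1) N2(1) M2(1) by auto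
    show "w x \<le> w y" if "a < x" "x < y" "y < b" "x \<notin> N1 \<union> N2 \<union> M2" "y \<notin> N1 \<union> N2 \<union> M2"
      "\<And>z. z \<in> {x..y} \<Longrightarrow> 0 < V z" for x y
      using N1(2)[of x y] M2(2)[of x] M2(2)[of y] that by auto
    show "w y \<le> w x" if "a < x" "x < y" "y < b" "x \<notin> N1 \<union> N2 \<union> M2" "y \<notin> N1 \<union> N2 \<union> M2"
      "\<And>z. z \<in> {x..y} \<Longrightarrow> V z < 0" for x y
      using N2(2)[of x y] M2(2)[of x] M2(2)[of y] that by auto
  qed
  then show ?thesis by blast
qed

text \<open>On \<open>[s, t]\<close> the curve \<open>U\<close> has the jointly measurable representative \<open>w\<close>, to which the propagation result
  applies. The second claim is the first one for the evolution \<open>(-u, -v)\<close>.\<close>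

lemma evolution_oscillation_mono:
  assumes ab: "a < b" and uv: "uv_evolution a b u v" and L1: "L1_continuous_rep a b u U"
    and st: "0 \<le> s" "s \<le> t"
  shows "oscillation_le a b n (U s) k \<Longrightarrow> oscillation_le a b n (U t) k"
    and "oscillation_le a b n (\<lambda>x. - U s x) k \<Longrightarrow> oscillation_le a b n (\<lambda>x. - U t x) k"
proof -
  \<comment> \<open>Any positive \<open>T \<ge> t\<close> serves; \<open>t\<close> itself may be \<open>0\<close>.\<close>
  define T where "T = t + 1"
  have T: "0 < T" "t \<le> T" "s \<le> T" using st by (auto simp: T_def)
  let ?\<Omega> = "{0<..} \<times> {a<..<b} :: (real \<times> real) set" and ?R = "{0<..<T} \<times> {a<..<b} :: (real \<times> real) set"
  have \<Omega>b: "?\<Omega> \<in> sets borel" and Rb: "?R \<in> sets borel" by (intro borel_open open_Times; simp)+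
  obtain ut vx where wd: "weak_time_deriv ?\<Omega> u ut"
    and vxW: "AE t in lebesgue_on {0<..}. W11_deriv a b (v t) (vx t)"
    and vxi: "\<forall>T>0. integrable (lebesgue_on ({0<..<T} \<times> {a<..<b})) (\<lambda>(t, x). vx t x)"
    and eq: "AE p in lebesgue_on ?\<Omega>. ut (fst p) (snd p) = vx (fst p) (snd p)"
    using uv unfolding uv_evolution_def by blast
  have "integrable (lebesgue_on ?R) (\<lambda>z. vx (fst z) (snd z))"
    using vxi T by (simp add: case_prod_beta')
  then obtain g where g: "g \<in> borel_measurable borel" "integrable lborel g"
    and gvx: "AE z in lborel. z \<in> ?R \<longrightarrow> g z = vx (fst z) (snd z)"
    using integrable_borel_version[OF Rb] by blast
  have gut: "AE z in lborel. z \<in> ?R \<longrightarrow> g z = ut (fst z) (snd z)"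
    using gvx eq[unfolded AE_lebesgue_on_iff[OF \<Omega>b]] by eventually_elim auto
  have ib: "{a<..<b} \<in> sets borel" by simp
  have "integrable (lebesgue_on {a<..<b}) (U s)" using L1 st unfolding L1_continuous_rep_def by blast
  from integrable_borel_version[OF ib this] obtain w0 where w0: "w0 \<in> borel_measurable borel" and w0U: "AE x in lborel. x \<in> {a<..<b} \<longrightarrow> w0 x = U s x"
    by blast
  define w where "w r x = w0 x + (LINT q|lborel. indicator {s<..r} q * g (q, x))" for r x
  have Uw: "AE x in lborel. a < x \<longrightarrow> x < b \<longrightarrow> U r x = w r x" if "s \<le> r" "r \<le> T" for r
    using borel_representative_flow[OF ab wd L1 g gut st(1) that T(1)] w0U
    by eventually_elim (auto simp: w_def)
  have gp: "integrable (lborel \<Otimes>\<^sub>M lborel) (\<lambda>(r, x). g (r, x))"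
    using g(2) by (simp add: lborel_prod)
  note g(1)[measurable] w0[measurable]
  have wm: "w r \<in> borel_measurable borel" for r
  proof -
    have "(\<lambda>(x, q). indicator {s<..r} q * g (q, x)) \<in> borel_measurable (borel \<Otimes>\<^sub>M lborel)"
      by measurable
    from lborel.borel_measurable_lebesgue_integral[OF this] show ?thesis
      unfolding w_def[abs_def] using w0 by (intro borel_measurable_add) auto
  qed
  have slices: "AE r in lborel. s < r \<longrightarrow> r < T \<longrightarrow> (\<exists>V N. flux_slice a b (w r) (\<lambda>x. g (r, x)) V N)"
  proof -
    have pos: "{0<..} \<in> sets (borel :: real measure)" by simp
    have 1: "AE r in lborel. r \<in> {0<..} \<longrightarrow> W11_deriv a b (v r) (vx r)"
      using vxW unfolding AE_lebesgue_on_iff[OF pos] .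
    have "AE r in lebesgue_on {0<..}. \<exists>V. continuous_rep a b (v r) V \<and> V a = 0 \<and> V b = 0"
      using uv unfolding uv_evolution_def by blast
    then have 2: "AE r in lborel. r \<in> {0<..} \<longrightarrow> (\<exists>V. continuous_rep a b (v r) V \<and> V a = 0 \<and> V b = 0)"
      unfolding AE_lebesgue_on_iff[OF pos] .
    have "AE r in lebesgue_on {0<..}. \<exists>V \<mu> \<nu>. continuous_rep a b (v r) V \<and> BV_deriv a b (u r) \<mu> \<nu> \<and> nonneg_product a b V \<mu> \<nu>"
      using uv unfolding uv_evolution_def by blast
    then have 3: "AE r in lborel. r \<in> {0<..} \<longrightarrow>
        (\<exists>V \<mu> \<nu>. continuous_rep a b (v r) V \<and> BV_deriv a b (u r) \<mu> \<nu> \<and> nonneg_product a b V \<mu> \<nu>)"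
      unfolding AE_lebesgue_on_iff[OF pos] .
    have "AE r in lebesgue_on {0<..}. AE x in lebesgue_on {a<..<b}. U r x = u r x"
      using L1 unfolding L1_continuous_rep_def by blast
    then have 4: "AE r in lborel. r \<in> {0<..} \<longrightarrow> (AE x in lborel. x \<in> {a<..<b} \<longrightarrow> U r x = u r x)"
      unfolding AE_lebesgue_on_iff[OF pos] by (simp only: AE_lebesgue_on_iff borel_open open_greaterThanLessThan)
    have "AE z in lborel \<Otimes>\<^sub>M lborel. z \<in> ?R \<longrightarrow> g z = vx (fst z) (snd z)" using gvx by (simp only: lborel_prod)
    from lborel_pair.AE_pair[OF this]
    have 5: "AE r in lborel. AE x in lborel. (r, x) \<in> ?R \<longrightarrow> g (r, x) = vx r x" by simp
    from 1 2 3 4 5 show ?thesis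
    proof eventually_elim
      case (elim r)
      show ?case
      proof (intro impI)
        assume r: "s < r" "r < T"
        then have r0: "r \<in> {0<..}" using st by auto
        obtain V0 where V0: "continuous_rep a b (v r) V0" "V0 a = 0" "V0 b = 0" using elim(2) r0 by blast
        obtain V \<mu> \<nu> where V: "continuous_rep a b (v r) V" "BV_deriv a b (u r) \<mu> \<nu>" "nonneg_product a b V \<mu> \<nu>"
          using elim(3) r0 by blast
        have gv: "AE x in lborel. a < x \<longrightarrow> x < b \<longrightarrow> g (r, x) = vx r x"
          using elim(5) by eventually_elim (use r st in auto)
        have "AE x in lborel. x \<in> {a<..<b} \<longrightarrow> U r x = u r x" using elim(4) r0 by blast
        with Uw[of r] have wu: "AE x in lborel. a < x \<longrightarrow> x < b \<longrightarrow> w r x = u r x"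
          using r by (auto elim: eventually_elim2)
        show "\<exists>V N. flux_slice a b (w r) (\<lambda>x. g (r, x)) V N"
          by (rule flux_sliceI[OF ab elim(1)[rule_format, OF r0] V0 V gv wm wu])
      qed
    qed
  qed
  have w0s: "AE x in lborel. a < x \<longrightarrow> x < b \<longrightarrow> U s x = w0 x"
    using w0U by eventually_elim auto
  have sym: "AE x in lborel. a < x \<longrightarrow> x < b \<longrightarrow> w t x = U t x"
    using Uw[OF st(2) T(2)] by eventually_elim auto
  show "oscillation_le a b n (U t) k" if osc: "oscillation_le a b n (U s) k"
  proof -
    have "oscillation_le a b n w0 k" by (rule oscillation_le_cong_AE[OF osc w0s])
    from oscillation_le_propagates[OF ab w0 gp w_def slices this st(2) T(2)]
    have "oscillation_le a b n (w t) k" .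
    then show ?thesis by (rule oscillation_le_cong_AE[OF _ sym])
  qed
  show "oscillation_le a b n (\<lambda>x. - U t x) k" if osc: "oscillation_le a b n (\<lambda>x. - U s x) k"
  proof -
    have "oscillation_le a b n (\<lambda>x. - w0 x) k"
      by (rule oscillation_le_cong_AE[OF osc]) (use w0s in eventually_elim, auto)
    moreover have "integrable (lborel \<Otimes>\<^sub>M lborel) (\<lambda>(r, x). - g (r, x))"
      using gp by (simp add: case_prod_beta')
    moreover have "- w r x = - w0 x + (LINT q|lborel. indicator {s<..r} q * - g (q, x))" for r x
      by (simp add: w_def)
    moreover have "AE r in lborel. s < r \<longrightarrow> r < T \<longrightarrow> (\<exists>V N. flux_slice a b (\<lambda>x. - w r x) (\<lambda>x. - g (r, x)) V N)"
      using slices by eventually_elim (use flux_slice.flux_slice_uminus in blast)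
    ultimately have "oscillation_le a b n (\<lambda>x. - w t x) k"
      using oscillation_le_propagates[OF ab, of "\<lambda>x. - w0 x" "\<lambda>r x. - g (r, x)" "\<lambda>r x. - w r x" s T n k t] w0 st T
      by simp
    then show ?thesis
      by (rule oscillation_le_cong_AE) (use sym in eventually_elim, auto)
  qed
qed

section \<open>Essential suprema and total variations\<close>

lemma oscillation_le_1:
  "oscillation_le a b 1 w k \<longleftrightarrow> (AE x in lborel. a < x \<longrightarrow> x < b \<longrightarrow> - w x \<le> k)"
proof
  assume "oscillation_le a b 1 w k"
  then obtain N where N: "negligible N"
    "\<And>x. ordered_chain a b 1 x \<Longrightarrow> (\<forall>i\<in>{1..1}. x i \<notin> N) \<Longrightarrow> alternating_sum 1 w x \<le> k"
    unfolding oscillation_le_def by blast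
  have "AE x in lebesgue. x \<notin> N" using N(1) by (intro AE_not_in) (simp add: negligible_iff_null_sets)
  then have "AE x in lborel. x \<notin> N" by (simp add: AE_completion_iff)
  then show "AE x in lborel. a < x \<longrightarrow> x < b \<longrightarrow> - w x \<le> k"
  proof eventually_elim
    case (elim x)
    then show ?case using N(2)[of "\<lambda>_. x"] by (auto simp: ordered_chain_def alternating_sum_def)
  qed
next
  assume "AE x in lborel. a < x \<longrightarrow> x < b \<longrightarrow> - w x \<le> k"
  then obtain M where M: "negligible M" "\<And>x. x \<notin> M \<Longrightarrow> a < x \<longrightarrow> x < b \<longrightarrow> - w x \<le> k"
    using AE_lborel_obtain_negligible by blast
  show "oscillation_le a b 1 w k"
    unfolding oscillation_le_def
  proof (intro exI[of _ M] conjI allI impI M(1))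
    fix x :: "nat \<Rightarrow> real" assume "ordered_chain a b 1 x" "\<forall>i\<in>{1..1}. x i \<notin> M"
    then show "alternating_sum 1 w x \<le> k"
      using M(2)[of "x 1"] by (simp add: ordered_chain_def alternating_sum_def)
  qed
qed

lemma esssup_interval_le_iff:
  assumes "w \<in> borel_measurable (lebesgue_on {a<..<b})"
  shows "esssup (lebesgue_on {a<..<b}) (\<lambda>x. ereal (w x)) \<le> ereal k \<longleftrightarrow> oscillation_le a b 1 (\<lambda>x. - w x) k"
proof -
  have m: "(\<lambda>x. ereal (w x)) \<in> borel_measurable (lebesgue_on {a<..<b})" using assms by measurable
  have "esssup (lebesgue_on {a<..<b}) (\<lambda>x. ereal (w x)) \<le> ereal k \<longleftrightarrow>
      (AE x in lebesgue_on {a<..<b}. ereal (w x) \<le> ereal k)"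
  proof
    assume le: "esssup (lebesgue_on {a<..<b}) (\<lambda>x. ereal (w x)) \<le> ereal k"
    show "AE x in lebesgue_on {a<..<b}. ereal (w x) \<le> ereal k"
      using esssup_AE[of "\<lambda>x. ereal (w x)" "lebesgue_on {a<..<b}"]
      by eventually_elim (rule order_trans[OF _ le])
  qed (rule esssup_I[OF m])
  also have "\<dots> \<longleftrightarrow> oscillation_le a b 1 (\<lambda>x. - w x) k"
    unfolding oscillation_le_1 by (simp add: AE_lebesgue_on_iff imp_conjL)
  finally show ?thesis .
qed

text \<open>Both sides say that the alternating sum is bounded by \<open>k\<close>, on the left almost everywhere in the simplex and
  on the right at all points with coordinates off a null set of the line.\<close>

lemma esssup_simplex_le_iff:
  assumes w: "integrable (lebesgue_on {a<..<b}) w"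
  shows "esssup (simplex_measure a b n) (\<lambda>x. ereal (\<Sum>i=1..n. (-1) ^ i * w (x i))) \<le> ereal k
    \<longleftrightarrow> oscillation_le a b n w k"
proof -
  let ?P = "PiM {1..n} (\<lambda>_. lborel :: real measure)"
  let ?S = "{x \<in> space ?P. (\<forall>i\<in>{1..n}. a < x i \<and> x i < b) \<and> (\<forall>i\<in>{1..<n}. x i < x (Suc i))}"
  have sf: "sigma_finite_measure (lborel :: real measure)" by (rule lborel.sigma_finite_measure_axioms)
  have Sb: "?S \<in> sets ?P"
    using ordered_chain_measurable[OF sets_lborel, where n = n and a = a and b = b] unfolding pred_def ordered_chain_def .
  have m: "(\<lambda>x. ereal (\<Sum>i=1..n. (-1) ^ i * w (x i))) \<in> borel_measurable (simplex_measure a b n)"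
    by (rule alternating_sum_measurable) (use w in auto)
  have "esssup (simplex_measure a b n) (\<lambda>x. ereal (\<Sum>i=1..n. (-1) ^ i * w (x i))) \<le> ereal k \<longleftrightarrow>
      (AE x in simplex_measure a b n. ereal (\<Sum>i=1..n. (-1) ^ i * w (x i)) \<le> ereal k)"
  proof
    assume le: "esssup (simplex_measure a b n) (\<lambda>x. ereal (\<Sum>i=1..n. (-1) ^ i * w (x i))) \<le> ereal k"
    show "AE x in simplex_measure a b n. ereal (\<Sum>i=1..n. (-1) ^ i * w (x i)) \<le> ereal k"
      using esssup_AE[of "\<lambda>x. ereal (\<Sum>i=1..n. (-1) ^ i * w (x i))" "simplex_measure a b n"]
      by eventually_elim (rule order_trans[OF _ le])
  qed (rule esssup_I[OF m])
  also have "\<dots> \<longleftrightarrow> (AE x in ?P. ordered_chain a b n x \<longrightarrow> alternating_sum n w x \<le> k)"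
  proof -
    have S: "?S \<inter> space (completion ?P) \<in> sets (completion ?P)"
      using sets_completionI_sets[OF Sb] by (simp add: Int_absorb2)
    have "(AE x in simplex_measure a b n. ereal (\<Sum>i=1..n. (-1) ^ i * w (x i)) \<le> ereal k) \<longleftrightarrow>
        (AE x in ?P. x \<in> ?S \<longrightarrow> ereal (\<Sum>i=1..n. (-1) ^ i * w (x i)) \<le> ereal k)"
      unfolding simplex_measure_def AE_restrict_space_iff[OF S] AE_completion_iff ..
    also have "\<dots> \<longleftrightarrow> (AE x in ?P. ordered_chain a b n x \<longrightarrow> alternating_sum n w x \<le> k)"
      by (rule AE_cong) (auto simp: ordered_chain_def alternating_sum_def)
    finally show ?thesis .
  qed
  also have "\<dots> \<longleftrightarrow> oscillation_le a b n w k"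
  proof
    assume ae: "AE x in ?P. ordered_chain a b n x \<longrightarrow> alternating_sum n w x \<le> k"
    have ib: "{a<..<b} \<in> sets borel" by simp
    from integrable_borel_version[OF ib w] obtain w'
      where w': "w' \<in> borel_measurable borel" "AE x in lborel. x \<in> {a<..<b} \<longrightarrow> w' x = w x"
      by blast
    from AE_PiM_coordinates[OF sf finite_atLeastAtMost w'(2), of 1 n] ae
    have "AE x in ?P. ordered_chain a b n x \<longrightarrow> alternating_sum n w' x \<le> k"
    proof eventually_elim
      case (elim x)
      show ?case
      proof
        assume oc: "ordered_chain a b n x"
        then have "alternating_sum n w' x = alternating_sum n w x"
          unfolding alternating_sum_def using elim(1) by (intro sum.cong) (auto simp: ordered_chain_def)
        then show "alternating_sum n w' x \<le> k" using elim(2) oc by simp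
      qed
    qed
    from oscillation_le_of_AE_PiM[OF sf sets_lborel _ w'(1) this]
    have "oscillation_le a b n w' k" by blast
    then show "oscillation_le a b n w k"
      by (rule oscillation_le_cong_AE) (use w'(2) in eventually_elim, auto)
  next
    assume "oscillation_le a b n w k"
    from AE_PiM_of_oscillation_le[OF sf _ this]
    show "AE x in ?P. ordered_chain a b n x \<longrightarrow> alternating_sum n w x \<le> k" by blast
  qed
  finally show ?thesis .
qed

lemma esssup_interval_mono:
  assumes "integrable (lebesgue_on {a<..<b}) w" "integrable (lebesgue_on {a<..<b}) w'"
    and "\<And>k. oscillation_le a b 1 (\<lambda>x. - w x) k \<Longrightarrow> oscillation_le a b 1 (\<lambda>x. - w' x) k"
  shows "esssup (lebesgue_on {a<..<b}) (\<lambda>x. ereal (w' x)) \<le> esssup (lebesgue_on {a<..<b}) (\<lambda>x. ereal (w x))"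
proof (rule ereal_le_real)
  fix k assume "esssup (lebesgue_on {a<..<b}) (\<lambda>x. ereal (w x)) \<le> ereal k"
  then show "esssup (lebesgue_on {a<..<b}) (\<lambda>x. ereal (w' x)) \<le> ereal k"
    using assms(3)[of k] esssup_interval_le_iff[OF borel_measurable_integrable[OF assms(1)], of k]
      esssup_interval_le_iff[OF borel_measurable_integrable[OF assms(2)], of k] by blast
qed

lemma TV_plus_mono:
  assumes "integrable (lebesgue_on {a<..<b}) w" "integrable (lebesgue_on {a<..<b}) w'"
    and "\<And>n k. oscillation_le a b n w k \<Longrightarrow> oscillation_le a b n w' k"
  shows "TV_plus a b w' \<le> TV_plus a b w"
proof -
  have "esssup (simplex_measure a b n) (\<lambda>x. ereal (\<Sum>i=1..n. (-1) ^ i * w' (x i)))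
      \<le> esssup (simplex_measure a b n) (\<lambda>x. ereal (\<Sum>i=1..n. (-1) ^ i * w (x i)))" for n
  proof (rule ereal_le_real)
    fix k assume "esssup (simplex_measure a b n) (\<lambda>x. ereal (\<Sum>i=1..n. (-1) ^ i * w (x i))) \<le> ereal k"
    then show "esssup (simplex_measure a b n) (\<lambda>x. ereal (\<Sum>i=1..n. (-1) ^ i * w' (x i))) \<le> ereal k"
      using assms(3)[of n k] esssup_simplex_le_iff[OF assms(1), of n k] esssup_simplex_le_iff[OF assms(2), of n k]
      by blast
  qed
  then show ?thesis unfolding TV_plus_def by (intro SUP_mono) blast
qed

theorem proposition2p10:
  fixes a b :: real and u v U :: "real \<Rightarrow> real \<Rightarrow> real"
  assumes "a < b"
    and "uv_evolution a b u v"
    and "L1_continuous_rep a b u U"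
  shows "antimono_on {0..} (\<lambda>t. ess_sup_on a b (U t))
    \<and> mono_on {0..} (\<lambda>t. ess_inf_on a b (U t))
    \<and> antimono_on {0..} (\<lambda>t. TV_plus a b (U t))
    \<and> antimono_on {0..} (\<lambda>t. TV_minus a b (U t))"
proof -
  have int: "integrable (lebesgue_on {a<..<b}) (U t)" "integrable (lebesgue_on {a<..<b}) (\<lambda>x. - U t x)"
    if "0 \<le> t" for t
    using assms(3) that unfolding L1_continuous_rep_def by auto
  have "ess_sup_on a b (U t) \<le> ess_sup_on a b (U s) \<and> ess_inf_on a b (U s) \<le> ess_inf_on a b (U t)
      \<and> TV_plus a b (U t) \<le> TV_plus a b (U s) \<and> TV_minus a b (U t) \<le> TV_minus a b (U s)"
    if st: "0 \<le> s" "s \<le> t" for s t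
  proof (intro conjI)
    have t: "0 \<le> t" using st by simp
    note osc = evolution_oscillation_mono[OF assms st]
    show "ess_sup_on a b (U t) \<le> ess_sup_on a b (U s)"
      unfolding ess_sup_on_def by (rule esssup_interval_mono[OF int(1)[OF st(1)] int(1)[OF t] osc(2)])
    have "oscillation_le a b 1 (\<lambda>x. - (- U s x)) k \<Longrightarrow> oscillation_le a b 1 (\<lambda>x. - (- U t x)) k" for k
      using osc(1)[of 1 k] by simp
    from esssup_interval_mono[OF int(2)[OF st(1)] int(2)[OF t] this]
    show "ess_inf_on a b (U s) \<le> ess_inf_on a b (U t)" by (simp add: ess_inf_on_def)
    show "TV_plus a b (U t) \<le> TV_plus a b (U s)"
      by (rule TV_plus_mono[OF int(1)[OF st(1)] int(1)[OF t] osc(1)])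
    show "TV_minus a b (U t) \<le> TV_minus a b (U s)"
      unfolding TV_minus_def by (rule TV_plus_mono[OF int(2)[OF st(1)] int(2)[OF t] osc(2)])
  qed
  then show ?thesis by (simp add: monotone_on_def)
qed

end
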